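(* Let $m\ge4$ and for $\vec t=(t_1,\dots,t_m)\in\mathbb R^m$ write $V_{\vec t}(x)=x^4-4x^2+\sum_{j=1}^m t_jx^j$. Suppose $V_{\vec t}\in P_m^{(2)}$. Then there exists a continuous path $\tau\mapsto\vec t(\tau)$, $[0,1]\to\mathbb R^m$, with $\vec t(0)=0$ (so $V_{\vec t(0)}(x)=x^4-4x^2$), $\vec t(1)=\vec t$, and $V_{\vec t(\tau)}\in P_m^{(2)}$ for all $\tau\in[0,1]$.
   Context: $P_m$ is the set of real polynomials of even degree $\le m$ with positive leading coefficient and $V(0)=0$. For $V\in P_m$, $\mu_V$ is the unique Borel probability measure on $\mathbb R$ minimizing $\iint\log|x-y|^{-1}d\mu(x)d\mu(y)+\int Vd\mu$; it satisfies $2\int\log|x-y|d\mu_V(y)-V(x)=\ell_V$ on $\operatorname{supp}\mu_V$ and $\le \ell_V$ on $\mathbb R$ for a constant $\ell_V$. $V$ is $k$-cut regular if $\operatorname{supp}\mu_V$ is a union of exactly $k$ disjoint compact intervals $\cup_j[\alpha_j,\beta_j]$, the density of $\mu_V$ equals $\frac1c\sqrt{|\prod_j(x-\alpha_j)(x-\beta_j)|}\,|h(x)|$ with $h$ a polynomial without zeros on $\operatorname{supp}\mu_V$, and the inequality is strict on $\mathbb R\setminus\operatorname{supp}\mu_V$. $P_m^{(k)}\subset P_m$ denotes the $k$-cut regular elements. *)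

theory Defs
  imports "HOL-Probability.Probability" "HOL-Computational_Algebra.Polynomial"
begin

definition in_P :: "nat \<Rightarrow> real poly \<Rightarrow> bool" where
  "in_P m V \<longleftrightarrow> even (degree V) \<and> degree V \<le> m \<and> lead_coeff V > 0 \<and> poly V 0 = 0"

definition borel_prob :: "real measure \<Rightarrow> bool" where
  "borel_prob \<mu> \<longleftrightarrow> prob_space \<mu> \<and> sets \<mu> = sets borel"

text \<open>Symmetrised integrand of the weighted logarithmic energy:
  log|x-y|^{-1} + V(x)/2 + V(y)/2 (off the diagonal).\<close>
definition log_kernel :: "real poly \<Rightarrow> real \<Rightarrow> real \<Rightarrow> real" where
  "log_kernel V x y = - ln \<bar>x - y\<bar> + (poly V x + poly V y) / 2"

definition energy_pos :: "real poly \<Rightarrow> real measure \<Rightarrow> ennreal" where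
  "energy_pos V \<mu> = (\<integral>\<^sup>+ z. (if fst z = snd z then \<infinity>
        else ennreal (max 0 (log_kernel V (fst z) (snd z)))) \<partial>(\<mu> \<Otimes>\<^sub>M \<mu>))"

definition energy_neg :: "real poly \<Rightarrow> real measure \<Rightarrow> ennreal" where
  "energy_neg V \<mu> = (\<integral>\<^sup>+ z. (if fst z = snd z then 0
        else ennreal (max 0 (- log_kernel V (fst z) (snd z)))) \<partial>(\<mu> \<Otimes>\<^sub>M \<mu>))"

text \<open>The weighted energy  \<integral>\<integral> log|x-y|^{-1} d\<mu> d\<mu> + \<integral> V d\<mu>, as an extended real.\<close>
definition energy :: "real poly \<Rightarrow> real measure \<Rightarrow> ereal" where
  "energy V \<mu> = enn2ereal (energy_pos V \<mu>) - enn2ereal (energy_neg V \<mu>)"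

definition is_equilibrium :: "real poly \<Rightarrow> real measure \<Rightarrow> bool" where
  "is_equilibrium V \<mu> \<longleftrightarrow> borel_prob \<mu> \<and>
     (\<forall>\<nu>. borel_prob \<nu> \<longrightarrow> energy V \<mu> \<le> energy V \<nu>)"

definition eq_measure :: "real poly \<Rightarrow> real measure" where
  "eq_measure V = (THE \<mu>. is_equilibrium V \<mu>)"

definition msupport :: "real measure \<Rightarrow> real set" where
  "msupport \<mu> = {x. \<forall>e>0. emeasure \<mu> (ball x e) > 0}"

definition cut_regular :: "nat \<Rightarrow> real poly \<Rightarrow> bool" where
  "cut_regular k V \<longleftrightarrow>
    (let \<mu> = eq_measure V; S = msupport \<mu> in
     \<exists>\<alpha> \<beta> :: nat \<Rightarrow> real.
       (\<forall>j<k. \<alpha> j < \<beta> j) \<and> (\<forall>j. Suc j < k \<longrightarrow> \<beta> j < \<alpha> (Suc j)) \<and>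
       S = (\<Union>j<k. {\<alpha> j .. \<beta> j}) \<and>
       (\<exists>c::real. \<exists>h::real poly. c > 0 \<and> (\<forall>x\<in>S. poly h x \<noteq> 0) \<and>
          \<mu> = density lborel (\<lambda>x. ennreal (indicator S x * (1 / c) *
                 sqrt \<bar>\<Prod>j<k. (x - \<alpha> j) * (x - \<beta> j)\<bar> * \<bar>poly h x\<bar>))) \<and>
       (\<exists>lv::real.
          (\<forall>x\<in>S. 2 * (\<integral>y. ln \<bar>x - y\<bar> \<partial>\<mu>) - poly V x = lv) \<and>
          (\<forall>x. x \<notin> S \<longrightarrow> 2 * (\<integral>y. ln \<bar>x - y\<bar> \<partial>\<mu>) - poly V x < lv)))"

definition in_P_cut :: "nat \<Rightarrow> nat \<Rightarrow> real poly \<Rightarrow> bool" where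
  "in_P_cut m k V \<longleftrightarrow> in_P m V \<and> cut_regular k V"

definition V_t :: "nat \<Rightarrow> (nat \<Rightarrow> real) \<Rightarrow> real poly" where
  "V_t m t = [:0, 0, -4, 0, 1:] + (\<Sum>j\<in>{1..m}. monom (t j) j)"

end

theory Submission
  imports Defs "HOL-Complex_Analysis.Complex_Analysis" "HOL-Real_Asymp.Real_Asymp"
begin

text \<open>
  For a fixed support the Euler--Lagrange conditions are linear in the pair (potential, measure).
  Hence a two-cut regular \<open>V\<close> can be joined by a segment to any other two-cut potential with the same
  support, provided that the polynomial factors \<open>h\<close> of the two densities have the same sign pattern on
  the cuts; in fact \<open>h\<close> always changes sign across the gap. On every support
  \<open>[a,b] \<union> [c,d]\<close> there is a quartic two-cut potential whose density is proportional to
  \<open>|x - e| \<surd>|R(x)|\<close> with \<open>R(x) = (x-a)(x-b)(x-c)(x-d)\<close>, where \<open>e\<close> is the \<open>\<surd>R\<close>-barycentre of the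
  gap, so that the effective potential takes the same value on both cuts. It depends continuously on
  the endpoints, and moving these linearly to \<open>-\<surd>3, -1, 1, \<surd>3\<close> leads to \<open>x\<^sup>4 - 4x\<^sup>2\<close>.

  That the Euler--Lagrange conditions single out the equilibrium measure rests on the representation of
  \<open>-log|x-y|\<close>, up to an error of size \<open>|x-y|/2R\<close> and a constant, as the measure of the set of balls of radius
  at most \<open>R\<close> that contain both points, which makes the kernel positive definite.
\<close>

section \<open>The weighted energy as a mutual energy\<close>

text \<open>\<open>cut_regular\<close> reaches the measure only through \<open>eq_measure\<close>, a
  definite description, so translating it into data on the endpoints requires that a minimiser
  exists and is unique. \<open>energy\<close> is a difference of two \<open>ennreal\<close>
  integrals; a constant K that makes the kernel nonnegative turns it into a single integral to which
  Tonelli applies, and energies are then compared through identities between sums, because infinite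
  values cannot be subtracted.

  On the complex side, the jump of the Cauchy transform would bring in principal values on the cuts.
  Instead the logarithmic potential itself is extended to the upper half plane: for a continuous
  density it stays continuous down to the real line, where its imaginary part is pi times the tail
  mass, and Schwarz reflection and Liouville suffice.

  The support is held fixed along the segment because a convex combination of two arbitrary two-cut
  potentials has no reason to be two-cut. Since h changes sign, it has a root in the gap; the
  simplest such h has degree one, and it belongs to a quartic potential.\<close>

lemma even_degree_poly_bdd_below:
  fixes p :: "real poly"
  assumes "even (degree p)" "lead_coeff p > 0"
  shows "\<exists>L. \<forall>x. L \<le> poly p x"
proof -
  define q where "q = pcompose p [:0, -1:]"
  have q: "poly q x = poly p (- x)" for x by (simp add: q_def poly_pcompose)
  have lq: "lead_coeff q > 0"
    using assms by (simp add: q_def lead_coeff_comp)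
  obtain n1 where n1: "\<And>x. x \<ge> n1 \<Longrightarrow> poly p x \<ge> lead_coeff p"
    using poly_pinfty_gt_lc[OF assms(2)] by auto
  obtain n2 where n2: "\<And>x. x \<ge> n2 \<Longrightarrow> poly q x \<ge> lead_coeff q"
    using poly_pinfty_gt_lc[OF lq] by auto
  define n where "n = max 0 (max n1 n2)"
  have "compact (poly p ` {-n..n})"
    by (intro compact_continuous_image continuous_intros compact_Icc)
  then have "bdd_below (poly p ` {-n..n})"
    by (intro bounded_imp_bdd_below compact_imp_bounded)
  then obtain L where L: "\<And>x. x \<in> {-n..n} \<Longrightarrow> L \<le> poly p x"
    by (meson bdd_below.E imageI)
  have "min 0 L \<le> poly p x" for x
  proof -
    consider "x \<in> {-n..n}" | "x \<ge> n1" | "-x \<ge> n2" unfolding n_def by force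
    then show ?thesis
    proof cases
      case 1 then show ?thesis using L by (simp add: min.coboundedI2)
    next
      case 2 then show ?thesis using n1[of x] assms(2) by linarith
    next
      case 3 then show ?thesis using n2[of "-x"] lq by (simp add: q min.coboundedI1 order_trans)
    qed
  qed
  then show ?thesis by blast
qed

lemma in_P_degree:
  assumes "in_P m V"
  shows "degree V \<ge> 2"
proof (rule ccontr)
  assume "\<not> 2 \<le> degree V"
  with assms have "degree V = 0" by (auto simp: in_P_def elim!: evenE)
  with assms show False by (auto simp: in_P_def elim!: degree_eq_zeroE)
qed

text \<open>Since V has degree at least 2, V + ax and V - ax keep its leading term and are bounded
  below; each of the two controls one half-line.\<close>

lemma in_P_superlinear:
  assumes "in_P m V"
  shows "\<exists>L. \<forall>x. a * \<bar>x\<bar> - L \<le> poly V x"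
proof -
  have "\<exists>L. \<forall>x. L \<le> poly (V + [:0, s:]) x" for s
  proof (rule even_degree_poly_bdd_below)
    have d: "degree [:0, s:] < degree V" using in_P_degree[OF assms] by simp
    show "even (degree (V + [:0, s:]))"
      using d assms by (simp add: degree_add_eq_left in_P_def)
    have "lead_coeff (V + [:0, s:]) = lead_coeff V"
      using d by (simp add: degree_add_eq_left coeff_eq_0)
    then show "lead_coeff (V + [:0, s:]) > 0" using assms by (simp add: in_P_def)
  qed
  from this[of a] this[of "-a"] obtain L1 L2
    where L: "\<And>x. L1 \<le> poly (V + [:0, a:]) x" "\<And>x. L2 \<le> poly (V + [:0, -a:]) x" by auto
  have *: "L1 \<le> poly V x + a * x" "L2 \<le> poly V x - a * x" for x
    using L(1)[of x] L(2)[of x] by (simp_all add: algebra_simps)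
  have "a * \<bar>x\<bar> - (\<bar>L1\<bar> + \<bar>L2\<bar>) \<le> poly V x" for x
    using *[of x] by (cases "x \<ge> 0") (auto simp: abs_if)
  then show ?thesis by blast
qed

text \<open>Slope 4 for V leaves 2|x| + 2|y| after averaging, and the logarithm uses up at most |x -
  y|; the convention \<open>ln 0 = 0\<close> covers x = y. The surplus |x| + |y| later yields
  tightness and absorbs the error of the ball representation.\<close>

lemma log_kernel_coercive:
  assumes "in_P m V"
  shows "\<exists>K\<ge>0. \<forall>x y. \<bar>x\<bar> + \<bar>y\<bar> \<le> log_kernel V x y + K"
proof -
  obtain L where L: "\<And>x. 4 * \<bar>x\<bar> - L \<le> poly V x"
    using in_P_superlinear[OF assms, of 4] by auto
  have "\<bar>x\<bar> + \<bar>y\<bar> \<le> log_kernel V x y + \<bar>L\<bar>" for x y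
  proof -
    have "ln \<bar>x - y\<bar> \<le> \<bar>x - y\<bar>"
      by (cases "x = y") (auto intro: order_trans[OF ln_le_minus_one])
    then show ?thesis using L[of x] L[of y] unfolding log_kernel_def by (simp add: field_simps)
  qed
  then show ?thesis by (intro exI[of _ "\<bar>L\<bar>"]) auto
qed

text \<open>With K from \<open>log_kernel_coercive\<close> the values are nonnegative, so mutual
  energies always exist in \<open>ennreal\<close>. The diagonal is set by hand, as
  \<open>ln 0 = 0\<close> would give atoms a finite self-energy.\<close>

definition kern :: "real poly \<Rightarrow> real \<Rightarrow> real \<Rightarrow> real \<Rightarrow> ennreal" where
  "kern V K x y = (if x = y then \<infinity> else ennreal (log_kernel V x y + K))"

definition mutual :: "real poly \<Rightarrow> real \<Rightarrow> real measure \<Rightarrow> real measure \<Rightarrow> ennreal" where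
  "mutual V K \<mu> \<nu> = (\<integral>\<^sup>+ x. \<integral>\<^sup>+ y. kern V K x y \<partial>\<nu> \<partial>\<mu>)"

lemma log_kernel_measurable [measurable]:
  assumes [measurable]: "f \<in> borel_measurable M" "g \<in> borel_measurable M"
  shows "(\<lambda>z. log_kernel V (f z) (g z)) \<in> borel_measurable M"
proof -
  have [measurable]: "poly V \<in> borel_measurable borel"
    by (intro borel_measurable_continuous_onI continuous_intros)
  show ?thesis unfolding log_kernel_def by measurable
qed

lemma kern_measurable [measurable]:
  assumes [measurable]: "f \<in> borel_measurable M" "g \<in> borel_measurable M"
  shows "(\<lambda>z. kern V K (f z) (g z)) \<in> borel_measurable M"
  unfolding kern_def by measurable

lemma borel_probD:
  assumes "borel_prob \<mu>"
  shows "prob_space \<mu>" "sets \<mu> = sets borel" "space \<mu> = UNIV"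
  using assms sets_eq_imp_space_eq[of \<mu> borel] by (auto simp: borel_prob_def)

lemma kern_commute: "kern V K x y = kern V K y x"
  by (simp add: kern_def log_kernel_def abs_minus_commute add.commute)

lemma mutual_pair:
  assumes "borel_prob \<mu>" "borel_prob \<nu>"
  shows "mutual V K \<mu> \<nu> = (\<integral>\<^sup>+ z. kern V K (fst z) (snd z) \<partial>(\<mu> \<Otimes>\<^sub>M \<nu>))"
proof -
  interpret \<nu>: prob_space \<nu> using borel_probD[OF assms(2)] by auto
  have [measurable_cong]: "sets \<mu> = sets borel" "sets \<nu> = sets borel"
    using borel_probD[OF assms(1)] borel_probD[OF assms(2)] by auto
  show ?thesis unfolding mutual_def
    by (subst \<nu>.nn_integral_fst[symmetric]) (auto simp: split_beta')
qed

lemma mutual_commute: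
  assumes "borel_prob \<mu>" "borel_prob \<nu>"
  shows "mutual V K \<mu> \<nu> = mutual V K \<nu> \<mu>"
proof -
  interpret \<nu>: prob_space \<nu> using borel_probD[OF assms(2)] by auto
  interpret \<mu>: prob_space \<mu> using borel_probD[OF assms(1)] by auto
  interpret pair_sigma_finite \<mu> \<nu> ..
  have [measurable_cong]: "sets \<mu> = sets borel" "sets \<nu> = sets borel"
    using borel_probD[OF assms(1)] borel_probD[OF assms(2)] by auto
  show ?thesis unfolding mutual_def
    by (subst Fubini') (auto simp: split_beta' kern_commute)
qed

text \<open>Pointwise, \<open>kern\<close> plus the negative part equals the positive part plus K.
  The negative part is at most K, hence has a finite integral, and may be moved across even if the
  energy is infinite.\<close>

lemma energy_eq_mutual:
  assumes K: "K \<ge> 0" "\<And>x y. \<bar>x\<bar> + \<bar>y\<bar> \<le> log_kernel V x y + K" and \<mu>: "borel_prob \<mu>"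
  shows "energy V \<mu> = enn2ereal (mutual V K \<mu> \<mu>) - ereal K"
proof -
  interpret \<mu>: prob_space \<mu> using borel_probD[OF \<mu>] by auto
  interpret pair_prob_space \<mu> \<mu> ..
  have [measurable_cong]: "sets \<mu> = sets borel"
    using borel_probD[OF \<mu>] by auto
  have em: "emeasure (\<mu> \<Otimes>\<^sub>M \<mu>) (space (\<mu> \<Otimes>\<^sub>M \<mu>)) = 1"
    by (rule P.emeasure_space_1)
  have nonneg: "0 \<le> log_kernel V x y + K" for x y using K(2)[of x y] by linarith
  have "mutual V K \<mu> \<mu> + energy_neg V \<mu> =
     (\<integral>\<^sup>+ z. kern V K (fst z) (snd z) + (if fst z = snd z then 0
        else ennreal (max 0 (- log_kernel V (fst z) (snd z)))) \<partial>(\<mu> \<Otimes>\<^sub>M \<mu>))"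
    unfolding mutual_pair[OF \<mu> \<mu>] energy_neg_def by (subst nn_integral_add) auto
  also have "\<dots> = (\<integral>\<^sup>+ z. (if fst z = snd z then \<infinity>
        else ennreal (max 0 (log_kernel V (fst z) (snd z)))) + ennreal K \<partial>(\<mu> \<Otimes>\<^sub>M \<mu>))"
    by (intro nn_integral_cong)
      (use nonneg K(1) in \<open>auto simp: kern_def max_def simp flip: ennreal_plus\<close>)
  also have "\<dots> = energy_pos V \<mu> + ennreal K"
    unfolding energy_pos_def by (subst nn_integral_add) (auto simp: em)
  finally have eq: "mutual V K \<mu> \<mu> + energy_neg V \<mu> = energy_pos V \<mu> + ennreal K" .
  have "energy_neg V \<mu> \<le> (\<integral>\<^sup>+ z. ennreal K \<partial>(\<mu> \<Otimes>\<^sub>M \<mu>))"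
    unfolding energy_neg_def
    by (intro nn_integral_mono) (use nonneg K(1) in \<open>auto simp: max_def intro!: ennreal_leI\<close>, smt (verit) nonneg)
  then have neg: "energy_neg V \<mu> \<le> ennreal K" by (simp add: em)
  then obtain n where n: "energy_neg V \<mu> = ennreal n" "n \<ge> 0"
    by (metis ennreal_cases ennreal_neq_top top.extremum_unique)
  show ?thesis
  proof (cases "energy_pos V \<mu>")
    case (real p)
    then have "mutual V K \<mu> \<mu> < \<top>" using eq n K(1)
      by (metis add_top ennreal_add_eq_top ennreal_neq_top less_top top.not_eq_extremum ennreal_add_eq_top)
    then obtain i where i: "mutual V K \<mu> \<mu> = ennreal i" "i \<ge> 0"
      by (metis ennreal_cases less_irrefl)
    have "i + n = p + K" using eq i n real K(1)
      by (simp flip: ennreal_plus)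
    then show ?thesis unfolding energy_def real i n using i n real K(1)
      by (simp add: enn2ereal_ennreal)
  next
    case top
    then have "mutual V K \<mu> \<mu> = \<top>" using eq n by (simp add: ennreal_add_eq_top)
    then show ?thesis unfolding energy_def top n using n by (simp add: enn2ereal_ennreal)
  qed
qed

lemma is_equilibrium_iff_mutual:
  assumes "K \<ge> 0" "\<And>x y. \<bar>x\<bar> + \<bar>y\<bar> \<le> log_kernel V x y + K"
  shows "is_equilibrium V \<mu> \<longleftrightarrow> borel_prob \<mu> \<and>
           (\<forall>\<nu>. borel_prob \<nu> \<longrightarrow> mutual V K \<mu> \<mu> \<le> mutual V K \<nu> \<nu>)"
proof -
  have "energy V \<mu> \<le> energy V \<nu> \<longleftrightarrow> mutual V K \<mu> \<mu> \<le> mutual V K \<nu> \<nu>"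
    if "borel_prob \<mu>" "borel_prob \<nu>" for \<nu>
    unfolding energy_eq_mutual[OF assms that(1)] energy_eq_mutual[OF assms that(2)]
    by (cases "enn2ereal (mutual V K \<mu> \<mu>)"; cases "enn2ereal (mutual V K \<nu> \<nu>)")
       (auto simp: less_eq_ennreal.rep_eq)
  then show ?thesis unfolding is_equilibrium_def by blast
qed

section \<open>Positive definiteness of the logarithmic kernel\<close>

text \<open>The pair w encodes the ball with centre \<open>fst w\<close> and radius
  \<open>snd w\<close>. Centres of balls of radius r that contain two points at distance s fill a
  length 2r - s, and (2r - s)/(2r^2) has the primitive ln r + s/(2r), whose value at the lower end r
  = s/2 produces -ln s. The cutoff R is needed because the integral diverges for large r.\<close>

definition ball_weight :: "real \<Rightarrow> real \<times> real \<Rightarrow> ennreal" where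
  "ball_weight R w = ennreal (indicator {0<..R} (snd w) / (2 * (snd w)\<^sup>2))"

definition balls_at :: "real \<Rightarrow> (real \<times> real) set" where
  "balls_at x = {w. \<bar>x - fst w\<bar> < snd w}"

definition ball_kernel :: "real \<Rightarrow> real \<Rightarrow> real \<Rightarrow> ennreal" where
  "ball_kernel R x y = (\<integral>\<^sup>+ w. ball_weight R w * (indicator (balls_at x) w * indicator (balls_at y) w)
      \<partial>(lborel \<Otimes>\<^sub>M lborel))"

lemma ball_weight_measurable [measurable]: "ball_weight R \<in> borel_measurable (lborel \<Otimes>\<^sub>M lborel)"
  unfolding ball_weight_def by measurable

lemma balls_at_measurable:
  assumes [measurable]: "f \<in> borel_measurable M" "g \<in> borel_measurable M" "h \<in> borel_measurable M"
  shows "(\<lambda>z. indicator (balls_at (f z)) (g z, h z) :: ennreal) \<in> borel_measurable M"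
  unfolding balls_at_def indicator_def by simp

lemma balls_at_measurable' [measurable]:
  assumes [measurable]: "f \<in> borel_measurable M" "g \<in> measurable M (lborel \<Otimes>\<^sub>M lborel)"
  shows "(\<lambda>z. indicator (balls_at (f z)) (g z) :: ennreal) \<in> borel_measurable M"
proof -
  have [measurable]: "(\<lambda>z. fst (g z)) \<in> borel_measurable M" "(\<lambda>z. snd (g z)) \<in> borel_measurable M"
    using measurable_compose[OF assms(2) measurable_fst] measurable_compose[OF assms(2) measurable_snd]
    by simp_all
  show ?thesis unfolding balls_at_def indicator_def by simp
qed

lemma ball_kernel_eq_radial:
  "ball_kernel R x y =
     (\<integral>\<^sup>+ r. ennreal (indicator {0<..R} r * max 0 (2 * r - \<bar>x - y\<bar>) / (2 * r\<^sup>2)) \<partial>lborel)"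
proof -
  have inner: "(\<integral>\<^sup>+ u. indicator (balls_at x) (u, r) * indicator (balls_at y) (u, r) \<partial>lborel) =
     ennreal (max 0 (2 * r - \<bar>x - y\<bar>))" (is "?L = _") for r
  proof -
    have "?L = (\<integral>\<^sup>+ u. indicator {max x y - r <..< min x y + r} u \<partial>lborel)"
      by (intro nn_integral_cong) (auto simp: balls_at_def indicator_def)
    also have "\<dots> = emeasure lborel {max x y - r <..< min x y + r}" by simp
    also have "\<dots> = ennreal (max 0 (2 * r - \<bar>x - y\<bar>))"
    proof (cases "max x y - r \<le> min x y + r")
      case True
      then show ?thesis by (auto simp: max_def min_def abs_if intro!: arg_cong[of _ _ ennreal])
    next
      case False
      then have "{max x y - r <..< min x y + r} = {}" by auto
      moreover have "max 0 (2 * r - \<bar>x - y\<bar>) = 0" using False by (auto simp: max_def min_def abs_if split: if_splits)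
      ultimately show ?thesis by simp
    qed
    finally show ?thesis .
  qed
  have "ball_kernel R x y = (\<integral>\<^sup>+ r. \<integral>\<^sup>+ u. ball_weight R (u, r) *
      (indicator (balls_at x) (u, r) * indicator (balls_at y) (u, r)) \<partial>lborel \<partial>lborel)"
    unfolding ball_kernel_def by (subst lborel_pair.nn_integral_snd) auto
  also have "\<dots> = (\<integral>\<^sup>+ r. ball_weight R (0, r) * ennreal (max 0 (2 * r - \<bar>x - y\<bar>)) \<partial>lborel)"
    unfolding inner[symmetric]
    by (intro nn_integral_cong, subst nn_integral_cmult[symmetric])
       (auto simp: ball_weight_def intro!: balls_at_measurable borel_measurable_times_ennreal)
  also have "\<dots> = (\<integral>\<^sup>+ r. ennreal (indicator {0<..R} r * max 0 (2 * r - \<bar>x - y\<bar>) / (2 * r\<^sup>2)) \<partial>lborel)"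
    by (intro nn_integral_cong, subst ball_weight_def, subst ennreal_mult[symmetric]) auto
  finally show ?thesis .
qed

lemma radial_integral:
  assumes "0 \<le> s" "0 < a" "s / 2 \<le> a" "a \<le> R"
  shows "(\<integral>\<^sup>+ r. ennreal ((2 * r - s) / (2 * r\<^sup>2)) * indicator {a..R} r \<partial>lborel) =
    ennreal ((ln R + s / (2 * R)) - (ln a + s / (2 * a)))"
proof (rule nn_integral_FTC_Icc[where F = "\<lambda>r. ln r + s / (2 * r)"])
  fix r :: real assume "r \<in> {a..R}"
  then have r: "a \<le> r" "r \<le> R" by auto
  then have "r > 0" using assms by linarith
  then show "((\<lambda>r. ln r + s / (2 * r)) has_real_derivative (2 * r - s) / (2 * r\<^sup>2)) (at r)"
    by (auto intro!: derivative_eq_intros simp: field_simps power2_eq_square)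
  show "0 \<le> (2 * r - s) / (2 * r\<^sup>2)" using r assms by simp
qed (use assms in auto)

text \<open>For s = 0 the radii in [a, R] already contribute ln R - ln a; the choice a = R exp(-n)
  gives the lower bound n.\<close>

lemma ball_kernel_diag:
  assumes "R > 0"
  shows "ball_kernel R x x = \<infinity>"
proof -
  have le: "ennreal (ln R - ln a) \<le> ball_kernel R x x" if "0 < a" "a \<le> R" for a
  proof -
    have "ennreal (ln R - ln a) = (\<integral>\<^sup>+ r. ennreal ((2 * r - 0) / (2 * r\<^sup>2)) * indicator {a..R} r \<partial>lborel)"
      using radial_integral[of 0 a R] that by simp
    also have "\<dots> \<le> ball_kernel R x x"
      unfolding ball_kernel_eq_radial using that
      by (intro nn_integral_mono) (auto simp: indicator_def)
    finally show ?thesis .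
  qed
  have "ennreal (real n) \<le> ball_kernel R x x" for n :: nat
    using le[of "R * exp (- real n)"] assms by (simp add: ln_mult)
  then show ?thesis
    by (metis ennreal_of_nat_eq_real_of_nat infinity_ennreal_def not_le ennreal_Ex_less_of_nat less_top)
qed

text \<open>The amount by which the truncated kernel exceeds -ln s + ln(2R) - 1, where s = |x - y|.
  In the second branch no ball of radius at most R contains both points, so the kernel is 0 and the
  error is whatever cancels the rest. Both branches are at most s/(2R), so the error fades as R
  grows.\<close>

definition ball_error :: "real \<Rightarrow> real \<Rightarrow> real \<Rightarrow> real" where
  "ball_error R x y = (if \<bar>x - y\<bar> < 2 * R then \<bar>x - y\<bar> / (2 * R)
     else ln (\<bar>x - y\<bar> / (2 * R)) + 1)"

lemma ball_error_measurable [measurable]: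
  assumes [measurable]: "f \<in> borel_measurable M" "g \<in> borel_measurable M"
  shows "(\<lambda>z. ball_error R (f z) (g z)) \<in> borel_measurable M"
  unfolding ball_error_def by measurable

lemma ball_error_bounds:
  assumes "R > 0"
  shows "0 \<le> ball_error R x y" "ball_error R x y \<le> (\<bar>x\<bar> + \<bar>y\<bar>) / (2 * R)"
proof -
  show "0 \<le> ball_error R x y"
    using assms by (auto simp: ball_error_def intro!: add_nonneg_nonneg ln_ge_zero)
  have "ball_error R x y \<le> \<bar>x - y\<bar> / (2 * R)"
  proof (cases "\<bar>x - y\<bar> < 2 * R")
    case False
    then have "\<bar>x - y\<bar> / (2 * R) > 0" using assms by auto
    from ln_le_minus_one[OF this] False show ?thesis by (simp add: ball_error_def)
  qed (simp add: ball_error_def)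
  also have "\<dots> \<le> (\<bar>x\<bar> + \<bar>y\<bar>) / (2 * R)"
    using assms by (intro divide_right_mono) auto
  finally show "ball_error R x y \<le> (\<bar>x\<bar> + \<bar>y\<bar>) / (2 * R)" .
qed

lemma ball_kernel_eq:
  assumes "R > 0" "x \<noteq> y"
  shows "ball_kernel R x y = ennreal (- ln \<bar>x - y\<bar> + ln (2 * R) - 1 + ball_error R x y)"
    and "0 \<le> - ln \<bar>x - y\<bar> + ln (2 * R) - 1 + ball_error R x y"
proof -
  define s where "s = \<bar>x - y\<bar>"
  have s: "s > 0" using assms by (simp add: s_def)
  have "ball_kernel R x y = ennreal (- ln s + ln (2 * R) - 1 + ball_error R x y)
     \<and> 0 \<le> - ln s + ln (2 * R) - 1 + ball_error R x y"
  proof (cases "s < 2 * R")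
    case True
    have "ball_kernel R x y = (\<integral>\<^sup>+ r. ennreal ((2 * r - s) / (2 * r\<^sup>2)) * indicator {s/2..R} r \<partial>lborel)"
      unfolding ball_kernel_eq_radial s_def[symmetric]
      using s by (intro nn_integral_cong) (auto simp: indicator_def max_def)
    also have "\<dots> = ennreal ((ln R + s / (2 * R)) - (ln (s / 2) + s / (2 * (s / 2))))"
      using True s assms by (intro radial_integral) auto
    also have "(ln R + s / (2 * R)) - (ln (s / 2) + s / (2 * (s / 2))) =
        - ln s + ln (2 * R) - 1 + ball_error R x y"
      using s assms True by (simp add: ball_error_def s_def[symmetric] ln_div ln_mult)
    finally have 1: "ball_kernel R x y = ennreal (- ln s + ln (2 * R) - 1 + ball_error R x y)" .
    have "ln (2 * R / s) \<ge> 1 - s / (2 * R)"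
      using ln_le_minus_one[of "s / (2 * R)"] s assms by (simp add: ln_div)
    then have "0 \<le> - ln s + ln (2 * R) - 1 + ball_error R x y"
      using s assms True by (simp add: ball_error_def s_def[symmetric] ln_div)
    with 1 show ?thesis by blast
  next
    case False
    have "ball_kernel R x y = (\<integral>\<^sup>+ r. 0 \<partial>(lborel :: real measure))"
      unfolding ball_kernel_eq_radial s_def[symmetric]
      using s False by (intro nn_integral_cong) (auto simp: indicator_def max_def)
    moreover have "- ln s + ln (2 * R) - 1 + ball_error R x y = 0"
      using s assms False by (simp add: ball_error_def s_def[symmetric] ln_div)
    ultimately show ?thesis by simp
  qed
  then show "ball_kernel R x y = ennreal (- ln \<bar>x - y\<bar> + ln (2 * R) - 1 + ball_error R x y)"
    and "0 \<le> - ln \<bar>x - y\<bar> + ln (2 * R) - 1 + ball_error R x y"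
    by (auto simp: s_def)
qed

text \<open>Error and constant are added on the left instead of subtracted on the right, which keeps
  the identity valid in \<open>ennreal\<close>, also on the diagonal where both sides are infinite.
  The bound on ln(2R) makes the added constant nonnegative.\<close>

lemma kern_ball_kernel:
  assumes K: "\<And>x y. \<bar>x\<bar> + \<bar>y\<bar> \<le> log_kernel V x y + K" and R: "ln (2 * R) \<ge> 1" "R > 0"
  shows "kern V K x y + ennreal (ball_error R x y) + ennreal (ln (2 * R) - 1) =
    ball_kernel R x y + (ennreal ((poly V x + K) / 2) + ennreal ((poly V y + K) / 2))"
proof (cases "x = y")
  case True
  then show ?thesis using R by (simp add: kern_def ball_kernel_diag)
next
  case False
  have V: "0 \<le> poly V z + K" for z
    using K[of z z] by (simp add: log_kernel_def)
  have k: "0 \<le> log_kernel V x y + K" using K[of x y] by linarith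
  note b = ball_kernel_eq[OF R(2) False] and e = ball_error_bounds(1)[OF R(2), of x y]
  have "kern V K x y + ennreal (ball_error R x y) + ennreal (ln (2 * R) - 1) =
     ennreal (log_kernel V x y + K + ball_error R x y + (ln (2 * R) - 1))"
    using False e R k by (simp add: kern_def)
  also have "log_kernel V x y + K + ball_error R x y + (ln (2 * R) - 1) =
     (- ln \<bar>x - y\<bar> + ln (2 * R) - 1 + ball_error R x y) + ((poly V x + K) / 2 + (poly V y + K) / 2)"
    by (simp add: log_kernel_def field_simps)
  also have "ennreal \<dots> = ennreal (- ln \<bar>x - y\<bar> + ln (2 * R) - 1 + ball_error R x y) +
     (ennreal ((poly V x + K) / 2) + ennreal ((poly V y + K) / 2))"
    using b(2) V[of x] V[of y] by (simp add: ennreal_plus[symmetric] del: ennreal_plus)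
  finally show ?thesis unfolding b(1) .
qed

definition ball_mass :: "real measure \<Rightarrow> real \<times> real \<Rightarrow> real" where
  "ball_mass \<mu> w = measure \<mu> {x. \<bar>x - fst w\<bar> < snd w}"

lemma ball_mass_eq:
  assumes "borel_prob \<mu>"
  shows "ennreal (ball_mass \<mu> w) = (\<integral>\<^sup>+ x. indicator (balls_at x) w \<partial>\<mu>)"
proof -
  interpret prob_space \<mu> using borel_probD[OF assms] by auto
  have [measurable_cong]: "sets \<mu> = sets borel" using borel_probD[OF assms] by auto
  have "(\<integral>\<^sup>+ x. indicator (balls_at x) w \<partial>\<mu>) = (\<integral>\<^sup>+ x. indicator {x. \<bar>x - fst w\<bar> < snd w} x \<partial>\<mu>)"
    by (intro nn_integral_cong) (auto simp: balls_at_def indicator_def)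
  also have "\<dots> = emeasure \<mu> {x. \<bar>x - fst w\<bar> < snd w}"
    by (intro nn_integral_indicator) (simp add: borel_probD[OF assms])
  finally show ?thesis by (simp add: ball_mass_def emeasure_eq_measure)
qed

lemma ball_mass_measurable [measurable]:
  assumes "borel_prob \<mu>"
  shows "ball_mass \<mu> \<in> borel_measurable (lborel \<Otimes>\<^sub>M lborel)"
proof -
  interpret prob_space \<mu> using borel_probD[OF assms] by auto
  have [measurable_cong]: "sets \<mu> = sets borel" using borel_probD[OF assms] by auto
  have "(\<lambda>w. \<integral>\<^sup>+ x. indicator (balls_at x) w \<partial>\<mu>) \<in> borel_measurable (lborel \<Otimes>\<^sub>M lborel)"
    by measurable
  then have "(\<lambda>w. enn2real (ennreal (ball_mass \<mu> w))) \<in> borel_measurable (lborel \<Otimes>\<^sub>M lborel)"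
    unfolding ball_mass_eq[OF assms] by measurable
  then show ?thesis by (simp add: ball_mass_def[abs_def])
qed

lemma ball_kernel_measurable [measurable]:
  assumes [measurable]: "f \<in> borel_measurable M" "g \<in> borel_measurable M"
  shows "(\<lambda>z. ball_kernel R (f z) (g z)) \<in> borel_measurable M"
  unfolding ball_kernel_eq_radial by measurable

text \<open>The kernel integrates products of indicators, so by Tonelli the double integral over
  points becomes a single integral over balls of a product of masses. For equal measures this is a
  weighted square, which is the source of positive definiteness.\<close>

lemma ball_kernel_mutual:
  assumes "borel_prob \<mu>" "borel_prob \<nu>"
  shows "(\<integral>\<^sup>+ x. \<integral>\<^sup>+ y. ball_kernel R x y \<partial>\<nu> \<partial>\<mu>) =
     (\<integral>\<^sup>+ w. ball_weight R w * ennreal (ball_mass \<mu> w * ball_mass \<nu> w) \<partial>(lborel \<Otimes>\<^sub>M lborel))"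
proof -
  interpret \<nu>: prob_space \<nu> using borel_probD[OF assms(2)] by auto
  interpret \<mu>: prob_space \<mu> using borel_probD[OF assms(1)] by auto
  interpret P: sigma_finite_measure "lborel \<Otimes>\<^sub>M lborel :: (real \<times> real) measure"
    by (simp add: lborel_prod sigma_finite_lborel)
  interpret P\<nu>: pair_sigma_finite \<nu> "lborel \<Otimes>\<^sub>M lborel :: (real \<times> real) measure" ..
  interpret P\<mu>: pair_sigma_finite \<mu> "lborel \<Otimes>\<^sub>M lborel :: (real \<times> real) measure" ..
  have [measurable_cong]: "sets \<mu> = sets borel" "sets \<nu> = sets borel"
    using borel_probD[OF assms(1)] borel_probD[OF assms(2)] by auto
  have 1: "(\<integral>\<^sup>+ y. ball_kernel R x y \<partial>\<nu>) =
     (\<integral>\<^sup>+ w. ball_weight R w * (indicator (balls_at x) w * ennreal (ball_mass \<nu> w)) \<partial>(lborel \<Otimes>\<^sub>M lborel))" for x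
    unfolding ball_kernel_def ball_mass_eq[OF assms(2)]
    by (subst P\<nu>.Fubini'[symmetric]) (auto intro!: nn_integral_cong simp: nn_integral_cmult)
  have "(\<integral>\<^sup>+ x. \<integral>\<^sup>+ y. ball_kernel R x y \<partial>\<nu> \<partial>\<mu>) =
     (\<integral>\<^sup>+ w. (\<integral>\<^sup>+ x. ball_weight R w * (indicator (balls_at x) w * ennreal (ball_mass \<nu> w)) \<partial>\<mu>) \<partial>(lborel \<Otimes>\<^sub>M lborel))"
    unfolding 1 using assms by (subst P\<mu>.Fubini'[symmetric]) auto
  also have "\<dots> = (\<integral>\<^sup>+ w. ball_weight R w * (ennreal (ball_mass \<mu> w) * ennreal (ball_mass \<nu> w)) \<partial>(lborel \<Otimes>\<^sub>M lborel))"
    by (intro nn_integral_cong) (simp add: nn_integral_cmult nn_integral_multc ball_mass_eq[OF assms(1)])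
  finally show ?thesis by (simp add: ennreal_mult ball_mass_def)
qed

text \<open>The quadratic form of the truncated kernel at the signed measure \<mu> - \<nu>. As an
  integral of a square it makes sense even if the individual energies are infinite.\<close>

definition ball_discrepancy :: "real \<Rightarrow> real measure \<Rightarrow> real measure \<Rightarrow> ennreal" where
  "ball_discrepancy R \<mu> \<nu> = (\<integral>\<^sup>+ w. ball_weight R w * ennreal ((ball_mass \<mu> w - ball_mass \<nu> w)\<^sup>2)
      \<partial>(lborel \<Otimes>\<^sub>M lborel))"

lemma ball_discrepancy_mono:
  assumes "R \<le> R'"
  shows "ball_discrepancy R \<mu> \<nu> \<le> ball_discrepancy R' \<mu> \<nu>"
  unfolding ball_discrepancy_def ball_weight_def
  using assms by (intro nn_integral_mono mult_right_mono) (auto simp: indicator_def)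

text \<open>The identity a^2 + b^2 = 2ab + (a - b)^2 under the integral, free of subtractions of
  possibly infinite terms.\<close>

lemma ball_kernel_parallelogram:
  assumes "borel_prob \<mu>" "borel_prob \<nu>"
  shows "(\<integral>\<^sup>+ x. \<integral>\<^sup>+ y. ball_kernel R x y \<partial>\<mu> \<partial>\<mu>) + (\<integral>\<^sup>+ x. \<integral>\<^sup>+ y. ball_kernel R x y \<partial>\<nu> \<partial>\<nu>) =
     2 * (\<integral>\<^sup>+ x. \<integral>\<^sup>+ y. ball_kernel R x y \<partial>\<nu> \<partial>\<mu>) + ball_discrepancy R \<mu> \<nu>"
proof -
  have [measurable]: "ball_mass \<mu> \<in> borel_measurable (lborel \<Otimes>\<^sub>M lborel)"
     "ball_mass \<nu> \<in> borel_measurable (lborel \<Otimes>\<^sub>M lborel)"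
    using assms by simp_all
  have eq: "ball_weight R w * ennreal (a * a) + ball_weight R w * ennreal (b * b) =
      2 * (ball_weight R w * ennreal (a * b)) + ball_weight R w * ennreal ((a - b)\<^sup>2)"
    if "a \<ge> 0" "b \<ge> 0" for w a b
  proof -
    have "ennreal (a * a) + ennreal (b * b) = 2 * ennreal (a * b) + ennreal ((a - b)\<^sup>2)"
    proof -
      have "ennreal (a * a) + ennreal (b * b) = ennreal (2 * (a * b) + (a - b)\<^sup>2)"
        using that by (simp add: ennreal_plus[symmetric] power2_eq_square algebra_simps del: ennreal_plus)
      also have "\<dots> = 2 * ennreal (a * b) + ennreal ((a - b)\<^sup>2)"
        using that by (simp add: ennreal_mult)
      finally show ?thesis .
    qed
    then have "ball_weight R w * (ennreal (a * a) + ennreal (b * b)) =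
       ball_weight R w * (2 * ennreal (a * b) + ennreal ((a - b)\<^sup>2))" by simp
    then show ?thesis by (simp add: algebra_simps)
  qed
  have nn: "ball_mass M w \<ge> 0" for M w by (simp add: ball_mass_def)
  have "(\<integral>\<^sup>+ w. ball_weight R w * ennreal (ball_mass \<mu> w * ball_mass \<mu> w) \<partial>(lborel \<Otimes>\<^sub>M lborel)) +
     (\<integral>\<^sup>+ w. ball_weight R w * ennreal (ball_mass \<nu> w * ball_mass \<nu> w) \<partial>(lborel \<Otimes>\<^sub>M lborel)) =
     (\<integral>\<^sup>+ w. ball_weight R w * ennreal (ball_mass \<mu> w * ball_mass \<mu> w) +
        ball_weight R w * ennreal (ball_mass \<nu> w * ball_mass \<nu> w) \<partial>(lborel \<Otimes>\<^sub>M lborel))"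
    by (subst nn_integral_add) auto
  also have "\<dots> = (\<integral>\<^sup>+ w. 2 * (ball_weight R w * ennreal (ball_mass \<mu> w * ball_mass \<nu> w)) +
        ball_weight R w * ennreal ((ball_mass \<mu> w - ball_mass \<nu> w)\<^sup>2) \<partial>(lborel \<Otimes>\<^sub>M lborel))"
    by (intro nn_integral_cong eq nn)
  also have "\<dots> = 2 * (\<integral>\<^sup>+ w. ball_weight R w * ennreal (ball_mass \<mu> w * ball_mass \<nu> w) \<partial>(lborel \<Otimes>\<^sub>M lborel)) +
     ball_discrepancy R \<mu> \<nu>"
    unfolding ball_discrepancy_def
    by (subst nn_integral_add, simp, simp, subst nn_integral_cmult) auto
  finally show ?thesis
    unfolding ball_kernel_mutual[OF assms(1) assms(1)] ball_kernel_mutual[OF assms(2) assms(2)]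
      ball_kernel_mutual[OF assms] .
qed

lemma mutual_ball_kernel:
  assumes "borel_prob \<mu>" "borel_prob \<nu>"
    and K: "\<And>x y. \<bar>x\<bar> + \<bar>y\<bar> \<le> log_kernel V x y + K" and R: "ln (2 * R) \<ge> 1" "R > 0"
  shows "mutual V K \<mu> \<nu> + (\<integral>\<^sup>+ x. \<integral>\<^sup>+ y. ennreal (ball_error R x y) \<partial>\<nu> \<partial>\<mu>) + ennreal (ln (2 * R) - 1) =
    (\<integral>\<^sup>+ x. \<integral>\<^sup>+ y. ball_kernel R x y \<partial>\<nu> \<partial>\<mu>) + ((\<integral>\<^sup>+ x. ennreal ((poly V x + K) / 2) \<partial>\<mu>) +
      (\<integral>\<^sup>+ x. ennreal ((poly V x + K) / 2) \<partial>\<nu>))"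
proof -
  interpret \<nu>: prob_space \<nu> using borel_probD[OF assms(2)] by auto
  interpret \<mu>: prob_space \<mu> using borel_probD[OF assms(1)] by auto
  have [measurable_cong]: "sets \<mu> = sets borel" "sets \<nu> = sets borel"
    using borel_probD[OF assms(1)] borel_probD[OF assms(2)] by auto
  have [measurable]: "poly V \<in> borel_measurable borel"
    by (intro borel_measurable_continuous_onI continuous_intros)
  have "mutual V K \<mu> \<nu> + (\<integral>\<^sup>+ x. \<integral>\<^sup>+ y. ennreal (ball_error R x y) \<partial>\<nu> \<partial>\<mu>) + ennreal (ln (2 * R) - 1) =
     (\<integral>\<^sup>+ x. \<integral>\<^sup>+ y. kern V K x y + ennreal (ball_error R x y) + ennreal (ln (2 * R) - 1) \<partial>\<nu> \<partial>\<mu>)"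
    unfolding mutual_def
    by (simp add: nn_integral_add \<nu>.emeasure_space_1 \<mu>.emeasure_space_1)
  also have "\<dots> = (\<integral>\<^sup>+ x. \<integral>\<^sup>+ y. ball_kernel R x y + (ennreal ((poly V x + K) / 2) + ennreal ((poly V y + K) / 2)) \<partial>\<nu> \<partial>\<mu>)"
    by (simp add: kern_ball_kernel[OF K R])
  also have "\<dots> = (\<integral>\<^sup>+ x. \<integral>\<^sup>+ y. ball_kernel R x y \<partial>\<nu> \<partial>\<mu>) + ((\<integral>\<^sup>+ x. ennreal ((poly V x + K) / 2) \<partial>\<mu>) +
      (\<integral>\<^sup>+ x. ennreal ((poly V x + K) / 2) \<partial>\<nu>))"
    by (simp add: nn_integral_add \<nu>.emeasure_space_1 \<mu>.emeasure_space_1)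
  finally show ?thesis .
qed

text \<open>The error is at most (|x| + |y|)/(2R), and coercivity bounds |x| + |y| by the shifted
  kernel. Hence for measures of finite energy it vanishes as R tends to infinity, without any
  assumption on their support.\<close>

lemma ball_error_mutual_le:
  assumes "borel_prob \<mu>"
    and K: "\<And>x y. \<bar>x\<bar> + \<bar>y\<bar> \<le> log_kernel V x y + K" and R: "R > 0"
  shows "(\<integral>\<^sup>+ x. \<integral>\<^sup>+ y. ennreal (ball_error R x y) \<partial>\<mu> \<partial>\<mu>) \<le> ennreal (1 / (2 * R)) * mutual V K \<mu> \<mu>"
proof -
  interpret \<mu>: prob_space \<mu> using borel_probD[OF assms(1)] by auto
  have [measurable_cong]: "sets \<mu> = sets borel" using borel_probD[OF assms(1)] by auto
  have "ennreal (ball_error R x y) \<le> ennreal (1 / (2 * R)) * kern V K x y" for x y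
  proof (cases "x = y")
    case True
    then show ?thesis using R by (simp add: kern_def ennreal_mult_top)
  next
    case False
    have "ball_error R x y \<le> 1 / (2 * R) * (\<bar>x\<bar> + \<bar>y\<bar>)"
      using ball_error_bounds(2)[OF R, of x y] by simp
    also have "\<dots> \<le> 1 / (2 * R) * (log_kernel V x y + K)"
      using K R by (intro mult_left_mono) auto
    finally show ?thesis using False R K[of x y]
      by (simp add: kern_def ennreal_mult[symmetric])
  qed
  then have "(\<integral>\<^sup>+ x. \<integral>\<^sup>+ y. ennreal (ball_error R x y) \<partial>\<mu> \<partial>\<mu>) \<le>
     (\<integral>\<^sup>+ x. \<integral>\<^sup>+ y. ennreal (1 / (2 * R)) * kern V K x y \<partial>\<mu> \<partial>\<mu>)"
    by (intro nn_integral_mono)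
  also have "\<dots> = ennreal (1 / (2 * R)) * mutual V K \<mu> \<mu>"
    unfolding mutual_def by (simp add: nn_integral_cmult)
  finally show ?thesis .
qed

text \<open>For one radius R the parallelogram identity holds for the ball kernels; the terms in V
  and the constants occur equally on both sides, and only the errors remain, at most 1/(2R) times
  the right-hand side. Then R tends to infinity, while the discrepancy is kept at the smaller radius
  R0 by monotonicity.\<close>

lemma mutual_positive_definite:
  assumes \<mu>: "borel_prob \<mu>" and \<nu>: "borel_prob \<nu>"
    and K: "\<And>x y. \<bar>x\<bar> + \<bar>y\<bar> \<le> log_kernel V x y + K"
  shows "2 * mutual V K \<mu> \<nu> + ball_discrepancy R0 \<mu> \<nu> \<le> mutual V K \<mu> \<mu> + mutual V K \<nu> \<nu>"
    (is "?A \<le> ?B")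
proof (cases "?B = \<top>")
  case False
  then obtain b where b: "?B = ennreal b" "b \<ge> 0" by (metis ennreal_cases)
  have *: "?A \<le> ennreal ((1 + 1 / (2 * R)) * b)" if R: "R \<ge> R0" "R \<ge> exp 1" for R
  proof -
    have R0: "R > 0" using R by (smt (verit) exp_gt_zero)
    have "ln (exp 1) \<le> ln (2 * R)" using R R0 by (subst ln_le_cancel_iff) auto
    then have lnR: "ln (2 * R) \<ge> 1" by simp
    define L where "L = ennreal (ln (2 * R) - 1)"
    define e where "e \<mu> \<nu> = (\<integral>\<^sup>+ x. \<integral>\<^sup>+ y. ennreal (ball_error R x y) \<partial>\<nu> \<partial>\<mu>)" for \<mu> \<nu>
    define k where "k \<mu> \<nu> = (\<integral>\<^sup>+ x. \<integral>\<^sup>+ y. ball_kernel R x y \<partial>\<nu> \<partial>\<mu>)" for \<mu> \<nu>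
    define v where "v \<mu> = (\<integral>\<^sup>+ x. ennreal ((poly V x + K) / 2) \<partial>\<mu>)" for \<mu>
    have m: "mutual V K \<mu>' \<nu>' + e \<mu>' \<nu>' + L = k \<mu>' \<nu>' + (v \<mu>' + v \<nu>')"
      if "borel_prob \<mu>'" "borel_prob \<nu>'" for \<mu>' \<nu>'
      using mutual_ball_kernel[OF that K lnR R0] by (simp add: e_def k_def v_def L_def)
    have p: "k \<mu> \<mu> + k \<nu> \<nu> = 2 * k \<mu> \<nu> + ball_discrepancy R \<mu> \<nu>"
      using ball_kernel_parallelogram[OF \<mu> \<nu>] by (simp add: k_def)
    have "?A + 2 * L \<le> 2 * (mutual V K \<mu> \<nu> + e \<mu> \<nu> + L) + ball_discrepancy R \<mu> \<nu>"
      using ball_discrepancy_mono[OF R(1), of \<mu> \<nu>]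
      by (simp add: algebra_simps add_mono add_increasing)
    also have "\<dots> = (2 * k \<mu> \<nu> + ball_discrepancy R \<mu> \<nu>) + 2 * (v \<mu> + v \<nu>)"
      unfolding m[OF \<mu> \<nu>] by (simp add: algebra_simps)
    also have "\<dots> = (k \<mu> \<mu> + (v \<mu> + v \<mu>)) + (k \<nu> \<nu> + (v \<nu> + v \<nu>))"
      unfolding p[symmetric] by (simp add: algebra_simps mult_2 mult_2_right)
    also have "\<dots> = (?B + (e \<mu> \<mu> + e \<nu> \<nu>)) + 2 * L"
      unfolding m[OF \<mu> \<mu>, symmetric] m[OF \<nu> \<nu>, symmetric] by (simp add: algebra_simps mult_2 mult_2_right)
    \<comment> \<open>The constant L is finite, so 2L cancels.\<close>
    finally have "?A \<le> ?B + (e \<mu> \<mu> + e \<nu> \<nu>)"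
      by (simp add: L_def ennreal_mult_eq_top_iff add.commute[of _ "2 * _"] ennreal_add_left_cancel_le)
    also have "\<dots> \<le> ?B + (ennreal (1 / (2 * R)) * mutual V K \<mu> \<mu> + ennreal (1 / (2 * R)) * mutual V K \<nu> \<nu>)"
      unfolding e_def using ball_error_mutual_le[OF \<mu> K R0] ball_error_mutual_le[OF \<nu> K R0]
      by (intro add_left_mono add_mono)
    also have "\<dots> = ?B + ennreal (1 / (2 * R)) * ?B" by (simp add: algebra_simps)
    also have "\<dots> = ennreal ((1 + 1 / (2 * R)) * b)"
      unfolding b(1) using b(2) R0 by (simp add: ennreal_mult[symmetric] ennreal_plus[symmetric] algebra_simps del: ennreal_plus)
    finally show ?thesis .
  qed
  have lim: "((\<lambda>R. ennreal ((1 + 1 / (2 * R)) * b)) \<longlongrightarrow> ennreal ((1 + 0) * b)) at_top"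
    by (intro tendsto_intros tendsto_ennrealI real_tendsto_divide_at_top[of _ 1]
        filterlim_tendsto_pos_mult_at_top[of _ 2] filterlim_ident) auto
  have "?A \<le> ennreal ((1 + 0) * b)"
    by (rule tendsto_lowerbound[OF lim])
       (use * in \<open>auto intro!: eventually_mono[OF eventually_ge_at_top[of "max R0 (exp 1)"]]\<close>)
  then show ?thesis using b by simp
next
  case True
  then show ?thesis by (metis top_greatest)
qed

section \<open>Existence and uniqueness of the equilibrium measure\<close>

text \<open>A vanishing integral of squares gives equal ball masses only for almost every centre and
  radius. That is enough: every open rectangle of centres and radii contains such a pair, and
  half-lines are exhausted by balls known only up to small perturbations.\<close>

lemma ball_discrepancy_zero_imp_eq:
  assumes \<mu>: "borel_prob \<mu>" and \<nu>: "borel_prob \<nu>"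
    and z: "\<And>R. ball_discrepancy R \<mu> \<nu> = 0"
  shows "\<mu> = \<nu>"
proof -
  have [measurable]: "ball_mass \<mu> \<in> borel_measurable (lborel \<Otimes>\<^sub>M lborel)"
     "ball_mass \<nu> \<in> borel_measurable (lborel \<Otimes>\<^sub>M lborel)"
    using \<mu> \<nu> by simp_all
  have good: "\<exists>u r. u0 < u \<and> u < u1 \<and> r0 < r \<and> r < r1 \<and> ball_mass \<mu> (u, r) = ball_mass \<nu> (u, r)"
    if r: "0 < r0" "r0 < r1" and u: "u0 < u1" for u0 u1 r0 r1 :: real
  proof (rule ccontr)
    assume none: "\<not> ?thesis"
    have "AE w in lborel \<Otimes>\<^sub>M lborel. ball_weight r1 w * ennreal ((ball_mass \<mu> w - ball_mass \<nu> w)\<^sup>2) = 0"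
      using z[of r1] unfolding ball_discrepancy_def by (subst (asm) nn_integral_0_iff_AE) auto
    then have ae: "AE w in lborel \<Otimes>\<^sub>M lborel. w \<notin> {u0<..<u1} \<times> {r0<..<r1}"
    proof eventually_elim
      case (elim w)
      show ?case
      proof
        assume w: "w \<in> {u0<..<u1} \<times> {r0<..<r1}"
        then have "ball_weight r1 w \<noteq> 0" using r by (auto simp: ball_weight_def)
        with elim have "ball_mass \<mu> w = ball_mass \<nu> w" by auto
        with none w show False by (cases w) auto
      qed
    qed
    have "emeasure (lborel \<Otimes>\<^sub>M lborel) ({u0<..<u1} \<times> {r0<..<r1}) = 0"
      using ae by (subst (asm) AE_iff_measurable[OF _ refl]) (auto simp: space_pair_measure)
    then show False
      using r u by (subst (asm) lborel.emeasure_pair_measure_Times) (auto simp: ennreal_mult[symmetric])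
  qed
  have le: "emeasure \<mu>' {x<..} \<le> emeasure \<nu>' {x<..}"
    if \<mu>': "borel_prob \<mu>'" and \<nu>': "borel_prob \<nu>'"
      and good: "\<And>r0 r1 u0 u1. 0 < r0 \<Longrightarrow> r0 < r1 \<Longrightarrow> u0 < u1 \<Longrightarrow>
        \<exists>u r. u0 < u \<and> u < u1 \<and> r0 < r \<and> r < r1 \<and> ball_mass \<mu>' (u, r) = ball_mass \<nu>' (u, r)"
    for \<mu>' \<nu>' x
  proof -
    interpret \<mu>': prob_space \<mu>' using borel_probD[OF \<mu>'] by auto
    interpret \<nu>': prob_space \<nu>' using borel_probD[OF \<nu>'] by auto
    have sets: "sets \<mu>' = sets borel" "sets \<nu>' = sets borel"
      using borel_probD[OF \<mu>'] borel_probD[OF \<nu>'] by auto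
    define A where "A n = {x + 1 / (real n + 1) <..< x + real n}" for n :: nat
    have "emeasure \<mu>' (A n) \<le> emeasure \<nu>' {x<..}" for n
    proof -
      define e where "e = 1 / (real n + 1)"
      have e: "e > 0" by (simp add: e_def)
      \<comment> \<open>The windows force u - r to lie between x + e/12 and x + e/2, and u + r to
        exceed x + n. The ball therefore contains \<open>A n\<close> and stays to the right of
        x.\<close>
      obtain u r where ur: "x + (real n + 1) + e / 3 < u" "u < x + (real n + 1) + e / 2"
         "real n + 1 < r" "r < real n + 1 + e / 4" and eq: "ball_mass \<mu>' (u, r) = ball_mass \<nu>' (u, r)"
        using good[of "real n + 1" "real n + 1 + e / 4" "x + (real n + 1) + e / 3" "x + (real n + 1) + e / 2"] e
        by auto
      have "emeasure \<mu>' (A n) \<le> emeasure \<mu>' {y. \<bar>y - u\<bar> < r}"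
        using ur e by (intro emeasure_mono) (auto simp: sets A_def e_def[symmetric] abs_if)
      also have "\<dots> = ennreal (ball_mass \<mu>' (u, r))" by (simp add: ball_mass_def \<mu>'.emeasure_eq_measure)
      also have "\<dots> = emeasure \<nu>' {y. \<bar>y - u\<bar> < r}" unfolding eq by (simp add: ball_mass_def \<nu>'.emeasure_eq_measure)
      also have "\<dots> \<le> emeasure \<nu>' {x<..}"
        using ur e by (intro emeasure_mono) (auto simp: sets abs_if split: if_splits)
      finally show ?thesis .
    qed
    moreover have "(SUP n. emeasure \<mu>' (A n)) = emeasure \<mu>' (\<Union>n. A n)"
    proof (rule SUP_emeasure_incseq)
      show "incseq A"
        unfolding incseq_def
      proof (intro allI impI)
        fix i j :: nat assume "i \<le> j"
        then have "1 / (real j + 1) \<le> 1 / (real i + 1)" "real i \<le> real j" by (auto intro!: divide_left_mono)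
        then show "A i \<subseteq> A j" by (auto simp: A_def)
      qed
    qed (auto simp: A_def sets)
    moreover have "(\<Union>n. A n) = {x<..}"
    proof (intro equalityI subsetI)
      fix y assume "y \<in> {x<..}"
      then have y: "y - x > 0" by simp
      obtain n1 :: nat where n1: "y - x < real n1" using reals_Archimedean2 by blast
      obtain n2 :: nat where n2: "1 / (y - x) < real n2" using reals_Archimedean2 by blast
      define n where "n = max n1 n2"
      have "1 / (y - x) < real n + 1" "y - x < real n" using n1 n2 by (auto simp: n_def)
      then have "y \<in> A n" using y by (auto simp: A_def field_simps)
      then show "y \<in> (\<Union>n. A n)" by blast
    next
      fix y assume "y \<in> (\<Union>n. A n)"
      then obtain n where "x + 1 / (real n + 1) < y" by (auto simp: A_def)
      moreover have "1 / (real n + 1) > 0" by simp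
      ultimately show "y \<in> {x<..}" unfolding greaterThan_iff by linarith
    qed
    ultimately show ?thesis by (metis SUP_least)
  qed
  show ?thesis
  proof (rule measure_eqI_lessThan)
    show "sets \<mu> = sets borel" "sets \<nu> = sets borel" using borel_probD \<mu> \<nu> by auto
    interpret \<mu>: prob_space \<mu> using borel_probD[OF \<mu>] by auto
    show "emeasure \<mu> {x<..} < \<infinity>" for x by (simp add: \<mu>.emeasure_eq_measure)
    have good': "\<exists>u r. u0 < u \<and> u < u1 \<and> r0 < r \<and> r < r1 \<and> ball_mass \<nu> (u, r) = ball_mass \<mu> (u, r)"
      if "0 < r0" "r0 < r1" "u0 < u1" for u0 u1 r0 r1 :: real
      using good[OF that] by force
    show "emeasure \<mu> {x<..} = emeasure \<nu> {x<..}" for x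
      by (rule antisym[OF le[OF \<mu> \<nu> good] le[OF \<nu> \<mu> good']])
  qed
qed

section \<open>Midpoints of measures and uniqueness of minimisers\<close>

definition midpoint_measure :: "real measure \<Rightarrow> real measure \<Rightarrow> real measure" where
  "midpoint_measure \<mu> \<nu> = measure_pmf (bernoulli_pmf (1/2)) \<bind> (\<lambda>b. if b then \<mu> else \<nu>)"

lemma midpoint_kernel:
  assumes "borel_prob \<mu>" "borel_prob \<nu>"
  shows "(\<lambda>b. if b then \<mu> else \<nu>) \<in> measurable (measure_pmf (bernoulli_pmf (1/2))) (subprob_algebra borel)"
proof (rule measurableI)
  fix b :: bool
  have "\<mu> \<in> space (subprob_algebra borel)" "\<nu> \<in> space (subprob_algebra borel)"
    using borel_probD[OF assms(1)] borel_probD[OF assms(2)]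
    by (simp_all only: space_subprob_algebra mem_Collect_eq prob_space_imp_subprob_space simp_thms)
  then show "(if b then \<mu> else \<nu>) \<in> space (subprob_algebra borel)" by (cases b) simp_all
qed simp

lemma borel_prob_midpoint:
  assumes "borel_prob \<mu>" "borel_prob \<nu>"
  shows "borel_prob (midpoint_measure \<mu> \<nu>)"
proof -
  have "sets (midpoint_measure \<mu> \<nu>) = sets borel"
    unfolding midpoint_measure_def
    by (rule sets_bind[where N = borel]) (use assms in \<open>auto simp: borel_prob_def\<close>)
  moreover have "prob_space (midpoint_measure \<mu> \<nu>)"
    unfolding midpoint_measure_def
    by (rule measure_pmf.prob_space_bind[OF _ midpoint_kernel[OF assms]])
       (use assms in \<open>auto simp: borel_prob_def\<close>)
  ultimately show ?thesis by (simp add: borel_prob_def)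
qed

lemma nn_integral_midpoint:
  assumes "borel_prob \<mu>" "borel_prob \<nu>" "f \<in> borel_measurable borel"
  shows "(\<integral>\<^sup>+ x. f x \<partial>midpoint_measure \<mu> \<nu>) = ennreal (1/2) * ((\<integral>\<^sup>+ x. f x \<partial>\<mu>) + (\<integral>\<^sup>+ x. f x \<partial>\<nu>))"
proof -
  have "(\<integral>\<^sup>+ x. f x \<partial>midpoint_measure \<mu> \<nu>) =
      (\<integral>\<^sup>+ b. (\<integral>\<^sup>+ x. f x \<partial>(if b then \<mu> else \<nu>)) \<partial>measure_pmf (bernoulli_pmf (1/2)))"
    unfolding midpoint_measure_def
    by (rule nn_integral_bind[OF assms(3) midpoint_kernel[OF assms(1,2)]])
  also have "\<dots> = (\<integral>\<^sup>+ x. f x \<partial>\<mu>) * ennreal (1/2) + (\<integral>\<^sup>+ x. f x \<partial>\<nu>) * ennreal (1/2)"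
    by (subst nn_integral_bernoulli_pmf) simp_all
  finally show ?thesis by (simp only: distrib_left mult.commute)
qed

lemma mutual_midpoint:
  assumes \<mu>: "borel_prob \<mu>" and \<nu>: "borel_prob \<nu>"
  shows "mutual V K (midpoint_measure \<mu> \<nu>) (midpoint_measure \<mu> \<nu>) =
    ennreal (1/4) * (mutual V K \<mu> \<mu> + 2 * mutual V K \<mu> \<nu> + mutual V K \<nu> \<nu>)"
proof -
  interpret \<nu>: prob_space \<nu> using borel_probD[OF \<nu>] by auto
  interpret \<mu>: prob_space \<mu> using borel_probD[OF \<mu>] by auto
  have [measurable_cong]: "sets \<mu> = sets borel" "sets \<nu> = sets borel"
    using borel_probD[OF \<mu>] borel_probD[OF \<nu>] by auto
  define f where "f x = (\<integral>\<^sup>+ y. kern V K x y \<partial>\<mu>)" for x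
  define g where "g x = (\<integral>\<^sup>+ y. kern V K x y \<partial>\<nu>)" for x
  have [measurable]: "f \<in> borel_measurable borel" "g \<in> borel_measurable borel"
    unfolding f_def g_def by measurable
  have inner: "(\<integral>\<^sup>+ y. kern V K x y \<partial>midpoint_measure \<mu> \<nu>) = ennreal (1/2) * (f x + g x)" for x
    unfolding f_def g_def by (rule nn_integral_midpoint[OF \<mu> \<nu>]) measurable
  have half: "(\<integral>\<^sup>+ x. ennreal (1/2) * (f x + g x) \<partial>\<kappa>) =
      ennreal (1/2) * ((\<integral>\<^sup>+ x. f x \<partial>\<kappa>) + (\<integral>\<^sup>+ x. g x \<partial>\<kappa>))"
    if [measurable_cong]: "sets \<kappa> = sets borel" for \<kappa>
  proof -
    have "(\<integral>\<^sup>+ x. ennreal (1/2) * (f x + g x) \<partial>\<kappa>) = ennreal (1/2) * (\<integral>\<^sup>+ x. f x + g x \<partial>\<kappa>)"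
      by (rule nn_integral_cmult) measurable
    also have "(\<integral>\<^sup>+ x. f x + g x \<partial>\<kappa>) = (\<integral>\<^sup>+ x. f x \<partial>\<kappa>) + (\<integral>\<^sup>+ x. g x \<partial>\<kappa>)"
      by (rule nn_integral_add) measurable
    finally show ?thesis .
  qed
  have "mutual V K (midpoint_measure \<mu> \<nu>) (midpoint_measure \<mu> \<nu>) =
      (\<integral>\<^sup>+ x. ennreal (1/2) * (f x + g x) \<partial>midpoint_measure \<mu> \<nu>)"
    unfolding mutual_def inner ..
  also have "\<dots> = ennreal (1/2) * ((\<integral>\<^sup>+ x. ennreal (1/2) * (f x + g x) \<partial>\<mu>) +
      (\<integral>\<^sup>+ x. ennreal (1/2) * (f x + g x) \<partial>\<nu>))"
    by (rule nn_integral_midpoint[OF \<mu> \<nu>]) measurable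
  also have "\<dots> = ennreal (1/2) * (ennreal (1/2) * (mutual V K \<mu> \<mu> + mutual V K \<mu> \<nu>) +
      ennreal (1/2) * (mutual V K \<nu> \<mu> + mutual V K \<nu> \<nu>))"
    using borel_probD(2)[OF \<mu>] borel_probD(2)[OF \<nu>] by (simp only: half) (simp only: mutual_def f_def g_def)
  also have "\<dots> = (ennreal (1/2) * ennreal (1/2)) * (mutual V K \<mu> \<mu> + 2 * mutual V K \<mu> \<nu> + mutual V K \<nu> \<nu>)"
    unfolding mutual_commute[OF \<nu> \<mu>] by (simp only: distrib_left mult_2 ac_simps)
  also have "ennreal (1/2) * ennreal (1/2) = ennreal (1/4)" by (subst ennreal_mult[symmetric]) auto
  finally show ?thesis .
qed

text \<open>Let i be the minimum, j the mutual energy and d the discrepancy. The midpoint cannot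
  beat the minimum, so i <= (2i + 2j)/4 and i <= j; positive definiteness says 2j + d <= 2i.
  Together d = 0. Finiteness of i is what permits the cancellation.\<close>

lemma mutual_minimizer_unique:
  assumes K: "\<And>x y. \<bar>x\<bar> + \<bar>y\<bar> \<le> log_kernel V x y + K"
    and \<mu>: "borel_prob \<mu>" "\<And>\<kappa>. borel_prob \<kappa> \<Longrightarrow> mutual V K \<mu> \<mu> \<le> mutual V K \<kappa> \<kappa>"
    and \<nu>: "borel_prob \<nu>" "\<And>\<kappa>. borel_prob \<kappa> \<Longrightarrow> mutual V K \<nu> \<nu> \<le> mutual V K \<kappa> \<kappa>"
    and fin: "mutual V K \<mu> \<mu> < \<top>"
  shows "\<mu> = \<nu>"
proof (rule ball_discrepancy_zero_imp_eq[OF \<mu>(1) \<nu>(1)])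
  fix R
  obtain i where i: "mutual V K \<mu> \<mu> = ennreal i" "i \<ge> 0"
    using fin by (metis ennreal_cases less_irrefl)
  have i': "mutual V K \<nu> \<nu> = ennreal i"
    using \<mu>(2)[OF \<nu>(1)] \<nu>(2)[OF \<mu>(1)] i by simp
  have pd: "2 * mutual V K \<mu> \<nu> + ball_discrepancy R \<mu> \<nu> \<le> ennreal (2 * i)"
    using mutual_positive_definite[OF \<mu>(1) \<nu>(1) K, of R] i by (simp add: i' ennreal_plus[symmetric] del: ennreal_plus)
  then have "2 * mutual V K \<mu> \<nu> \<le> ennreal (2 * i)"
    by (metis add_increasing2 order_trans zero_le order_refl)
  then have "mutual V K \<mu> \<nu> \<noteq> \<top>" by (auto simp: ennreal_mult_top top_unique)
  then obtain j where j: "mutual V K \<mu> \<nu> = ennreal j" "j \<ge> 0" by (metis ennreal_cases)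
  have "ball_discrepancy R \<mu> \<nu> \<noteq> \<top>" using pd by (auto simp: top_unique)
  then obtain d where d: "ball_discrepancy R \<mu> \<nu> = ennreal d" "d \<ge> 0" by (metis ennreal_cases)
  have "2 * mutual V K \<mu> \<nu> = ennreal (2 * j)" using j by (simp add: ennreal_mult)
  then have 1: "2 * j + d \<le> 2 * i" using pd i(2) j d
    by (simp add: ennreal_plus[symmetric] del: ennreal_plus)
  have "ennreal i \<le> ennreal (1/4) * (ennreal i + 2 * ennreal j + ennreal i)"
    using \<mu>(2)[OF borel_prob_midpoint[OF \<mu>(1) \<nu>(1)]] unfolding mutual_midpoint[OF \<mu>(1) \<nu>(1)] i i' j .
  also have "\<dots> = ennreal (1/4 * (i + 2 * j + i))"
  proof -
    have "2 * ennreal j = ennreal (2 * j)" using j(2) by (simp add: ennreal_mult)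
    then show ?thesis using i(2) j(2)
      by (simp add: ennreal_plus[symmetric] ennreal_mult[symmetric] del: ennreal_plus)
  qed
  finally have "i \<le> 1/4 * (i + 2 * j + i)" using i(2) j(2) by simp
  then have "i \<le> j" by (simp add: field_simps)
  with 1 d(2) have "d = 0" by simp
  then show "ball_discrepancy R \<mu> \<nu> = 0" by (simp add: d)
qed

text \<open>A density bounded by M' gives a ball of radius r mass at most 2rM', so the square of the
  mass cancels the singular weight 1/(2r^2). What is left is a bounded integrand on a bounded set of
  centres and radii.\<close>

lemma mutual_bounded_density_finite:
  assumes \<mu>: "borel_prob \<mu>" "\<mu> = density lborel (\<lambda>x. ennreal (f x))"
    and [measurable]: "f \<in> borel_measurable borel"
    and f: "\<And>x. f x \<le> M" "\<And>x. x \<notin> {a..b} \<Longrightarrow> f x = 0"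
    and K: "\<And>x y. \<bar>x\<bar> + \<bar>y\<bar> \<le> log_kernel V x y + K"
  shows "mutual V K \<mu> \<mu> < \<top>"
proof -
  interpret \<mu>: prob_space \<mu> using borel_probD[OF \<mu>(1)] by auto
  have [measurable_cong]: "sets \<mu> = sets borel" using borel_probD[OF \<mu>(1)] by auto
  have [measurable]: "poly V \<in> borel_measurable borel"
    by (intro borel_measurable_continuous_onI continuous_intros)
  \<comment> \<open>Any fixed radius with ln(2R) >= 1 serves here.\<close>
  define R :: real where "R = exp 1"
  have R: "R > 0" "ln (2 * R) \<ge> 1" by (simp_all add: R_def ln_mult)
  define M' where "M' = max M 0"
  have M': "f x \<le> M'" "0 \<le> M'" for x using f(1)[of x] by (auto simp: M'_def)
  have supp: "AE x in \<mu>. x \<in> {a..b}"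
    unfolding \<mu>(2) using f(2) by (subst AE_density, simp, intro AE_I2) force
  have mass: "ball_mass \<mu> (u, r) \<le> 2 * r * M' * indicator {a - R..b + R} u" if r: "0 < r" "r \<le> R" for u r
  proof (cases "u \<in> {a - R..b + R}")
    case True
    have "emeasure \<mu> {x. \<bar>x - u\<bar> < r} = (\<integral>\<^sup>+ x. ennreal (f x) * indicator {x. \<bar>x - u\<bar> < r} x \<partial>lborel)"
      unfolding \<mu>(2) by (subst emeasure_density) auto
    also have "\<dots> \<le> (\<integral>\<^sup>+ x. ennreal M' * indicator {u - r<..<u + r} x \<partial>lborel)"
      using M' by (intro nn_integral_mono) (auto simp: indicator_def intro!: ennreal_leI)
    also have "\<dots> = ennreal (2 * r * M')"
      using r M' by (simp add: nn_integral_cmult_indicator ennreal_mult[symmetric] mult_ac)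
    finally show ?thesis using True r M' by (simp add: ball_mass_def \<mu>.emeasure_eq_measure)
  next
    case False
    have "AE x in \<mu>. x \<notin> {x. \<bar>x - u\<bar> < r}"
      using supp by eventually_elim (use False r in \<open>auto simp: abs_if split: if_splits\<close>)
    then have "ball_mass \<mu> (u, r) = 0"
      by (simp add: ball_mass_def \<mu>.prob_eq_0 AE_iff_measurable[OF _ refl] borel_probD[OF \<mu>(1)])
    then show ?thesis using False by simp
  qed
  have "(\<integral>\<^sup>+ x. \<integral>\<^sup>+ y. ball_kernel R x y \<partial>\<mu> \<partial>\<mu>) \<le>
     (\<integral>\<^sup>+ w. ennreal (2 * M'\<^sup>2) * indicator ({a - R..b + R} \<times> {0<..R}) w \<partial>(lborel \<Otimes>\<^sub>M lborel))"
    unfolding ball_kernel_mutual[OF \<mu>(1) \<mu>(1)]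
  proof (intro nn_integral_mono)
    fix w :: "real \<times> real"
    obtain u r where w: "w = (u, r)" by (cases w)
    show "ball_weight R w * ennreal (ball_mass \<mu> w * ball_mass \<mu> w) \<le>
      ennreal (2 * M'\<^sup>2) * indicator ({a - R..b + R} \<times> {0<..R}) w"
    proof (cases "0 < r \<and> r \<le> R \<and> u \<in> {a - R..b + R}")
      case True
      have nn: "0 \<le> ball_mass \<mu> (u, r)" by (simp add: ball_mass_def)
      have "ball_mass \<mu> (u, r) * ball_mass \<mu> (u, r) \<le>
         (2 * r * M' * indicator {a - R..b + R} u) * (2 * r * M' * indicator {a - R..b + R} u)"
        using mass[of r u] True nn M'(2) by (intro mult_mono) (auto simp: indicator_def)
      then have "1 / (2 * r\<^sup>2) * (ball_mass \<mu> (u, r) * ball_mass \<mu> (u, r)) \<le> 1 / (2 * r\<^sup>2) *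
         ((2 * r * M' * indicator {a - R..b + R} u) * (2 * r * M' * indicator {a - R..b + R} u))"
        by (intro mult_left_mono) auto
      also have "\<dots> = 2 * M'\<^sup>2 * indicator {a - R..b + R} u"
        using True by (auto simp: indicator_def power2_eq_square)
      finally have "ennreal (1 / (2 * r\<^sup>2) * (ball_mass \<mu> (u, r) * ball_mass \<mu> (u, r))) \<le>
         ennreal (2 * M'\<^sup>2 * indicator {a - R..b + R} u)" by (rule ennreal_leI)
      then show ?thesis using True nn
        by (simp add: w ball_weight_def ennreal_mult[symmetric] indicator_def)
    next
      case False
      have "ball_mass \<mu> (u, r) = 0" if "0 < r" "r \<le> R"
        using mass[OF that, of u] that False by (simp add: ball_mass_def measure_le_0_iff)
      then show ?thesis using False by (auto simp: w ball_weight_def indicator_def)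
    qed
  qed
  also have "\<dots> < \<top>"
    by (subst nn_integral_cmult_indicator) (auto simp: lborel.emeasure_pair_measure_Times ennreal_mult_less_top R(1) less_imp_le emeasure_lborel_Icc_eq)
  finally have 1: "(\<integral>\<^sup>+ x. \<integral>\<^sup>+ y. ball_kernel R x y \<partial>\<mu> \<partial>\<mu>) < \<top>" .
  have "bounded (poly V ` {a..b})"
    by (intro compact_imp_bounded compact_continuous_image continuous_intros compact_Icc)
  then obtain B where B: "\<And>x. x \<in> {a..b} \<Longrightarrow> \<bar>poly V x\<bar> \<le> B"
    unfolding bounded_real by blast
  have "(\<integral>\<^sup>+ x. ennreal ((poly V x + K) / 2) \<partial>\<mu>) \<le> (\<integral>\<^sup>+ x. ennreal ((B + K) / 2) \<partial>\<mu>)"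
    by (intro nn_integral_mono_AE) (use supp in eventually_elim, use B in \<open>force intro!: ennreal_leI\<close>)
  then have 2: "(\<integral>\<^sup>+ x. ennreal ((poly V x + K) / 2) \<partial>\<mu>) < \<top>"
    by (simp add: \<mu>.emeasure_space_1 order_le_less_trans)
  have "mutual V K \<mu> \<mu> \<le> mutual V K \<mu> \<mu> + (\<integral>\<^sup>+ x. \<integral>\<^sup>+ y. ennreal (ball_error R x y) \<partial>\<mu> \<partial>\<mu>) + ennreal (ln (2 * R) - 1)"
    by (simp add: add.assoc)
  also have "\<dots> < \<top>"
    unfolding mutual_ball_kernel[OF \<mu>(1) \<mu>(1) K R(2,1)] using 1 2 by simp
  finally show ?thesis .
qed

section \<open>Existence of a minimiser: finite energy, semicontinuity, tightness\<close>

lemma exists_finite_mutual: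
  assumes K: "\<And>x y. \<bar>x\<bar> + \<bar>y\<bar> \<le> log_kernel V x y + K"
  shows "\<exists>\<mu>. borel_prob \<mu> \<and> mutual V K \<mu> \<mu> < \<top>"
proof -
  define \<mu> :: "real measure" where "\<mu> = density lborel (\<lambda>x. ennreal (indicator {0..1} x))"
  have "prob_space \<mu>"
    by (rule prob_spaceI) (simp add: \<mu>_def emeasure_density ennreal_indicator)
  then have "borel_prob \<mu>" by (simp add: borel_prob_def \<mu>_def)
  moreover have "mutual V K \<mu> \<mu> < \<top>"
    by (rule mutual_bounded_density_finite[OF \<open>borel_prob \<mu>\<close> \<mu>_def _ _ _ K, of 1 0 1])
       (auto simp: indicator_def)
  ultimately show ?thesis by blast
qed

text \<open>As a map into \<open>ennreal\<close> the kernel is continuous even on the diagonal,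
  where it tends to infinity; the weaker form with liminf is the one that Fatou's lemma
  takes.\<close>

lemma kern_lower_semicontinuous:
  assumes K: "\<And>x y. \<bar>x\<bar> + \<bar>y\<bar> \<le> log_kernel V x y + K"
    and x: "X \<longlonglongrightarrow> x" and y: "Y \<longlonglongrightarrow> y"
  shows "kern V K x y \<le> liminf (\<lambda>n. kern V K (X n) (Y n))"
proof -
  have V: "isCont (poly V) z" for z by (rule poly_isCont)
  have "(\<lambda>n. kern V K (X n) (Y n)) \<longlonglongrightarrow> kern V K x y"
  proof (cases "x = y")
    case False
    have "eventually (\<lambda>n. \<bar>X n - Y n\<bar> > 0) sequentially"
      using False by (intro order_tendstoD(1)[OF tendsto_rabs[OF tendsto_diff[OF x y]]]) auto
    then have "eventually (\<lambda>n. ennreal (log_kernel V (X n) (Y n) + K) = kern V K (X n) (Y n)) sequentially"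
      by eventually_elim (auto simp: kern_def)
    moreover have "(\<lambda>n. ennreal (log_kernel V (X n) (Y n) + K)) \<longlonglongrightarrow> ennreal (log_kernel V x y + K)"
      unfolding log_kernel_def using False
      by (intro tendsto_intros tendsto_ennrealI x y isCont_tendsto_compose[OF V]) auto
    ultimately show ?thesis using False by (simp add: kern_def Lim_transform_eventually)
  next
    case True
    \<comment> \<open>The potential loses at most 1 near the limit, so the threshold for |X n - Y n|
      is chosen to give -ln|X n - Y n| > l + 1 - K - V(x).\<close>
    have "eventually (\<lambda>n. ennreal l < kern V K (X n) (Y n)) sequentially" if "l \<ge> 0" for l
    proof -
      have lim: "(\<lambda>n. (poly V (X n) + poly V (Y n)) / 2) \<longlonglongrightarrow> (poly V x + poly V y) / 2"
        by (intro tendsto_intros x y isCont_tendsto_compose[OF V]) auto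
      have "eventually (\<lambda>n. (poly V (X n) + poly V (Y n)) / 2 > poly V x - 1) sequentially"
        using True by (intro order_tendstoD(1)[OF lim]) auto
      moreover have "eventually (\<lambda>n. \<bar>X n - Y n\<bar> < exp (- (l + 1 - K - poly V x))) sequentially"
        using True by (intro order_tendstoD(2)[OF tendsto_rabs[OF tendsto_diff[OF x y]]]) auto
      ultimately show ?thesis
      proof eventually_elim
        case (elim n)
        show ?case
        proof (cases "X n = Y n")
          case False
          then have "ln \<bar>X n - Y n\<bar> < - (l + 1 - K - poly V x)"
            using elim(2) by (metis ln_less_cancel_iff ln_exp exp_gt_zero right_minus_eq zero_less_abs_iff)
          then have "l < log_kernel V (X n) (Y n) + K"
            using elim(1) unfolding log_kernel_def by linarith
          then show ?thesis using False that by (simp add: kern_def ennreal_less_iff)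
        qed (simp add: kern_def)
      qed
    qed
    then show ?thesis using True by (simp add: kern_def tendsto_top_iff_ennreal)
  qed
  then show ?thesis by (simp add: lim_imp_Liminf)
qed

lemma borel_prob_iff_real_distribution: "borel_prob \<mu> \<longleftrightarrow> real_distribution \<mu>"
  unfolding borel_prob_def real_distribution_def real_distribution_axioms_def
  using sets_eq_imp_space_eq[of \<mu> borel] by auto

text \<open>Skorohod's theorem replaces weak convergence by pointwise convergence of random
  variables on one space. Using two independent points of that space, Fatou's lemma is applied once
  in each variable.\<close>

lemma mutual_weak_limit:
  assumes K: "\<And>x y. \<bar>x\<bar> + \<bar>y\<bar> \<le> log_kernel V x y + K"
    and \<mu>: "\<And>n. borel_prob (\<mu> n)" and M: "borel_prob M" and w: "weak_conv_m \<mu> M"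
  shows "mutual V K M M \<le> liminf (\<lambda>n. mutual V K (\<mu> n) (\<mu> n))"
proof -
  have "\<exists>(\<Omega> :: real measure) Y_seq Y. prob_space \<Omega> \<and> (\<forall>n. Y_seq n \<in> borel_measurable \<Omega>) \<and>
     (\<forall>n. distr \<Omega> borel (Y_seq n) = \<mu> n) \<and> Y \<in> borel_measurable \<Omega> \<and> distr \<Omega> borel Y = M \<and>
     (\<forall>x\<in>space \<Omega>. (\<lambda>n. Y_seq n x) \<longlonglongrightarrow> Y x)"
    using Skorohod[of \<mu> M] \<mu> M w by (simp add: borel_prob_iff_real_distribution)
  then obtain \<Omega> :: "real measure" and Y_seq Y where
    \<Omega>: "prob_space \<Omega>" and [measurable]: "\<And>n. Y_seq n \<in> borel_measurable \<Omega>" "Y \<in> borel_measurable \<Omega>"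
    and Yn: "\<And>n. distr \<Omega> borel (Y_seq n) = \<mu> n" and Y: "distr \<Omega> borel Y = M"
    and lim: "\<And>x. x \<in> space \<Omega> \<Longrightarrow> (\<lambda>n. Y_seq n x) \<longlonglongrightarrow> Y x"
    by blast
  interpret prob_space \<Omega> by fact
  have mut: "mutual V K (distr \<Omega> borel Z) (distr \<Omega> borel Z) = (\<integral>\<^sup>+ x. \<integral>\<^sup>+ y. kern V K (Z x) (Z y) \<partial>\<Omega> \<partial>\<Omega>)"
    if [measurable]: "Z \<in> borel_measurable \<Omega>" for Z
    unfolding mutual_def by (simp add: nn_integral_distr)
  have "mutual V K M M = (\<integral>\<^sup>+ x. \<integral>\<^sup>+ y. kern V K (Y x) (Y y) \<partial>\<Omega> \<partial>\<Omega>)"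
    by (simp add: mut flip: Y)
  also have "\<dots> \<le> (\<integral>\<^sup>+ x. \<integral>\<^sup>+ y. liminf (\<lambda>n. kern V K (Y_seq n x) (Y_seq n y)) \<partial>\<Omega> \<partial>\<Omega>)"
    by (intro nn_integral_mono kern_lower_semicontinuous[OF K] lim)
  also have "\<dots> \<le> (\<integral>\<^sup>+ x. liminf (\<lambda>n. \<integral>\<^sup>+ y. kern V K (Y_seq n x) (Y_seq n y) \<partial>\<Omega>) \<partial>\<Omega>)"
    by (intro nn_integral_mono nn_integral_liminf) auto
  also have "\<dots> \<le> liminf (\<lambda>n. \<integral>\<^sup>+ x. \<integral>\<^sup>+ y. kern V K (Y_seq n x) (Y_seq n y) \<partial>\<Omega> \<partial>\<Omega>)"
    by (intro nn_integral_liminf) auto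
  also have "\<dots> = liminf (\<lambda>n. mutual V K (\<mu> n) (\<mu> n))"
    by (simp add: mut flip: Yn)
  finally show ?thesis .
qed

text \<open>Markov's inequality for |x|, which is bounded by the shifted kernel.\<close>

lemma bounded_mutual_tight:
  assumes K: "\<And>x y. \<bar>x\<bar> + \<bar>y\<bar> \<le> log_kernel V x y + K"
    and \<mu>: "\<And>n. borel_prob (\<mu> n)" and C: "\<And>n. mutual V K (\<mu> n) (\<mu> n) \<le> ennreal C"
  shows "tight \<mu>"
  unfolding tight_def
proof (intro conjI allI impI)
  show "real_distribution (\<mu> n)" for n using \<mu> by (simp add: borel_prob_iff_real_distribution)
next
  fix e :: real assume e: "e > 0"
  \<comment> \<open>C' is positive and strictly above C, so that a = C'/e leaves a mass strictly
    below e outside.\<close>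
  define C' where "C' = max C 0 + 1"
  have C': "C' > 0" "C < C'" by (auto simp: C'_def)
  define a where "a = C' / e"
  have a: "a > 0" using C' e by (simp add: a_def)
  have "1 - e < measure (\<mu> n) {- a <.. a}" for n
  proof -
    interpret \<mu>: prob_space "\<mu> n" using borel_probD[OF \<mu>] by auto
    have [measurable_cong]: "sets (\<mu> n) = sets borel" using borel_probD[OF \<mu>] by auto
    have sp: "space (\<mu> n) = UNIV" using borel_probD[OF \<mu>] by auto
    define A where "A = {x. a \<le> \<bar>x\<bar>}"
    have A: "A \<in> sets borel" unfolding A_def by measurable
    have "ennreal a * emeasure (\<mu> n) A = (\<integral>\<^sup>+ x. ennreal a * indicator A x \<partial>\<mu> n)"
      using A by (simp add: nn_integral_cmult_indicator borel_probD[OF \<mu>])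
    also have "\<dots> \<le> (\<integral>\<^sup>+ x. \<integral>\<^sup>+ y. kern V K x y \<partial>\<mu> n \<partial>\<mu> n)"
    proof (intro nn_integral_mono)
      fix x
      have "ennreal a * indicator A x = (\<integral>\<^sup>+ y. ennreal a * indicator A x \<partial>\<mu> n)"
        by (simp add: \<mu>.emeasure_space_1)
      also have "\<dots> \<le> (\<integral>\<^sup>+ y. kern V K x y \<partial>\<mu> n)"
      proof (intro nn_integral_mono)
        fix y
        show "ennreal a * indicator A x \<le> kern V K x y"
          using K[of x y] by (auto simp: kern_def indicator_def A_def intro!: ennreal_leI)
      qed
      finally show "ennreal a * indicator A x \<le> (\<integral>\<^sup>+ y. kern V K x y \<partial>\<mu> n)" .
    qed
    also have "\<dots> \<le> ennreal C" using C[of n] by (simp add: mutual_def)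
    finally have "ennreal (a * measure (\<mu> n) A) \<le> ennreal C"
      using a by (simp add: \<mu>.emeasure_eq_measure ennreal_mult)
    then have "a * measure (\<mu> n) A \<le> max C 0"
      by (metis ennreal_le_iff2 max.cobounded1 max.cobounded2 order_trans)
    then have "a * measure (\<mu> n) A < C'" by (simp add: C'_def)
    then have "measure (\<mu> n) A < e"
      using a e C' by (simp add: a_def field_simps)
    moreover have "measure (\<mu> n) (- A) = 1 - measure (\<mu> n) A"
      using A \<mu>.prob_compl[of A] by (simp add: sp borel_probD[OF \<mu>] Compl_eq_Diff_UNIV)
    moreover have "measure (\<mu> n) (- A) \<le> measure (\<mu> n) {- a <.. a}"
      by (intro \<mu>.finite_measure_mono) (auto simp: A_def borel_probD[OF \<mu>])
    ultimately show ?thesis by linarith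
  qed
  then show "\<exists>a b. a < b \<and> (\<forall>n. 1 - e < measure (\<mu> n) {a<..b})"
    using a by (intro exI[of _ "-a"] exI[of _ a]) auto
qed

text \<open>The direct method: a decreasing sequence of energies that tends to the infimum, with its
  infinite initial terms dropped, belongs to tight measures, and a weak limit along a subsequence
  attains the infimum by semicontinuity.\<close>

lemma mutual_minimizer_exists:
  assumes K: "\<And>x y. \<bar>x\<bar> + \<bar>y\<bar> \<le> log_kernel V x y + K"
  shows "\<exists>\<mu>. borel_prob \<mu> \<and> (\<forall>\<nu>. borel_prob \<nu> \<longrightarrow> mutual V K \<mu> \<mu> \<le> mutual V K \<nu> \<nu>)"
proof -
  define X where "X = {mutual V K \<nu> \<nu> |\<nu>. borel_prob \<nu>}"
  obtain \<mu>0 where \<mu>0: "borel_prob \<mu>0" "mutual V K \<mu>0 \<mu>0 < \<top>"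
    using exists_finite_mutual[OF K] by blast
  have "X \<noteq> {}" using \<mu>0 by (auto simp: X_def)
  then obtain f :: "nat \<Rightarrow> ennreal" where f: "decseq f" "range f \<subseteq> X" "Inf X = (INF i. f i)"
    using ennreal_Inf_countable_INF[of X] by (auto simp: decseq_def)
  have f_lim: "f \<longlonglongrightarrow> Inf X" unfolding f(3) by (rule LIMSEQ_INF[OF f(1)])
  have "Inf X < \<top>" using \<mu>0 by (intro Inf_less_iff[THEN iffD2]) (auto simp: X_def)
  then obtain N where N: "f N < \<top>"
    using order_tendstoD(2)[OF f_lim] by (auto simp: eventually_sequentially)
  then obtain C where C: "f N = ennreal C" by (metis ennreal_cases less_irrefl)
  have "\<forall>n. \<exists>\<nu>. borel_prob \<nu> \<and> f (n + N) = mutual V K \<nu> \<nu>" using f(2) by (auto simp: X_def)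
  then obtain \<mu> where \<mu>: "\<And>n. borel_prob (\<mu> n)" "\<And>n. f (n + N) = mutual V K (\<mu> n) (\<mu> n)"
    by metis
  have "tight \<mu>"
    by (rule bounded_mutual_tight[OF K \<mu>(1), of _ C])
       (metis C \<mu>(2) f(1) decseqD le_add2)
  from tight_imp_convergent_subsubsequence[OF this strict_mono_id]
  obtain r M where r: "strict_mono (r :: nat \<Rightarrow> nat)" "real_distribution M" "weak_conv_m (\<mu> \<circ> r) M"
    by (auto simp: comp_def)
  have M: "borel_prob M" using r(2) by (simp add: borel_prob_iff_real_distribution)
  have "mutual V K M M \<le> liminf (\<lambda>n. mutual V K ((\<mu> \<circ> r) n) ((\<mu> \<circ> r) n))"
    by (rule mutual_weak_limit[OF K _ M r(3)]) (simp add: \<mu>)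
  also have "\<dots> = Inf X"
  proof (rule lim_imp_Liminf)
    have "((\<lambda>n. f (n + N)) \<circ> r) \<longlonglongrightarrow> Inf X"
      by (rule LIMSEQ_subseq_LIMSEQ[OF LIMSEQ_ignore_initial_segment[OF f_lim] r(1)])
    then show "(\<lambda>n. mutual V K ((\<mu> \<circ> r) n) ((\<mu> \<circ> r) n)) \<longlonglongrightarrow> Inf X" by (simp add: comp_def \<mu>)
  qed simp
  finally have "mutual V K M M \<le> Inf X" .
  then have "\<forall>\<nu>. borel_prob \<nu> \<longrightarrow> mutual V K M M \<le> mutual V K \<nu> \<nu>"
    unfolding X_def by (auto simp: le_Inf_iff)
  with M show ?thesis by blast
qed

lemma is_equilibrium_unique:
  assumes "in_P m V" "is_equilibrium V \<mu>" "is_equilibrium V \<nu>"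
  shows "\<mu> = \<nu>"
proof -
  obtain K where K: "K \<ge> 0" "\<And>x y. \<bar>x\<bar> + \<bar>y\<bar> \<le> log_kernel V x y + K"
    using log_kernel_coercive[OF assms(1)] by auto
  note iff = is_equilibrium_iff_mutual[OF K]
  obtain \<mu>0 where "borel_prob \<mu>0" "mutual V K \<mu>0 \<mu>0 < \<top>"
    using exists_finite_mutual[OF K(2)] by blast
  then have "mutual V K \<mu> \<mu> < \<top>" using assms(2) unfolding iff by (blast intro: order_le_less_trans)
  then show ?thesis
    using assms(2,3) unfolding iff by (intro mutual_minimizer_unique[OF K(2)]) auto
qed

lemma eq_measure_unique:
  assumes "in_P m V" "is_equilibrium V \<mu>"
  shows "eq_measure V = \<mu>"
  unfolding eq_measure_def using is_equilibrium_unique[OF assms(1)] assms(2) by blast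

text \<open>Without this, a hypothesis about \<open>eq_measure V\<close> would say nothing about a
  minimiser; later it supplies total mass one for the measure in a two-cut hypothesis.\<close>

lemma is_equilibrium_eq_measure:
  assumes "in_P m V"
  shows "is_equilibrium V (eq_measure V)"
proof -
  obtain K where K: "K \<ge> 0" "\<And>x y. \<bar>x\<bar> + \<bar>y\<bar> \<le> log_kernel V x y + K"
    using log_kernel_coercive[OF assms] by auto
  obtain \<mu> where "is_equilibrium V \<mu>"
    using mutual_minimizer_exists[OF K(2)] unfolding is_equilibrium_iff_mutual[OF K] by blast
  then show ?thesis using eq_measure_unique[OF assms] by metis
qed

section \<open>Euler--Lagrange conditions\<close>

text \<open>An integrable function of u that dominates |ln |u|| for |u| <= L: the first two terms
  handle |u| < 1 on either side of 0, the last one handles |u| >= 1, where ln |u| <= L.\<close>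

definition log_majorant :: "real \<Rightarrow> real \<Rightarrow> real" where
  "log_majorant L u = indicator {0<..<1} u * (- ln u) + indicator {0<..<1} (- u) * (- ln (- u)) +
     L * indicator {- L..L} u"

lemma log_majorant_integrable: "integrable lborel (log_majorant L)"
proof -
  have "set_integrable lborel (einterval 0 1) (\<lambda>u. - ln u)"
  proof (rule interval_integral_FTC_nonneg(1)[where F = "\<lambda>u. u - u * ln u" and A = 0 and B = 1])
    show "((\<lambda>u. u - u * ln u) has_real_derivative - ln x) (at x)" if "0 < ereal x" "ereal x < 1" for x
      using that by (auto intro!: derivative_eq_intros simp: zero_ereal_def)
    show "isCont (\<lambda>u. - ln u) x" if "0 < ereal x" "ereal x < 1" for x
      using that by (auto intro!: continuous_intros simp: zero_ereal_def)
    show "AE x in lborel. 0 < ereal x \<longrightarrow> ereal x < 1 \<longrightarrow> 0 \<le> - ln x"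
      by (auto simp: zero_ereal_def one_ereal_def)
    have "((\<lambda>u::real. u - u * ln u) \<longlongrightarrow> 0) (at_right 0)" by real_asymp
    then show "(((\<lambda>u. u - u * ln u) \<circ> real_of_ereal) \<longlongrightarrow> 0) (at_right 0)"
      by (simp add: ereal_tendsto_simps zero_ereal_def)
    have "((\<lambda>u::real. u - u * ln u) \<longlongrightarrow> 1) (at_left 1)" by real_asymp
    then show "(((\<lambda>u. u - u * ln u) \<circ> real_of_ereal) \<longlongrightarrow> 1) (at_left 1)"
      by (simp add: ereal_tendsto_simps one_ereal_def)
  qed auto
  moreover have "einterval 0 1 = {0<..<1::real}"
    by (auto simp: einterval_def zero_ereal_def one_ereal_def)
  ultimately have 1: "integrable lborel (\<lambda>u::real. indicator {0<..<1} u * (- ln u))"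
    by (simp add: set_integrable_def)
  have 2: "integrable lborel (\<lambda>u::real. indicator {0<..<1} (- u) * (- ln (- u)))"
    using lborel_integrable_real_affine[OF 1, of "-1" 0] by simp
  have 3: "integrable lborel (\<lambda>u::real. L * indicator {- L..L} u)"
    by (intro integrable_mult_right integrable_real_indicator) (auto simp: emeasure_lborel_Icc_eq)
  show ?thesis unfolding log_majorant_def
    by (intro Bochner_Integration.integrable_add 1 2 3)
qed

lemma log_majorant_nonneg:
  assumes "L \<ge> 0"
  shows "0 \<le> log_majorant L u"
proof -
  have neg: "0 \<le> indicator {0<..<1} v * (- ln v)" for v :: real
    by (cases "v \<in> {0<..<1}") auto
  show ?thesis unfolding log_majorant_def
    using neg[of u] neg[of "- u"] assms by (intro add_nonneg_nonneg mult_nonneg_nonneg[OF assms]) auto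
qed

lemma abs_ln_le_log_majorant:
  assumes "\<bar>u\<bar> \<le> L"
  shows "\<bar>ln \<bar>u\<bar>\<bar> \<le> log_majorant L u" "0 \<le> log_majorant L u"
proof -
  have L: "L \<ge> 0" using assms by linarith
  consider "u = 0" | "0 < \<bar>u\<bar>" "\<bar>u\<bar> < 1" | "1 \<le> \<bar>u\<bar>" by linarith
  then have "\<bar>ln \<bar>u\<bar>\<bar> \<le> log_majorant L u"
  proof cases
    case 2
    then have "ln \<bar>u\<bar> < 0" by simp
    then show ?thesis using 2 assms L
      by (cases "u > 0") (auto simp: log_majorant_def indicator_def)
  next
    case 3
    have "ln \<bar>u\<bar> \<le> \<bar>u\<bar> - 1" using 3 by (intro ln_le_minus_one) linarith
    then have "0 \<le> ln \<bar>u\<bar>" "ln \<bar>u\<bar> \<le> L" using assms 3 by auto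
    then show ?thesis using 3 assms L by (auto simp: log_majorant_def indicator_def)
  qed (use L in \<open>auto simp: log_majorant_def\<close>)
  then show "\<bar>ln \<bar>u\<bar>\<bar> \<le> log_majorant L u" "0 \<le> log_majorant L u" by linarith+
qed

lemma integrable_log_times_bounded:
  fixes f :: "real \<Rightarrow> real"
  assumes [measurable]: "f \<in> borel_measurable borel"
    and f: "\<And>x. \<bar>f x\<bar> \<le> M" "\<And>x. x \<notin> {a..b} \<Longrightarrow> f x = 0"
  shows "integrable lborel (\<lambda>y. ln \<bar>x - y\<bar> * f y)"
proof (rule Bochner_Integration.integrable_bound)
  define L where "L = \<bar>x\<bar> + \<bar>a\<bar> + \<bar>b\<bar>"
  show "integrable lborel (\<lambda>y. M * log_majorant L (x - y))"
    using lborel_integrable_real_affine[OF log_majorant_integrable, of "-1" L x]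
    by (intro integrable_mult_right) simp
  show "AE y in lborel. norm (ln \<bar>x - y\<bar> * f y) \<le> norm (M * log_majorant L (x - y))"
  proof (intro AE_I2)
    fix y
    show "norm (ln \<bar>x - y\<bar> * f y) \<le> norm (M * log_majorant L (x - y))"
    proof (cases "y \<in> {a..b}")
      case True
      then have l: "\<bar>x - y\<bar> \<le> L" unfolding L_def by auto
      have "\<bar>ln \<bar>x - y\<bar>\<bar> * \<bar>f y\<bar> \<le> log_majorant L (x - y) * M"
        using abs_ln_le_log_majorant[OF l] f(1)[of y] by (intro mult_mono) auto
      then have "norm (ln \<bar>x - y\<bar> * f y) \<le> M * log_majorant L (x - y)"
        by (simp add: abs_mult mult.commute)
      then show ?thesis by (rule order_trans) simp
    qed (simp add: f(2))
  qed
qed simp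

lemma integrable_continuous_times_bounded:
  fixes f g :: "real \<Rightarrow> real"
  assumes [measurable]: "f \<in> borel_measurable borel"
    and f: "\<And>x. \<bar>f x\<bar> \<le> M" "\<And>x. x \<notin> {a..b} \<Longrightarrow> f x = 0"
    and g: "continuous_on UNIV g"
  shows "integrable lborel (\<lambda>y. g y * f y)"
proof -
  have [measurable]: "g \<in> borel_measurable borel" using g by (rule borel_measurable_continuous_onI)
  have "bounded (g ` {a..b})"
    by (intro compact_imp_bounded compact_continuous_image compact_Icc continuous_on_subset[OF g]) auto
  then obtain B where B: "\<And>x. x \<in> {a..b} \<Longrightarrow> \<bar>g x\<bar> \<le> B" unfolding bounded_real by blast
  show ?thesis
  proof (rule Bochner_Integration.integrable_bound)
    show "integrable lborel (\<lambda>y. B * M * indicator {a..b} y)"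
      by (intro integrable_mult_right integrable_real_indicator) (auto simp: emeasure_lborel_Icc_eq)
    show "AE y in lborel. norm (g y * f y) \<le> norm (B * M * indicator {a..b} y)"
    proof (intro AE_I2)
      fix y show "norm (g y * f y) \<le> norm (B * M * indicator {a..b} y)"
      proof (cases "y \<in> {a..b}")
        case True
        then have "\<bar>g y\<bar> * \<bar>f y\<bar> \<le> B * M" using B[of y] f(1)[of y] by (intro mult_mono) auto
        then have "\<bar>g y * f y\<bar> \<le> B * M" by (simp only: abs_mult)
        then have "\<bar>g y * f y\<bar> \<le> \<bar>B * M\<bar>" by (rule order_trans) (rule abs_ge_self)
        then show ?thesis using True by (simp only: real_norm_def indicator_simps mult_1_right)
      qed (simp add: f(2))
    qed
  qed simp
qed

text \<open>Integrating the kernel against \<mu> gives a function that is at least c everywhere and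
  equal to c almost everywhere for \<mu>. Hence c is the energy of \<mu> and at most its mutual
  energy with any \<nu>. Positive definiteness yields 2c <= c + energy of \<nu>, and c is
  finite.\<close>

lemma Euler_Lagrange_imp_equilibrium:
  assumes V: "in_P m V"
    and [measurable]: "\<rho> \<in> borel_measurable borel"
    and \<rho>: "\<And>x. 0 \<le> \<rho> x" "\<And>x. \<rho> x \<le> M" "\<And>x. x \<notin> {a..b} \<Longrightarrow> \<rho> x = 0"
    and mass: "(\<integral> x. \<rho> x \<partial>lborel) = 1"
    and eq: "\<And>x. \<rho> x \<noteq> 0 \<Longrightarrow> 2 * (\<integral> y. ln \<bar>x - y\<bar> * \<rho> y \<partial>lborel) - poly V x = lv"
    and le: "\<And>x. 2 * (\<integral> y. ln \<bar>x - y\<bar> * \<rho> y \<partial>lborel) - poly V x \<le> lv"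
  shows "is_equilibrium V (density lborel (\<lambda>x. ennreal (\<rho> x)))"
proof -
  obtain K where K: "K \<ge> 0" "\<And>x y. \<bar>x\<bar> + \<bar>y\<bar> \<le> log_kernel V x y + K"
    using log_kernel_coercive[OF V] by auto
  define \<mu> where "\<mu> = density lborel (\<lambda>x. ennreal (\<rho> x))"
  define U where "U x = (\<integral> y. ln \<bar>x - y\<bar> * \<rho> y \<partial>lborel)" for x
  define v where "v = (\<integral> y. poly V y * \<rho> y \<partial>lborel)"
  have abs: "\<bar>\<rho> x\<bar> \<le> M" for x using \<rho>(1,2)[of x] by simp
  have int: "integrable lborel (\<lambda>y. poly p y * \<rho> y)" for p :: "real poly"
    by (rule integrable_continuous_times_bounded[OF _ abs \<rho>(3)]) (simp_all add: continuous_on_poly)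
  have int\<rho>: "integrable lborel \<rho>" using int[of 1] by simp
  note intV = int[of V]
  have intL: "integrable lborel (\<lambda>y. ln \<bar>x - y\<bar> * \<rho> y)" for x
    by (rule integrable_log_times_bounded[OF _ abs \<rho>(3)]) simp
  have nn1: "(\<integral>\<^sup>+ x. ennreal (\<rho> x) \<partial>lborel) = 1"
    using mass int\<rho> \<rho>(1) by (subst nn_integral_eq_integral) auto
  have prob: "prob_space \<mu>"
    by (rule prob_spaceI) (simp add: \<mu>_def emeasure_density nn1)
  then have bp: "borel_prob \<mu>" by (simp add: borel_prob_def \<mu>_def)
  interpret prob_space \<mu> by fact
  have \<phi>: "(\<integral>\<^sup>+ y. kern V K x y \<partial>\<mu>) = ennreal (- U x + poly V x / 2 + v / 2 + K)" for x
  proof -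
    \<comment> \<open>The infinite diagonal value is met only at y = x, a null set for a measure
      with a density.\<close>
    have "AE y in lborel. kern V K x y * ennreal (\<rho> y) = ennreal ((log_kernel V x y + K) * \<rho> y)"
      using AE_lborel_singleton[of x]
    proof eventually_elim
      case (elim y)
      then show ?case using K(2)[of x y] \<rho>(1)[of y] by (auto simp: kern_def ennreal_mult)
    qed
    then have "(\<integral>\<^sup>+ y. kern V K x y \<partial>\<mu>) = (\<integral>\<^sup>+ y. ennreal ((log_kernel V x y + K) * \<rho> y) \<partial>lborel)"
      unfolding \<mu>_def by (subst nn_integral_density) (auto intro!: nn_integral_cong_AE simp: mult.commute)
    also have "(\<lambda>y. (log_kernel V x y + K) * \<rho> y) =
        (\<lambda>y. - (ln \<bar>x - y\<bar> * \<rho> y) + (poly V x / 2 + K) * \<rho> y + 1/2 * (poly V y * \<rho> y))"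
      by (auto simp: log_kernel_def field_simps)
    also have "(\<integral>\<^sup>+ y. ennreal (- (ln \<bar>x - y\<bar> * \<rho> y) + (poly V x / 2 + K) * \<rho> y + 1/2 * (poly V y * \<rho> y)) \<partial>lborel) =
        ennreal (\<integral> y. (- (ln \<bar>x - y\<bar> * \<rho> y) + (poly V x / 2 + K) * \<rho> y + 1/2 * (poly V y * \<rho> y)) \<partial>lborel)"
    proof (rule nn_integral_eq_integral)
      show "integrable lborel (\<lambda>y. - (ln \<bar>x - y\<bar> * \<rho> y) + (poly V x / 2 + K) * \<rho> y + 1/2 * (poly V y * \<rho> y))"
        by (intro Bochner_Integration.integrable_add Bochner_Integration.integrable_minus
             integrable_mult_right intL int\<rho> intV)
      have "0 \<le> (log_kernel V x y + K) * \<rho> y" for y using K(2)[of x y] \<rho>(1)[of y] by auto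
      then show "AE y in lborel. 0 \<le> - (ln \<bar>x - y\<bar> * \<rho> y) + (poly V x / 2 + K) * \<rho> y + 1/2 * (poly V y * \<rho> y)"
        by (auto simp: log_kernel_def field_simps)
    qed
    also have "(\<integral> y. (- (ln \<bar>x - y\<bar> * \<rho> y) + (poly V x / 2 + K) * \<rho> y + 1/2 * (poly V y * \<rho> y)) \<partial>lborel) =
        - U x + (poly V x / 2 + K) * 1 + 1/2 * v"
    proof (rule has_bochner_integral_integral_eq)
      have "has_bochner_integral lborel (\<lambda>y. ln \<bar>x - y\<bar> * \<rho> y) (U x)"
        unfolding U_def by (rule has_bochner_integral_integrable[OF intL])
      moreover have "has_bochner_integral lborel \<rho> 1"
        using has_bochner_integral_integrable[OF int\<rho>] by (simp only: mass)
      moreover have "has_bochner_integral lborel (\<lambda>y. poly V y * \<rho> y) v"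
        unfolding v_def by (rule has_bochner_integral_integrable[OF intV])
      ultimately show "has_bochner_integral lborel
          (\<lambda>y. - (ln \<bar>x - y\<bar> * \<rho> y) + (poly V x / 2 + K) * \<rho> y + 1/2 * (poly V y * \<rho> y))
          (- U x + (poly V x / 2 + K) * 1 + 1/2 * v)"
        by (intro has_bochner_integral_add has_bochner_integral_minus has_bochner_integral_mult_right)
    qed
    finally show ?thesis by (simp add: algebra_simps)
  qed
  define c where "c = ennreal (- lv / 2 + v / 2 + K)"
  have ge: "c \<le> (\<integral>\<^sup>+ y. kern V K x y \<partial>\<mu>)" for x
    unfolding \<phi> c_def using le[of x] by (intro ennreal_leI) (simp add: U_def field_simps)
  have eq': "(\<integral>\<^sup>+ y. kern V K x y \<partial>\<mu>) = c" if "\<rho> x \<noteq> 0" for x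
    unfolding \<phi> c_def using eq[OF that] by (intro arg_cong[of _ _ ennreal]) (simp add: U_def field_simps)
  have ae: "AE x in \<mu>. \<rho> x \<noteq> 0" unfolding \<mu>_def by (subst AE_density) auto
  have \<mu>\<mu>: "mutual V K \<mu> \<mu> = c"
  proof -
    have "mutual V K \<mu> \<mu> = (\<integral>\<^sup>+ x. c \<partial>\<mu>)"
      unfolding mutual_def by (rule nn_integral_cong_AE) (use ae in eventually_elim, rule eq')
    then show ?thesis by (simp add: emeasure_space_1)
  qed
  have "mutual V K \<mu> \<mu> \<le> mutual V K \<nu> \<nu>" if \<nu>: "borel_prob \<nu>" for \<nu>
  proof -
    interpret \<nu>: prob_space \<nu> using borel_probD[OF \<nu>] by auto
    have "c = (\<integral>\<^sup>+ x. c \<partial>\<nu>)" by (simp add: \<nu>.emeasure_space_1)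
    also have "\<dots> \<le> mutual V K \<nu> \<mu>" unfolding mutual_def by (intro nn_integral_mono ge)
    finally have "c \<le> mutual V K \<mu> \<nu>" by (simp add: mutual_commute[OF \<nu> bp])
    then have "2 * c \<le> 2 * mutual V K \<mu> \<nu>" by (intro mult_left_mono) auto
    also have "\<dots> \<le> mutual V K \<mu> \<mu> + mutual V K \<nu> \<nu>"
      using mutual_positive_definite[OF bp \<nu> K(2), of 0] by (metis add_increasing2 order_trans zero_le order_refl)
    finally have "c + c \<le> c + mutual V K \<nu> \<nu>" by (simp add: \<mu>\<mu> mult_2)
    then show ?thesis unfolding \<mu>\<mu> by (simp add: c_def ennreal_add_left_cancel_le)
  qed
  then show ?thesis using bp unfolding is_equilibrium_iff_mutual[OF K] \<mu>_def by blast
qed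

section \<open>The complex logarithmic potential\<close>

text \<open>The branches of logarithm and square root are rotated so that they are continuous up to the real axis from above.\<close>
definition log_uhp :: "complex \<Rightarrow> complex" where
  "log_uhp w = Ln (- \<i> * w) + \<i> * (pi / 2)"

lemma minus_i_times_nonpos:
  assumes "Im w \<ge> 0" "w \<noteq> 0"
  shows "- \<i> * w \<notin> \<real>\<^sub>\<le>\<^sub>0"
  using assms by (auto simp: complex_nonpos_Reals_iff complex_eq_iff)

lemma isCont_log_uhp:
  assumes "Im w \<ge> 0" "w \<noteq> 0"
  shows "isCont log_uhp w"
  unfolding log_uhp_def using minus_i_times_nonpos[OF assms]
  by (intro continuous_intros) auto

lemma has_field_derivative_log_uhp:
  assumes "Im w > 0"
  shows "(log_uhp has_field_derivative 1 / w) (at w)"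
proof -
  have "w \<noteq> 0" using assms by auto
  then show ?thesis
    unfolding log_uhp_def using minus_i_times_nonpos[of w] assms
    by (auto intro!: derivative_eq_intros simp: field_simps)
qed

lemma Re_log_uhp: "w \<noteq> 0 \<Longrightarrow> Re (log_uhp w) = ln (cmod w)"
  by (simp add: log_uhp_def norm_mult)

text \<open>This jump by pi at the origin lets the imaginary part of the logarithmic transform count
  the mass to the right of a point.\<close>

lemma Im_log_uhp_of_real:
  "x > 0 \<Longrightarrow> Im (log_uhp (of_real x)) = 0"
  "x < 0 \<Longrightarrow> Im (log_uhp (of_real x)) = pi"
proof -
  show "Im (log_uhp (of_real x)) = 0" if "x > 0"
  proof -
    have "Ln (- \<i> * of_real x) = Ln (of_real x) + Ln (- \<i>)"
      using that by (subst mult.commute, intro Ln_times_of_real) auto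
    then show ?thesis using that by (simp add: log_uhp_def)
  qed
  show "Im (log_uhp (of_real x)) = pi" if "x < 0"
  proof -
    have "Ln (of_real (- x) * \<i>) = Ln (of_real (- x)) + Ln \<i>"
      using that by (intro Ln_times_of_real) auto
    moreover have "- \<i> * of_real x = of_real (- x) * \<i>" by simp
    moreover have "Im (Ln (of_real (- x))) = 0" using that by (subst Ln_of_real) auto
    ultimately show ?thesis using that unfolding log_uhp_def by (simp del: of_real_minus)
  qed
qed

lemma norm_log_uhp_le:
  assumes "w \<noteq> 0"
  shows "norm (log_uhp w) \<le> \<bar>ln (cmod w)\<bar> + 2 * pi"
proof -
  have "norm (log_uhp w) \<le> \<bar>Re (log_uhp w)\<bar> + \<bar>Im (log_uhp w)\<bar>" by (rule cmod_le)
  moreover have "\<bar>Im (log_uhp w)\<bar> \<le> 2 * pi"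
    using Im_Ln_le_pi[of "- \<i> * w"] mpi_less_Im_Ln[of "- \<i> * w"] assms pi_gt_zero
    by (auto simp: log_uhp_def abs_if)
  ultimately show ?thesis using assms by (simp add: Re_log_uhp)
qed

lemma log_uhp_measurable [measurable]: "log_uhp \<in> borel_measurable borel"
  unfolding log_uhp_def by measurable

text \<open>The complex logarithmic potential: its real part on the real line is the usual potential
  and its derivative above the line is the Cauchy transform. For continuous densities it has
  boundary values everywhere on the line.\<close>

definition log_transform :: "(real \<Rightarrow> real) \<Rightarrow> complex \<Rightarrow> complex" where
  "log_transform \<rho> z = (\<integral> y. log_uhp (z - of_real y) * of_real (\<rho> y) \<partial>lborel)"

definition cauchy_transform :: "real \<Rightarrow> real \<Rightarrow> (real \<Rightarrow> real) \<Rightarrow> complex \<Rightarrow> complex" where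
  "cauchy_transform a b \<rho> z = integral {a..b} (\<lambda>y. of_real (\<rho> y) / (z - of_real y))"

locale compact_density =
  fixes \<rho> :: "real \<Rightarrow> real" and a b M :: real
  assumes cont: "continuous_on UNIV \<rho>"
    and zero: "\<And>x. x \<notin> {a..b} \<Longrightarrow> \<rho> x = 0"
    and bound: "\<And>x. \<bar>\<rho> x\<bar> \<le> M"
begin

lemma measurable_\<rho> [measurable]: "\<rho> \<in> borel_measurable borel"
  using cont by (rule borel_measurable_continuous_onI)

lemma shifted_integrand_measurable:
  "(\<lambda>u. log_uhp (Complex u y) * of_real (\<rho> (x - u))) \<in> borel_measurable lborel"
  unfolding Complex_eq by measurable

text \<open>The substitution moves Re z from the singular logarithm into the continuous density. The
  singularity then stays at u = 0 while z varies, and one majorant serves for all nearby z.\<close>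

lemma log_transform_shift:
  "log_transform \<rho> z = (\<integral> u. log_uhp (Complex u (Im z)) * of_real (\<rho> (Re z - u)) \<partial>lborel)"
proof -
  have "log_transform \<rho> z = (\<integral> u. log_uhp (z - of_real (Re z + (-1) * u)) * of_real (\<rho> (Re z + (-1) * u)) \<partial>lborel)"
    unfolding log_transform_def by (subst lborel_integral_real_affine[where c = "-1" and t = "Re z"]) auto
  also have "\<dots> = (\<integral> u. log_uhp (Complex u (Im z)) * of_real (\<rho> (Re z - u)) \<partial>lborel)"
    by (intro Bochner_Integration.integral_cong refl arg_cong2[of _ _ _ _ times] arg_cong[of _ _ log_uhp])
       (auto simp: complex_eq_iff)
  finally show ?thesis .
qed

text \<open>Where |u + iy| <= 1, the inequality |u| <= |u + iy| reduces the logarithm to ln |u|;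
  elsewhere it is at most |u| + y <= L + B. The term 2 pi bounds the imaginary part.\<close>

lemma log_integrand_bound:
  assumes "\<bar>x\<bar> \<le> B" "0 \<le> y" "y \<le> B" "u \<noteq> 0" and L: "L = B + \<bar>a\<bar> + \<bar>b\<bar>"
  shows "norm (log_uhp (Complex u y) * of_real (\<rho> (x - u))) \<le>
     M * (log_majorant L u + (L + B + 2 * pi) * indicator {- L..L} u)"
proof (cases "x - u \<in> {a..b}")
  case False
  have "L \<ge> 0" "B \<ge> 0" using assms by linarith+
  then have "0 \<le> log_majorant L u + (L + B + 2 * pi) * indicator {- L..L} u"
    by (intro add_nonneg_nonneg log_majorant_nonneg mult_nonneg_nonneg indicator_pos_le)
       (simp_all add: pi_ge_zero)
  moreover have "M \<ge> 0" using bound[of 0] by linarith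
  ultimately show ?thesis by (simp add: zero[OF False])
next
  case True
  then have u: "\<bar>u\<bar> \<le> L" using assms(1) L by auto
  have nz: "Complex u y \<noteq> 0" using assms(4) by (simp add: complex_eq_iff)
  have ge: "\<bar>u\<bar> \<le> cmod (Complex u y)" using abs_Re_le_cmod[of "Complex u y"] by simp
  have le: "cmod (Complex u y) \<le> \<bar>u\<bar> + y" using cmod_le[of "Complex u y"] assms(2) by simp
  have LB: "L \<ge> 0" "B \<ge> 0" using u assms(2,3) by linarith+
  have ln_le: "\<bar>ln (cmod (Complex u y))\<bar> \<le> log_majorant L u + (L + B)"
  proof (cases "cmod (Complex u y) \<le> 1")
    case True
    have "ln \<bar>u\<bar> \<le> ln (cmod (Complex u y))" using ge assms(4) by (subst ln_le_cancel_iff) auto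
    moreover have "ln (cmod (Complex u y)) \<le> 0" using True nz by (subst ln_le_zero_iff) auto
    ultimately have "\<bar>ln (cmod (Complex u y))\<bar> \<le> \<bar>ln \<bar>u\<bar>\<bar>" by linarith
    then show ?thesis using abs_ln_le_log_majorant(1)[OF u] LB by linarith
  next
    case False
    have "ln (cmod (Complex u y)) \<le> cmod (Complex u y) - 1" using nz by (intro ln_le_minus_one) auto
    moreover have "0 \<le> ln (cmod (Complex u y))" using False by simp
    ultimately show ?thesis using le assms(3) u abs_ln_le_log_majorant(2)[OF u] by linarith
  qed
  have "indicator {- L..L} u = (1 :: real)" using u by (auto simp: abs_le_iff)
  then have le': "norm (log_uhp (Complex u y)) \<le> log_majorant L u + (L + B + 2 * pi) * indicator {- L..L} u"
    using norm_log_uhp_le[OF nz] ln_le by simp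
  have "norm (log_uhp (Complex u y)) * \<bar>\<rho> (x - u)\<bar> \<le>
      (log_majorant L u + (L + B + 2 * pi) * indicator {- L..L} u) * M"
    by (rule mult_mono[OF le' bound order_trans[OF norm_ge_zero le'] abs_ge_zero])
  then show ?thesis by (simp add: norm_mult mult.commute)
qed

lemma majorant_integrable:
  "integrable lborel (\<lambda>u. M * (log_majorant L u + C * indicator {- L..L} u))"
  by (intro integrable_mult_right Bochner_Integration.integrable_add log_majorant_integrable integrable_real_indicator)
     (auto simp: emeasure_lborel_Icc_eq)

lemma log_transform_continuous: "continuous_on {z. Im z \<ge> 0} (log_transform \<rho>)"
proof (rule continuous_on_sequentiallyI)
  fix Z z assume Z: "\<forall>n. Z n \<in> {z. 0 \<le> Im z}" and z: "z \<in> {z. 0 \<le> Im z}" and lim: "Z \<longlonglongrightarrow> z"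
  have "Bseq Z" using lim convergentI convergent_imp_Bseq by blast
  then obtain B where B: "\<And>n. norm (Z n) \<le> B" by (auto simp: Bseq_def)
  define L where "L = B + \<bar>a\<bar> + \<bar>b\<bar>"
  have limI: "(\<lambda>n. Im (Z n)) \<longlonglongrightarrow> Im z" and limR: "(\<lambda>n. Re (Z n)) \<longlonglongrightarrow> Re z"
    using lim by (auto intro: tendsto_intros)
  have nz: "AE u in lborel. u \<noteq> (0::real)" by (rule AE_lborel_singleton)
  show "(\<lambda>n. log_transform \<rho> (Z n)) \<longlonglongrightarrow> log_transform \<rho> z"
    unfolding log_transform_shift
  proof (rule integral_dominated_convergence)
    show "integrable lborel (\<lambda>u. M * (log_majorant L u + (L + B + 2 * pi) * indicator {- L..L} u))"
      by (rule majorant_integrable)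
    show "AE u in lborel. (\<lambda>n. log_uhp (Complex u (Im (Z n))) * of_real (\<rho> (Re (Z n) - u)))
        \<longlonglongrightarrow> log_uhp (Complex u (Im z)) * of_real (\<rho> (Re z - u))"
      using nz
    proof eventually_elim
      case (elim u)
      have 1: "(\<lambda>n. Complex u (Im (Z n))) \<longlonglongrightarrow> Complex u (Im z)"
        by (intro tendsto_Complex tendsto_const limI)
      have 2: "isCont log_uhp (Complex u (Im z))"
        using z elim by (intro isCont_log_uhp) (auto simp: complex_eq_iff)
      have "isCont \<rho> (Re z - u)" using cont by (simp add: continuous_on_eq_continuous_at)
      then have 3: "(\<lambda>n. \<rho> (Re (Z n) - u)) \<longlonglongrightarrow> \<rho> (Re z - u)"
        by (rule isCont_tendsto_compose) (intro tendsto_intros limR)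
      show ?case by (intro tendsto_mult tendsto_of_real 3 isCont_tendsto_compose[OF 2 1])
    qed
    show "AE u in lborel. norm (log_uhp (Complex u (Im (Z n))) * of_real (\<rho> (Re (Z n) - u)))
        \<le> M * (log_majorant L u + (L + B + 2 * pi) * indicator {- L..L} u)" for n
      using nz
    proof eventually_elim
      case (elim u)
      show ?case
        using B[of n] Z abs_Re_le_cmod[of "Z n"] abs_Im_le_cmod[of "Z n"] elim
        by (intro log_integrand_bound L_def) auto
    qed
  qed (rule shifted_integrand_measurable)+
qed

lemma log_integrable:
  assumes "Im z \<ge> 0"
  shows "integrable lborel (\<lambda>y. log_uhp (z - of_real y) * of_real (\<rho> y))"
proof -
  define B where "B = norm z"
  define L where "L = B + \<bar>a\<bar> + \<bar>b\<bar>"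
  have "integrable lborel (\<lambda>u. log_uhp (Complex u (Im z)) * of_real (\<rho> (Re z - u)))"
  proof (rule Bochner_Integration.integrable_bound[OF majorant_integrable])
    show "AE u in lborel. norm (log_uhp (Complex u (Im z)) * of_real (\<rho> (Re z - u)))
        \<le> norm (M * (log_majorant L u + (L + B + 2 * pi) * indicator {- L..L} u))"
      using AE_lborel_singleton[of 0]
    proof eventually_elim
      case (elim u)
      have "norm (log_uhp (Complex u (Im z)) * of_real (\<rho> (Re z - u)))
        \<le> M * (log_majorant L u + (L + B + 2 * pi) * indicator {- L..L} u)"
        using assms abs_Re_le_cmod[of z] abs_Im_le_cmod[of z] elim
        by (intro log_integrand_bound L_def) (auto simp: B_def)
      then show ?case by (rule order_trans) simp
    qed
  qed (rule shifted_integrand_measurable)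
  from lborel_integrable_real_affine[OF this, of "-1" "Re z"]
  have "integrable lborel (\<lambda>y. log_uhp (Complex (Re z - y) (Im z)) * of_real (\<rho> y))" by simp
  moreover have "Complex (Re z - y) (Im z) = z - of_real y" for y by (simp add: complex_eq_iff)
  ultimately show ?thesis by simp
qed

lemma log_transform_has_derivative:
  assumes "Im z > 0"
  shows "(log_transform \<rho> has_field_derivative cauchy_transform a b \<rho> z) (at z)"
proof -
  define U where "U = {z. Im z > 0}"
  have U: "open U" "convex U" "z \<in> U"
    using assms by (auto simp: U_def open_halfspace_Im_gt convex_halfspace_Im_gt)
  have eq: "log_transform \<rho> z = integral (cbox a b) (\<lambda>y. log_uhp (z - of_real y) * of_real (\<rho> y))" if "z \<in> U" for z
  proof -
    have "set_integrable lborel {a..b} (\<lambda>y. log_uhp (z - of_real y) * of_real (\<rho> y))"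
      using log_integrable[of z] that unfolding set_integrable_def
      by (intro integrable_mult_indicator) (auto simp: U_def)
    from set_borel_integral_eq_integral(2)[OF this]
    have "integral {a..b} (\<lambda>y. log_uhp (z - of_real y) * of_real (\<rho> y)) =
        (LINT y:{a..b}|lborel. log_uhp (z - of_real y) * of_real (\<rho> y))" by simp
    also have "\<dots> = log_transform \<rho> z"
      unfolding log_transform_def set_lebesgue_integral_def
      by (intro Bochner_Integration.integral_cong refl) (auto simp: indicator_def zero)
    finally show ?thesis by simp
  qed
  have "((\<lambda>z. integral (cbox a b) (\<lambda>y. log_uhp (z - of_real y) * of_real (\<rho> y))) has_field_derivative
     integral (cbox a b) (\<lambda>y. of_real (\<rho> y) / (z - of_real y))) (at z within U)"
  proof (rule leibniz_rule_field_derivative[where U = U and fx = "\<lambda>z y. of_real (\<rho> y) / (z - of_real y)"])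
    fix x :: complex and t :: real assume x: "x \<in> U"
    have "((\<lambda>x. log_uhp (x - of_real t)) has_field_derivative 1 / (x - of_real t) * (1 - 0)) (at x)"
      using x by (intro DERIV_chain'[OF _ has_field_derivative_log_uhp] derivative_intros) (auto simp: U_def)
    then have "((\<lambda>x. log_uhp (x - of_real t) * of_real (\<rho> t)) has_field_derivative
        1 / (x - of_real t) * (1 - 0) * of_real (\<rho> t)) (at x)"
      by (rule DERIV_cmult_right)
    then show "((\<lambda>x. log_uhp (x - of_real t) * of_real (\<rho> t)) has_field_derivative of_real (\<rho> t) / (x - of_real t)) (at x within U)"
      by (simp add: has_field_derivative_at_within)
  next
    fix x assume x: "x \<in> U"
    have "isCont (\<lambda>y. log_uhp (x - of_real y)) y" for y :: real
    proof (rule isCont_o2[where f = "\<lambda>y. x - of_real y" and g = log_uhp])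
      show "isCont (\<lambda>y. x - of_real y) y" by (intro continuous_intros)
      show "isCont log_uhp (x - of_real y)"
        by (rule isCont_log_uhp) (use x in \<open>auto simp: U_def complex_eq_iff\<close>)
    qed
    then have "continuous_on {a..b} (\<lambda>y. log_uhp (x - of_real y))"
      by (simp add: continuous_at_imp_continuous_on)
    then show "(\<lambda>y. log_uhp (x - of_real y) * of_real (\<rho> y)) integrable_on cbox a b"
      unfolding cbox_interval
      by (intro integrable_continuous_interval continuous_on_mult continuous_on_of_real
          continuous_on_subset[OF cont]) auto
  next
    have "continuous_on (U \<times> cbox a b) (\<lambda>p. \<rho> (snd p))"
      by (rule continuous_on_compose2[OF cont continuous_on_snd[OF continuous_on_id]]) auto
    then show "continuous_on (U \<times> cbox a b) (\<lambda>(z, y). of_real (\<rho> y) / (z - of_real y))"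
      unfolding split_beta'
    proof (intro continuous_on_divide continuous_on_of_real continuous_on_diff continuous_on_fst
        continuous_on_snd continuous_on_id ballI)
      show "fst p - of_real (snd p) \<noteq> 0" if "p \<in> U \<times> cbox a b" for p
      proof
        assume "fst p - of_real (snd p) = 0"
        then have "Im (fst p) = 0" by (simp add: complex_eq_iff)
        then show False using that by (auto simp: U_def)
      qed
    qed
  qed (use U in auto)
  then have "((\<lambda>z. integral (cbox a b) (\<lambda>y. log_uhp (z - of_real y) * of_real (\<rho> y))) has_field_derivative
     cauchy_transform a b \<rho> z) (at z)"
    using U by (simp add: at_within_open[OF U(3,1)] cauchy_transform_def)
  then show ?thesis
    by (rule has_field_derivative_transform_within_open[OF _ U(1,3)]) (simp add: eq)
qed

lemma Re_log_transform_of_real: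
  "Re (log_transform \<rho> (of_real x)) = (\<integral> y. ln \<bar>x - y\<bar> * \<rho> y \<partial>lborel)"
proof -
  have "Re (log_transform \<rho> (of_real x)) =
      (\<integral> y. Re (log_uhp (of_real x - of_real y) * of_real (\<rho> y)) \<partial>lborel)"
    unfolding log_transform_def by (rule integral_Re[symmetric], rule log_integrable) simp
  also have "\<dots> = (\<integral> y. ln \<bar>x - y\<bar> * \<rho> y \<partial>lborel)"
  proof (rule integral_cong_AE)
    show "AE y in lborel. Re (log_uhp (of_real x - of_real y) * of_real (\<rho> y)) = ln \<bar>x - y\<bar> * \<rho> y"
      using AE_lborel_singleton[of x]
    proof eventually_elim
      case (elim y)
      then have "Re (log_uhp (of_real (x - y))) = ln (cmod (of_real (x - y)))" by (intro Re_log_uhp) auto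
      then show ?case by (simp del: of_real_diff flip: of_real_diff)
    qed
  qed auto
  finally show ?thesis .
qed

text \<open>By the jump of \<open>log_uhp\<close>, the imaginary part at t is pi times the integral
  of \<rho> over y > t. This statement stands in for the Plemelj formula.\<close>

lemma Im_log_transform_derivative:
  "((\<lambda>x. Im (log_transform \<rho> (of_real x))) has_real_derivative - pi * \<rho> x) (at x)"
proof -
  \<comment> \<open>Margins of 1 put x inside the open interval and B beyond the support, so the
    tail integral may stop at B.\<close>
  define A B where "A = min a x - 1" and "B = max b x + 1"
  have eq: "Im (log_transform \<rho> (of_real t)) = pi * integral {t..B} \<rho>" if t: "t \<in> {A<..<B}" for t
  proof -
    have "Im (log_transform \<rho> (of_real t)) =
        (\<integral> y. Im (log_uhp (of_real t - of_real y) * of_real (\<rho> y)) \<partial>lborel)"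
      unfolding log_transform_def by (rule integral_Im[symmetric], rule log_integrable) simp
    also have "\<dots> = (\<integral> y. pi * (indicator {t..B} y *\<^sub>R \<rho> y) \<partial>lborel)"
    proof (rule integral_cong_AE)
      show "AE y in lborel. Im (log_uhp (of_real t - of_real y) * of_real (\<rho> y)) = pi * (indicator {t..B} y *\<^sub>R \<rho> y)"
        using AE_lborel_singleton[of t]
      proof eventually_elim
        case (elim y)
        then consider "y < t" | "t < y" by linarith
        then show ?case
        proof cases
          case 1
          then show ?thesis using Im_log_uhp_of_real(1)[of "t - y"] by simp
        next
          case 2
          moreover have "\<rho> y = 0" if "y > B" using that by (intro zero) (auto simp: B_def)
          ultimately show ?thesis using Im_log_uhp_of_real(2)[of "t - y"] by (auto simp: indicator_def)
        qed
      qed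
    qed auto
    also have "\<dots> = pi * (LINT y:{t..B}|lborel. \<rho> y)" by (simp add: set_lebesgue_integral_def)
    also have "(LINT y:{t..B}|lborel. \<rho> y) = integral {t..B} \<rho>"
      by (intro set_borel_integral_eq_integral(2) borel_integrable_atLeastAtMost')
         (rule continuous_on_subset[OF cont], simp)
    finally show ?thesis .
  qed
  have x: "x \<in> {A<..<B}" "{A<..<B} \<subseteq> {A..B}" by (auto simp: A_def B_def)
  have "((\<lambda>t. pi * integral {t..B} \<rho>) has_real_derivative pi * (- \<rho> x)) (at x within {A..B})"
    using x by (intro DERIV_cmult integral_has_real_derivative' continuous_on_subset[OF cont]) auto
  then have "((\<lambda>t. pi * integral {t..B} \<rho>) has_real_derivative pi * (- \<rho> x)) (at x)"
    using has_field_derivative_subset[OF _ x(2)] at_within_open[OF x(1)] by (metis open_greaterThanLessThan)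
  then have "((\<lambda>x. Im (log_transform \<rho> (of_real x))) has_real_derivative pi * (- \<rho> x)) (at x)"
    by (rule has_field_derivative_transform_within_open[OF _ _ x(1)]) (auto simp: eq)
  then show ?thesis by simp
qed

lemma cauchy_transform_tendsto_0:
  "(cauchy_transform a b \<rho> \<longlongrightarrow> 0) (inf at_infinity (principal {z. Im z > 0}))"
proof (rule Lim_null_comparison)
  define N where "N = 2 * (\<bar>a\<bar> + \<bar>b\<bar>) + 1"
  define D where "D = \<bar>b - a\<bar> * M * 2"
  have "norm (cauchy_transform a b \<rho> z) \<le> D * norm (inverse z)" if z: "norm z \<ge> N" for z
  proof -
    have zp: "norm z > 0" using z by (auto simp: N_def)
    have M: "M \<ge> 0" using bound[of 0] by linarith
    have ptw: "norm (of_real (\<rho> y) / (z - of_real y)) \<le> 2 * M / norm z" if "y \<in> cbox a b" for y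
    proof -
      have "norm z - norm (of_real y :: complex) \<le> norm (z - of_real y)" by (rule norm_triangle_ineq2)
      moreover have "norm (of_real y :: complex) \<le> \<bar>a\<bar> + \<bar>b\<bar>" using that by auto
      ultimately have *: "norm z / 2 \<le> norm (z - of_real y)" using z by (auto simp: N_def)
      have "norm (of_real (\<rho> y) / (z - of_real y)) \<le> M / (norm z / 2)"
        unfolding norm_divide using bound[of y] * zp by (intro frac_le) auto
      then show ?thesis by (simp add: mult.commute)
    qed
    have nz: "z \<noteq> of_real y" if "y \<in> {a..b}" for y
    proof
      assume "z = of_real y"
      then have "norm z \<le> \<bar>a\<bar> + \<bar>b\<bar>" using that by auto
      then show False using z by (auto simp: N_def)
    qed
    have int: "(\<lambda>y. of_real (\<rho> y) / (z - of_real y)) integrable_on cbox a b"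
      unfolding cbox_interval
    proof (intro integrable_continuous_interval continuous_on_divide continuous_on_of_real
        continuous_on_diff continuous_on_const continuous_on_id ballI)
      show "continuous_on {a..b} \<rho>" by (rule continuous_on_subset[OF cont]) simp
      show "z - of_real y \<noteq> 0" if "y \<in> {a..b}" for y using nz[OF that] by simp
    qed
    have "norm (cauchy_transform a b \<rho> z) \<le> (2 * M / norm z) * measure lborel (cbox a b)"
      unfolding cauchy_transform_def
      using has_integral_bound[OF _ integrable_integral[OF int] ptw] M zp by simp
    also have "\<dots> \<le> D * norm (inverse z)"
    proof -
      have "measure lborel (cbox a b) \<le> \<bar>b - a\<bar>" by (simp add: content_real_if)
      then have "(2 * M / norm z) * measure lborel (cbox a b) \<le> (2 * M / norm z) * \<bar>b - a\<bar>"
        using M zp by (intro mult_left_mono) auto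
      then show ?thesis by (simp add: D_def norm_inverse divide_inverse mult_ac)
    qed
    finally show ?thesis .
  qed
  then show "eventually (\<lambda>z. norm (cauchy_transform a b \<rho> z) \<le> D * norm (inverse z)) (inf at_infinity (principal {z. Im z > 0}))"
    unfolding eventually_inf_principal eventually_at_infinity by (intro exI[of _ N]) simp
  show "((\<lambda>z. D * norm (inverse z)) \<longlongrightarrow> 0) (inf at_infinity (principal {z. Im z > (0::real)}))"
    by (rule tendsto_mono[OF inf_le1])
       (intro tendsto_mult_right_zero tendsto_norm_zero tendsto_inverse_0)
qed

end

section \<open>Reflection arguments in the upper half plane\<close>

lemma closed_superset_of_uhp:
  assumes "closed T" "\<And>z. Im z > 0 \<Longrightarrow> z \<in> T" "Im z \<ge> 0"
  shows "z \<in> T"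
proof -
  have "(\<lambda>n. z + \<i> * of_real (1 / real (Suc n))) \<longlonglongrightarrow> z + \<i> * of_real 0"
    by (intro tendsto_intros LIMSEQ_Suc lim_1_over_n)
  then have lim: "(\<lambda>n. z + \<i> * of_real (1 / real (Suc n))) \<longlonglongrightarrow> z" by simp
  have "z + \<i> * of_real (1 / real (Suc n)) \<in> T" for n
  proof (rule assms(2))
    have "Im (z + \<i> * of_real (1 / real (Suc n))) = Im z + 1 / real (Suc n)" by simp
    moreover have "1 / real (Suc n) > 0" by simp
    ultimately show "0 < Im (z + \<i> * of_real (1 / real (Suc n)))" using assms(3) by linarith
  qed
  then show ?thesis by (rule closed_sequentially[OF assms(1) _ lim])
qed

text \<open>Reflection across the interval extends f holomorphically to a disc around its midpoint,
  where zeros accumulate; the identity theorem gives f = 0 on the disc, then on the open half plane,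
  and continuity adds the boundary.\<close>

lemma uhp_boundary_zero:
  assumes hol: "f holomorphic_on {z. Im z > 0}" and cont: "continuous_on {z. Im z \<ge> 0} f"
    and zero: "\<And>x. p < x \<Longrightarrow> x < q \<Longrightarrow> f (of_real x) = 0" and "p < q" and z: "Im z \<ge> 0"
  shows "f z = 0"
proof -
  define m where "m = (p + q) / 2"
  define r where "r = (q - p) / 2"
  define B where "B = ball (complex_of_real m) r"
  have r: "r > 0" using \<open>p < q\<close> by (simp add: r_def)
  have Breal: "p < x \<and> x < q" if "complex_of_real x \<in> B" for x
  proof -
    have "dist (complex_of_real m) (of_real x) = \<bar>m - x\<bar>" by (simp add: dist_norm flip: of_real_diff)
    then have "\<bar>m - x\<bar> < r" using that by (simp add: B_def)
    then show ?thesis by (auto simp: m_def r_def abs_less_iff field_simps)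
  qed
  define g where "g = (\<lambda>z. if 0 \<le> Im z then f z else cnj (f (cnj z)))"
  have g: "g holomorphic_on B"
    unfolding g_def
  proof (rule Schwarz_reflection)
    show "cnj ` B \<subseteq> B"
    proof
      fix w assume "w \<in> cnj ` B"
      then obtain v where v: "v \<in> B" "w = cnj v" by auto
      have "cmod (cnj (of_real m - v)) = cmod (of_real m - v)" by (rule complex_mod_cnj)
      then show "w \<in> B" using v by (simp add: B_def dist_norm)
    qed
    show "f holomorphic_on (B \<inter> {z. 0 < Im z})" by (rule holomorphic_on_subset[OF hol]) auto
    show "continuous_on (B \<inter> {z. 0 \<le> Im z}) f" by (rule continuous_on_subset[OF cont]) auto
    show "f z \<in> \<real>" if "z \<in> B" "z \<in> \<real>" for z
      using that zero Breal by (auto elim!: Reals_cases)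
  qed (simp add: B_def)
  have gz: "g w = 0" if "w \<in> B" for w
  proof (rule analytic_continuation[OF g, where U = "complex_of_real ` {m - r<..<m + r}" and \<xi> = "of_real m"])
    show "open B" "connected B" by (simp_all add: B_def)
    show "complex_of_real ` {m - r<..<m + r} \<subseteq> B"
      by (auto simp: B_def dist_norm simp flip: of_real_diff)
    show "complex_of_real m \<in> B" using r by (simp add: B_def)
    show "complex_of_real m islimpt complex_of_real ` {m - r<..<m + r}"
      unfolding islimpt_approachable
    proof (intro allI impI)
      fix e :: real assume "e > 0"
      define d where "d = min e r / 2"
      have "d > 0" "d < e" "d < r" using \<open>e > 0\<close> r by (auto simp: d_def)
      then show "\<exists>x'\<in>complex_of_real ` {m - r<..<m + r}. x' \<noteq> of_real m \<and> dist x' (of_real m) < e"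
        by (intro bexI[of _ "of_real (m + d)"] imageI) (auto simp: dist_norm)
    qed
    show "g z = 0" if "z \<in> complex_of_real ` {m - r<..<m + r}" for z
      using that zero by (auto simp: g_def m_def r_def field_simps)
  qed (rule that)
  have pos: "f w = 0" if w: "Im w > 0" for w
  proof (rule analytic_continuation_open[where s = "B \<inter> {z. Im z > 0}" and s' = "{z. Im z > 0}" and f = f and g = "\<lambda>_. 0"])
    show "open (B \<inter> {z. Im z > 0})" by (auto simp: B_def open_halfspace_Im_gt)
    show "open {z. Im z > 0}" by (rule open_halfspace_Im_gt)
    have "norm (- (\<i> * of_real (r / 2))) = r / 2" using r by (simp add: norm_mult)
    then have "of_real m + \<i> * of_real (r / 2) \<in> B \<inter> {z. Im z > 0}"
      using r by (simp add: B_def dist_norm)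
    then show "B \<inter> {z. Im z > 0} \<noteq> {}" by blast
    show "connected {z. Im z > 0}" by (intro convex_connected convex_halfspace_Im_gt)
    show "f z = 0" if "z \<in> B \<inter> {z. Im z > 0}" for z using gz[of z] that by (auto simp: g_def)
  qed (use hol w in auto)
  have "closed {z. Im z \<ge> 0 \<and> f z = 0}"
    using continuous_closed_preimage_constant[OF cont closed_halfspace_Im_ge, of 0] by simp
  then have "z \<in> {z. Im z \<ge> 0 \<and> f z = 0}"
    by (rule closed_superset_of_uhp[OF _ _ z]) (simp add: pos)
  then show ?thesis by simp
qed

text \<open>The decay is asked of the derivative because logarithmic transforms themselves grow.
  Reflection makes f entire, its derivative tends to 0 at infinity in both half planes, so it
  vanishes identically.\<close>

lemma uhp_Liouville:
  assumes der: "\<And>z. Im z > 0 \<Longrightarrow> (f has_field_derivative f' z) (at z)"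
    and cont: "continuous_on {z. Im z \<ge> 0} f"
    and real: "\<And>x. f (of_real x) \<in> \<real>"
    and lim: "(f' \<longlongrightarrow> 0) (inf at_infinity (principal {z. Im z > 0}))"
  shows "\<exists>c. \<forall>z. Im z \<ge> 0 \<longrightarrow> f z = c"
proof -
  have hol: "f holomorphic_on {z. Im z > 0}"
    using der by (auto simp: holomorphic_on_def field_differentiable_def intro: has_field_derivative_at_within)
  define g where "g = (\<lambda>z. if 0 \<le> Im z then f z else cnj (f (cnj z)))"
  have g: "g holomorphic_on UNIV"
    unfolding g_def
    by (rule Schwarz_reflection) (use hol cont real in \<open>auto elim!: Reals_cases\<close>)
  have dup: "deriv g z = f' z" if "Im z > 0" for z
  proof (rule DERIV_imp_deriv)
    have z: "z \<in> {z. Im z > 0}" "open {z. Im z > (0::real)}" using that by (auto simp: open_halfspace_Im_gt)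
    show "(g has_field_derivative f' z) (at z)"
      by (rule has_field_derivative_transform_within_open[OF der[OF that] z(2,1)]) (simp add: g_def)
  qed
  have ddown: "deriv g z = cnj (f' (cnj z))" if "Im z < 0" for z
  proof (rule DERIV_imp_deriv)
    have z: "z \<in> {z. Im z < 0}" "open {z. Im z < (0::real)}" using that by (auto simp: open_halfspace_Im_lt)
    have "((cnj \<circ> f \<circ> cnj) has_field_derivative cnj (f' (cnj z))) (at z)"
      using that by (intro has_field_derivative_cnj_cnj der) simp
    then show "(g has_field_derivative cnj (f' (cnj z))) (at z)"
      by (rule has_field_derivative_transform_within_open[OF _ z(2,1)]) (simp add: g_def)
  qed
  have hd: "deriv g holomorphic_on UNIV" using g by (intro holomorphic_deriv) auto
  have "(deriv g \<longlongrightarrow> 0) at_infinity"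
  proof (rule tendstoI)
    fix e :: real assume e: "e > 0"
    have "eventually (\<lambda>z. Im z > 0 \<longrightarrow> dist (f' z) 0 < e / 2) at_infinity"
      using tendstoD[OF lim, of "e / 2"] e by (simp add: eventually_inf_principal)
    then obtain N where N: "\<And>z. N \<le> norm z \<Longrightarrow> Im z > 0 \<Longrightarrow> norm (f' z) < e / 2"
      by (auto simp: eventually_at_infinity)
    have nonreal: "norm (deriv g z) < e / 2" if "N \<le> norm z" "Im z \<noteq> 0" for z
    proof (cases "Im z > 0")
      case True
      then show ?thesis using N that by (simp add: dup)
    next
      case False
      then show ?thesis using N[of "cnj z"] that by (simp add: ddown)
    qed
    have "norm (deriv g z) \<le> e / 2" if z: "N \<le> norm z" for z
    proof (cases "Im z = 0")
      case False
      then show ?thesis using nonreal that by (simp add: less_imp_le)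
    next
      case True
      \<comment> \<open>On the real axis the derivative of the extension is not given by f', so its
        bound is obtained as a limit from above. The points \<open>Z n\<close> are no smaller in
        modulus than z, hence still in the range of the estimate.\<close>
      define Z where "Z n = z + \<i> * of_real (1 / real (Suc n))" for n
      have "Z \<longlonglongrightarrow> z + \<i> * of_real 0"
        unfolding Z_def by (intro tendsto_intros LIMSEQ_Suc lim_1_over_n)
      moreover have "isCont (deriv g) z"
        using hd holomorphic_on_imp_continuous_on continuous_on_eq_continuous_at by blast
      ultimately have "(\<lambda>n. norm (deriv g (Z n))) \<longlonglongrightarrow> norm (deriv g z)"
        by (intro tendsto_norm isCont_tendsto_compose[of z "deriv g"]) auto
      moreover have "norm (deriv g (Z n)) \<le> e / 2" for n
      proof -
        have "norm z \<le> norm (Z n)"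
          using True by (simp add: Z_def cmod_def)
        then have "norm (deriv g (Z n)) < e / 2" using True z by (intro nonreal) (auto simp: Z_def)
        then show ?thesis by simp
      qed
      ultimately show ?thesis by (intro tendsto_upperbound[where F = sequentially]) auto
    qed
    then have "\<forall>z. N \<le> norm z \<longrightarrow> dist (deriv g z) 0 < e" using e by (smt (verit) dist_norm diff_zero field_sum_of_halves)
    then show "eventually (\<lambda>z. dist (deriv g z) 0 < e) at_infinity" by (auto simp: eventually_at_infinity)
  qed
  then have d0: "deriv g z = 0" for z by (rule Liouville_weak_0[OF hd])
  have "\<exists>c. \<forall>z\<in>UNIV. g z = c"
  proof (rule has_field_derivative_zero_constant)
    show "(g has_field_derivative 0) (at z within UNIV)" for z
      using holomorphic_derivI[OF g open_UNIV, of z] by (simp add: d0)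
  qed simp
  then show ?thesis by (auto simp: g_def split: if_splits)
qed

section \<open>The square root on the closed upper half plane\<close>

definition sqrt_uhp :: "complex \<Rightarrow> complex" where
  "sqrt_uhp w = cis (pi / 4) * csqrt (- \<i> * w)"

lemma cis_pi_quarter_power2: "(cis (pi / 4))\<^sup>2 = \<i>" "(cis (- pi / 4))\<^sup>2 = - \<i>"
proof -
  have "pi / 4 + pi / 4 = pi / 2" "- pi / 4 + - pi / 4 = - (pi / 2)" by simp_all
  then show "(cis (pi / 4))\<^sup>2 = \<i>" "(cis (- pi / 4))\<^sup>2 = - \<i>"
    unfolding power2_eq_square cis_mult by (simp_all only: cis_pi_half cis_minus_pi_half)
qed

lemma sqrt_uhp_power2: "(sqrt_uhp w)\<^sup>2 = w"
  unfolding sqrt_uhp_def power_mult_distrib cis_pi_quarter_power2 by simp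

lemma sqrt_uhp_of_real_pos:
  assumes "x \<ge> 0"
  shows "sqrt_uhp (of_real x) = of_real (sqrt x)"
proof -
  have "csqrt (- \<i> * of_real x) = of_real (sqrt x) * cis (- pi / 4)" (is "_ = ?w")
  proof (cases "x = 0")
    case False
    show ?thesis
    proof (rule csqrt_unique)
      show "?w\<^sup>2 = - \<i> * of_real x"
        unfolding power_mult_distrib cis_pi_quarter_power2
        using assms by (simp flip: of_real_power)
      have "Re ?w = sqrt x * cos (pi / 4)" by simp
      then have "Re ?w > 0" using assms False by (simp add: cos_45)
      then show "0 < Re ?w \<or> Re ?w = 0 \<and> 0 \<le> Im ?w" by simp
    qed
  qed simp
  moreover have "cis (pi / 4) * cis (- pi / 4) = 1" by (simp add: cis_mult)
  ultimately have "sqrt_uhp (of_real x) = cis (pi / 4) * (of_real (sqrt x) * cis (- pi / 4))"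
    and "cis (pi / 4) * cis (- pi / 4) = 1" unfolding sqrt_uhp_def by metis+
  then show ?thesis by (metis mult.left_commute mult_1_right)
qed

lemma sqrt_uhp_of_real_neg:
  assumes "x \<le> 0"
  shows "sqrt_uhp (of_real x) = \<i> * of_real (sqrt (- x))"
proof -
  have "csqrt (- \<i> * of_real x) = of_real (sqrt (- x)) * cis (pi / 4)" (is "_ = ?w")
  proof (cases "x = 0")
    case False
    show ?thesis
    proof (rule csqrt_unique)
      show "?w\<^sup>2 = - \<i> * of_real x"
        unfolding power_mult_distrib cis_pi_quarter_power2
        using assms by (simp flip: of_real_power)
      have "Re ?w = sqrt (- x) * cos (pi / 4)" by simp
      then have "Re ?w > 0" using assms False by (simp add: cos_45)
      then show "0 < Re ?w \<or> Re ?w = 0 \<and> 0 \<le> Im ?w" by simp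
    qed
  qed simp
  then have "sqrt_uhp (of_real x) = of_real (sqrt (- x)) * (cis (pi / 4))\<^sup>2"
    unfolding sqrt_uhp_def power2_eq_square by (simp only: mult.left_commute)
  then show ?thesis by (simp only: cis_pi_quarter_power2 mult.commute)
qed

lemma norm_sqrt_uhp: "norm (sqrt_uhp w) = sqrt (norm w)"
proof -
  have "norm (sqrt_uhp w) ^ 2 = norm w" by (simp add: sqrt_uhp_power2 flip: norm_power)
  then show ?thesis by (metis norm_ge_zero real_sqrt_unique)
qed

lemma sqrt_uhp_continuous: "continuous_on {z. Im z \<ge> 0} sqrt_uhp"
  unfolding continuous_on_def
proof
  fix w assume w: "w \<in> {z. 0 \<le> Im z}"
  show "(sqrt_uhp \<longlongrightarrow> sqrt_uhp w) (at w within {z. 0 \<le> Im z})"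
  proof (cases "w = 0")
    case True
    have "((\<lambda>z. norm (sqrt_uhp z)) \<longlongrightarrow> sqrt (norm (0::complex))) (at 0 within {z. 0 \<le> Im z})"
      unfolding norm_sqrt_uhp by (intro tendsto_intros)
    then have "(sqrt_uhp \<longlongrightarrow> 0) (at 0 within {z. 0 \<le> Im z})"
      by (simp add: tendsto_norm_zero_iff)
    then show ?thesis using True by (simp add: sqrt_uhp_def)
  next
    case False
    have "- \<i> * w \<notin> \<real>\<^sub>\<le>\<^sub>0" using w False by (intro minus_i_times_nonpos) auto
    then have "isCont csqrt (- \<i> * w)" by (rule continuous_at_csqrt)
    then have "isCont (\<lambda>w. csqrt (- \<i> * w)) w"
      by (intro isCont_o2[where f = "\<lambda>w. - \<i> * w" and g = csqrt] continuous_intros)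
    then have "isCont sqrt_uhp w"
      unfolding sqrt_uhp_def by (intro continuous_intros)
    then show ?thesis unfolding isCont_def by (rule Lim_at_imp_Lim_at_within)
  qed
qed

lemma sqrt_uhp_holomorphic: "sqrt_uhp holomorphic_on {z. Im z > 0}"
  unfolding sqrt_uhp_def
proof (intro holomorphic_on_mult holomorphic_on_const holomorphic_on_csqrt' holomorphic_on_ident)
  show "- \<i> * z \<notin> \<real>\<^sub>\<le>\<^sub>0" if "z \<in> {z. Im z > 0}" for z
    using that by (intro minus_i_times_nonpos) auto
qed

text \<open>For the quotient r one has r^2 - 1 = -e/z. Numerator and denominator lie in the sector
  |Im| <= Re, so Re r >= 0 and |r + 1| >= 1, whence |r - 1| <= |r^2 - 1|.\<close>

lemma sqrt_uhp_quotient: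
  assumes "Im z > 0"
  shows "norm (sqrt_uhp (z - of_real e) / sqrt_uhp z - 1) \<le> \<bar>e\<bar> * norm (inverse z)"
proof -
  define A where "A = csqrt (- \<i> * (z - of_real e))"
  define B where "B = csqrt (- \<i> * z)"
  have z: "z \<noteq> 0" using assms by auto
  have A2: "A ^ 2 = - \<i> * (z - of_real e)" and B2: "B ^ 2 = - \<i> * z" by (simp_all add: A_def B_def)
  have Ap: "Re A \<ge> 0" "Re B \<ge> 0"
  proof -
    have "0 \<le> Re (csqrt w)" for w using csqrt_principal[of w] by (auto simp del: csqrt.simps)
    then show "Re A \<ge> 0" "Re B \<ge> 0" unfolding A_def B_def by blast+
  qed
  have "Re (A ^ 2) > 0" "Re (B ^ 2) > 0" using assms by (simp_all add: A2 B2)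
  then have "(Im A)\<^sup>2 \<le> (Re A)\<^sup>2" "(Im B)\<^sup>2 \<le> (Re B)\<^sup>2" by (simp_all add: power2_eq_square)
  then have le: "\<bar>Im A\<bar> \<le> Re A" "\<bar>Im B\<bar> \<le> Re B" using Ap by (metis abs_le_square_iff abs_of_nonneg)+
  have "\<bar>Im A * Im B\<bar> \<le> Re A * Re B" unfolding abs_mult using le Ap by (intro mult_mono) auto
  then have "Re A * Re B + Im A * Im B \<ge> 0" by linarith
  define r where "r = A / B"
  have "Re r = (Re A * Re B + Im A * Im B) / ((Re B)\<^sup>2 + (Im B)\<^sup>2)" by (simp add: r_def Re_divide)
  then have "Re r \<ge> 0" using \<open>Re A * Re B + Im A * Im B \<ge> 0\<close> by simp
  then have "1 \<le> norm (r + 1)" using complex_Re_le_cmod[of "r + 1"] by simp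
  have "r ^ 2 - 1 = - of_real e * inverse z"
    using z by (simp add: r_def power_divide A2 B2 field_simps)
  then have "(r - 1) * (r + 1) = - of_real e * inverse z" by (simp add: algebra_simps power2_eq_square)
  then have "norm ((r - 1) * (r + 1)) = norm (- of_real e * inverse z)" by (rule arg_cong)
  then have "norm (r - 1) * norm (r + 1) = \<bar>e\<bar> * norm (inverse z)"
    by (simp only: norm_mult norm_minus_cancel norm_of_real)
  moreover have "norm (r - 1) * 1 \<le> norm (r - 1) * norm (r + 1)"
    using \<open>1 \<le> norm (r + 1)\<close> by (intro mult_left_mono) auto
  ultimately have "norm (r - 1) \<le> \<bar>e\<bar> * norm (inverse z)" by simp
  moreover have "sqrt_uhp (z - of_real e) / sqrt_uhp z = r"
    by (simp add: sqrt_uhp_def r_def A_def B_def)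
  ultimately show ?thesis by simp
qed

lemma sqrt_uhp_quotient_tendsto:
  "((\<lambda>z. sqrt_uhp (z - of_real e) / sqrt_uhp z) \<longlongrightarrow> 1) (inf at_infinity (principal {z. Im z > 0}))"
proof (rule Lim_null[THEN iffD2])
  show "((\<lambda>z. sqrt_uhp (z - of_real e) / sqrt_uhp z - 1) \<longlongrightarrow> 0) (inf at_infinity (principal {z. Im z > 0}))"
  proof (rule Lim_null_comparison)
    show "eventually (\<lambda>z. norm (sqrt_uhp (z - of_real e) / sqrt_uhp z - 1) \<le> \<bar>e\<bar> * norm (inverse z))
       (inf at_infinity (principal {z. Im z > 0}))"
      unfolding eventually_inf_principal using sqrt_uhp_quotient by simp
    show "((\<lambda>z. \<bar>e\<bar> * norm (inverse z)) \<longlongrightarrow> 0) (inf at_infinity (principal {z. Im z > (0::real)}))"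
      by (rule tendsto_mono[OF inf_le1])
         (intro tendsto_mult_right_zero tendsto_norm_zero tendsto_inverse_0)
  qed
qed

section \<open>Square root of a quartic and two-cut densities\<close>

definition quartic :: "real \<Rightarrow> real \<Rightarrow> real \<Rightarrow> real \<Rightarrow> real \<Rightarrow> real" where
  "quartic a b c d x = (x - a) * (x - b) * (x - c) * (x - d)"

text \<open>Truncating at 0 replaces an indicator of the cuts, so the weight is continuous in x and
  in the endpoints at once.\<close>

definition cut_weight :: "real \<Rightarrow> real \<Rightarrow> real \<Rightarrow> real \<Rightarrow> real \<Rightarrow> real" where
  "cut_weight a b c d x = sqrt (max 0 (- quartic a b c d x))"

text \<open>The product is split into two truncated factors because truncating the quartic itself
  would also leave positive values outside [a, d]; the first factor already vanishes off the
  gap.\<close>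

definition gap_weight :: "real \<Rightarrow> real \<Rightarrow> real \<Rightarrow> real \<Rightarrow> real \<Rightarrow> real" where
  "gap_weight a b c d x = sqrt (max 0 ((x - b) * (c - x))) * sqrt (max 0 ((x - a) * (d - x)))"

definition sqrt_quartic :: "real \<Rightarrow> real \<Rightarrow> real \<Rightarrow> real \<Rightarrow> complex \<Rightarrow> complex" where
  "sqrt_quartic a b c d z = sqrt_uhp (z - of_real a) * sqrt_uhp (z - of_real b) *
     sqrt_uhp (z - of_real c) * sqrt_uhp (z - of_real d)"

lemma cut_weight_continuous: "continuous_on A (cut_weight a b c d)"
  unfolding cut_weight_def quartic_def by (intro continuous_intros)

lemma cut_weight_nonneg: "cut_weight a b c d x \<ge> 0"
  by (simp add: cut_weight_def)

lemma gap_weight_continuous: "continuous_on A (gap_weight a b c d)"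
  unfolding gap_weight_def by (intro continuous_intros)

lemma sqrt_quartic_continuous: "continuous_on {z. Im z \<ge> 0} (sqrt_quartic a b c d)"
  unfolding sqrt_quartic_def
  by (intro continuous_on_mult continuous_on_compose2[OF sqrt_uhp_continuous]
       continuous_on_diff continuous_on_id continuous_on_const) auto

lemma sqrt_quartic_holomorphic: "sqrt_quartic a b c d holomorphic_on {z. Im z > 0}"
proof -
  have "(\<lambda>z. sqrt_uhp (z - of_real e)) holomorphic_on {z. Im z > 0}" for e
  proof -
    have "(sqrt_uhp \<circ> (\<lambda>z. z - of_real e)) holomorphic_on {z. Im z > 0}"
      by (rule holomorphic_on_compose_gen[OF _ sqrt_uhp_holomorphic])
         (auto intro: holomorphic_on_diff holomorphic_on_ident holomorphic_on_const)
    then show ?thesis by (simp add: comp_def)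
  qed
  then show ?thesis unfolding sqrt_quartic_def by (intro holomorphic_on_mult)
qed

text \<open>A derivative relative to the closed half plane suffices along the real line, which lies
  inside that half plane.\<close>

lemma derivative_within_uhp_of_real:
  assumes "(f has_field_derivative f') (at (of_real x) within {z. Im z \<ge> 0})"
  shows "((\<lambda>t. Re (f (of_real t))) has_real_derivative Re f') (at x)"
    and "((\<lambda>t. Im (f (of_real t))) has_real_derivative Im f') (at x)"
proof -
  have "(complex_of_real has_vector_derivative 1) (at x)"
    using has_vector_derivative_of_real[OF DERIV_ident] by simp
  moreover have "(f has_field_derivative f') (at (of_real x) within range complex_of_real)"
    by (rule has_field_derivative_subset[OF assms]) auto
  ultimately have "(f \<circ> complex_of_real has_vector_derivative 1 * f') (at x)"
    by (rule field_vector_diff_chain_within)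
  then have *: "((\<lambda>t. f (of_real t)) has_vector_derivative f') (at x)" by (simp add: comp_def)
  show "((\<lambda>t. Re (f (of_real t))) has_real_derivative Re f') (at x)"
    unfolding has_real_derivative_iff_has_vector_derivative
    by (rule bounded_linear.has_vector_derivative[OF bounded_linear_Re *])
  show "((\<lambda>t. Im (f (of_real t))) has_real_derivative Im f') (at x)"
    unfolding has_real_derivative_iff_has_vector_derivative
    by (rule bounded_linear.has_vector_derivative[OF bounded_linear_Im *])
qed

text \<open>The closed half plane is convex, so a function continuous on it and holomorphic inside
  has a primitive whose derivative relations reach the boundary. This allows comparing boundary
  values without contour integrals.\<close>

lemma uhp_primitive:
  assumes "continuous_on {z. Im z \<ge> 0} f" "f holomorphic_on {z. Im z > 0}"
  obtains F where "\<And>z. Im z \<ge> 0 \<Longrightarrow> (F has_field_derivative f z) (at z within {z. Im z \<ge> 0})"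
    and "continuous_on {z. Im z \<ge> 0} F"
    and "\<And>z. Im z > 0 \<Longrightarrow> (F has_field_derivative f z) (at z)"
proof -
  have "interior {z. Im z \<ge> 0} = {z. Im z > 0}"
    using interior_halfspace_ge[of \<i> 0] by (simp add: inner_complex_def)
  then have "f field_differentiable at x" if "x \<in> interior {z. Im z \<ge> 0} - {}" for x
    using assms(2) that by (simp add: holomorphic_on_open open_halfspace_Im_gt field_differentiable_def)
  then obtain F where F: "\<And>z. z \<in> {z. Im z \<ge> 0} \<Longrightarrow> (F has_field_derivative f z) (at z within {z. Im z \<ge> 0})"
    using holomorphic_convex_primitive[OF convex_halfspace_Im_ge finite.emptyI assms(1)] by blast
  show ?thesis
  proof
    show "(F has_field_derivative f z) (at z within {z. Im z \<ge> 0})" if "Im z \<ge> 0" for z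
      using F that by simp
    then show "continuous_on {z. Im z \<ge> 0} F"
      by (intro DERIV_continuous_on[where D = f]) simp
    show "(F has_field_derivative f z) (at z)" if z: "Im z > 0" for z
    proof -
      have "(F has_field_derivative f z) (at z within {z. Im z > 0})"
        by (rule has_field_derivative_subset[OF F]) (use z in auto)
      then show ?thesis using z at_within_open[of z "{z. Im z > 0}"] open_halfspace_Im_gt[of 0] by simp
    qed
  qed
qed

locale two_cuts =
  fixes a b c d :: real
  assumes ab: "a < b" and bc: "b < c" and cd: "c < d"
begin

lemma quartic_pairs: "quartic a b c d x = ((x - a) * (x - b)) * ((x - c) * (x - d))"
  by (simp add: quartic_def mult.assoc)

lemma quartic_pos:
  assumes "x < a \<or> (b < x \<and> x < c) \<or> d < x"
  shows "quartic a b c d x > 0"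
proof -
  consider "x < a" | "b < x" "x < c" | "d < x" using assms by blast
  then have "0 < (x - a) * (x - b) \<and> 0 < (x - c) * (x - d)"
  proof cases
    case 1
    then show ?thesis using ab bc cd by (intro conjI mult_neg_neg) linarith+
  next
    case 2
    then show ?thesis using ab bc cd by (intro conjI mult_pos_pos[of "x - a"] mult_neg_neg) linarith+
  next
    case 3
    then show ?thesis using ab bc cd by (intro conjI mult_pos_pos) linarith+
  qed
  then show ?thesis unfolding quartic_pairs by simp
qed

lemma quartic_neg:
  assumes "(a < x \<and> x < b) \<or> (c < x \<and> x < d)"
  shows "quartic a b c d x < 0"
  using assms
proof (elim disjE conjE)
  assume x: "a < x" "x < b"
  have "(x - a) * (x - b) < 0" using x by (intro mult_pos_neg) linarith+
  moreover have "0 < (x - c) * (x - d)" using x bc cd by (intro mult_neg_neg) linarith+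
  ultimately show ?thesis unfolding quartic_pairs by (rule mult_neg_pos)
next
  assume x: "c < x" "x < d"
  have "0 < (x - a) * (x - b)" using x ab bc by (intro mult_pos_pos) linarith+
  moreover have "(x - c) * (x - d) < 0" using x by (intro mult_pos_neg) linarith+
  ultimately show ?thesis unfolding quartic_pairs by (rule mult_pos_neg)
qed

lemma quartic_nonneg: "x \<le> a \<or> (b \<le> x \<and> x \<le> c) \<or> d \<le> x \<Longrightarrow> quartic a b c d x \<ge> 0"
  using quartic_pos[of x] by (auto simp: quartic_def le_less)

lemma quartic_nonpos: "(a \<le> x \<and> x \<le> b) \<or> (c \<le> x \<and> x \<le> d) \<Longrightarrow> quartic a b c d x \<le> 0"
  using quartic_neg[of x] by (auto simp: quartic_def le_less)

lemma cut_weight_eq_0: "x \<notin> {a..b} \<union> {c..d} \<Longrightarrow> cut_weight a b c d x = 0"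
  using quartic_pos[of x] by (auto simp: cut_weight_def not_le)

lemma cut_weight_pos: "(a < x \<and> x < b) \<or> (c < x \<and> x < d) \<Longrightarrow> cut_weight a b c d x > 0"
  using quartic_neg[of x] by (simp add: cut_weight_def)

lemma gap_weight_eq:
  assumes "b \<le> x" "x \<le> c"
  shows "gap_weight a b c d x = sqrt (quartic a b c d x)"
proof -
  have "0 \<le> (x - b) * (c - x)" "0 \<le> (x - a) * (d - x)" using assms ab bc cd by simp_all
  then have "gap_weight a b c d x = sqrt (((x - b) * (c - x)) * ((x - a) * (d - x)))"
    by (simp only: gap_weight_def max_absorb2 real_sqrt_mult)
  also have "((x - b) * (c - x)) * ((x - a) * (d - x)) = quartic a b c d x"
    by (simp add: quartic_def algebra_simps)
  finally show ?thesis .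
qed

lemma gap_weight_eq_0:
  assumes "x \<notin> {b..c}"
  shows "gap_weight a b c d x = 0"
proof -
  have "x < b \<or> c < x" using assms by auto
  then have "(x - b) * (c - x) \<le> 0"
    using bc by (auto intro: mult_nonpos_nonneg mult_nonneg_nonpos)
  then show ?thesis by (simp add: gap_weight_def)
qed

text \<open>To the right of d all four factors are positive. Each endpoint passed from right to left
  turns one factor into i times a positive number, so the phases on the five intervals, read from
  the right, are 1, i, -1, -i, 1.\<close>

lemma sqrt_quartic_outer:
  assumes "x \<le> a \<or> d \<le> x"
  shows "sqrt_quartic a b c d (of_real x) = of_real (sqrt (quartic a b c d x))"
  using assms
proof
  assume "x \<le> a"
  then have "sqrt_quartic a b c d (of_real x) =
     of_real (sqrt (a - x) * sqrt (b - x) * sqrt (c - x) * sqrt (d - x))"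
    using ab bc cd unfolding sqrt_quartic_def
    by (simp add: sqrt_uhp_of_real_neg mult_ac del: of_real_diff flip: of_real_diff)
  then show ?thesis by (simp add: quartic_def algebra_simps flip: real_sqrt_mult)
next
  assume "d \<le> x"
  then show ?thesis
    using ab bc cd unfolding sqrt_quartic_def
    by (simp add: sqrt_uhp_of_real_pos quartic_def real_sqrt_mult del: of_real_diff flip: of_real_diff)
qed

lemma sqrt_quartic_left_cut:
  assumes "a \<le> x" "x \<le> b"
  shows "sqrt_quartic a b c d (of_real x) = - \<i> * of_real (cut_weight a b c d x)"
proof -
  have "sqrt_quartic a b c d (of_real x) =
     - \<i> * of_real (sqrt (x - a) * sqrt (b - x) * sqrt (c - x) * sqrt (d - x))"
    using ab bc cd assms unfolding sqrt_quartic_def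
    by (simp add: sqrt_uhp_of_real_neg sqrt_uhp_of_real_pos mult_ac del: of_real_diff flip: of_real_diff)
  moreover have "cut_weight a b c d x = sqrt (x - a) * sqrt (b - x) * sqrt (c - x) * sqrt (d - x)"
    using quartic_nonpos[of x] assms
    by (simp add: cut_weight_def quartic_def max_def algebra_simps flip: real_sqrt_mult)
  ultimately show ?thesis by simp
qed

lemma sqrt_quartic_gap:
  assumes "b \<le> x" "x \<le> c"
  shows "sqrt_quartic a b c d (of_real x) = - of_real (gap_weight a b c d x)"
proof -
  have "sqrt_quartic a b c d (of_real x) =
     - of_real (sqrt (x - a) * sqrt (x - b) * sqrt (c - x) * sqrt (d - x))"
    using ab bc cd assms unfolding sqrt_quartic_def
    by (simp add: sqrt_uhp_of_real_neg sqrt_uhp_of_real_pos mult_ac del: of_real_diff flip: of_real_diff)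
  moreover have "gap_weight a b c d x = sqrt (x - a) * sqrt (x - b) * sqrt (c - x) * sqrt (d - x)"
    using assms unfolding gap_weight_eq[OF assms]
    by (simp add: quartic_def algebra_simps flip: real_sqrt_mult)
  ultimately show ?thesis by simp
qed

lemma sqrt_quartic_right_cut:
  assumes "c \<le> x" "x \<le> d"
  shows "sqrt_quartic a b c d (of_real x) = \<i> * of_real (cut_weight a b c d x)"
proof -
  have "sqrt_quartic a b c d (of_real x) =
     \<i> * of_real (sqrt (x - a) * sqrt (x - b) * sqrt (x - c) * sqrt (d - x))"
    using ab bc cd assms unfolding sqrt_quartic_def
    by (simp add: sqrt_uhp_of_real_neg sqrt_uhp_of_real_pos mult_ac del: of_real_diff flip: of_real_diff)
  moreover have "cut_weight a b c d x = sqrt (x - a) * sqrt (x - b) * sqrt (x - c) * sqrt (d - x)"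
    using quartic_nonpos[of x] assms
    by (simp add: cut_weight_def quartic_def max_def algebra_simps flip: real_sqrt_mult)
  ultimately show ?thesis by simp
qed

end

lemma compact_density_ex:
  assumes "continuous_on UNIV \<rho>" "\<And>x. x \<notin> {a..b} \<Longrightarrow> \<rho> x = (0::real)"
  shows "\<exists>M. compact_density \<rho> a b M"
proof -
  have "bounded (\<rho> ` {a..b})"
    by (intro compact_imp_bounded compact_continuous_image compact_Icc continuous_on_subset[OF assms(1)]) auto
  then obtain B where B: "\<And>x. x \<in> {a..b} \<Longrightarrow> \<bar>\<rho> x\<bar> \<le> B" unfolding bounded_real by blast
  have "\<bar>\<rho> x\<bar> \<le> max B 0" for x
    using B[of x] assms(2)[of x] by (cases "x \<in> {a..b}") auto
  then show ?thesis using assms by (intro exI[of _ "max B 0"]) (simp add: compact_density_def)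
qed

section \<open>Polynomial part of the square root at infinity\<close>

definition root_lin :: "real \<Rightarrow> real \<Rightarrow> real \<Rightarrow> real \<Rightarrow> real" where
  "root_lin a b c d = - (a + b + c + d) / 2"

definition root_const :: "real \<Rightarrow> real \<Rightarrow> real \<Rightarrow> real \<Rightarrow> real" where
  "root_const a b c d = (a*b + a*c + a*d + b*c + b*d + c*d - (root_lin a b c d)\<^sup>2) / 2"

text \<open>With Q the quadratic polynomial part of sqrt R at infinity, R - Q^2 = 2
  \<open>rem_lin\<close> z + \<open>rem_const\<close>. The factor 2 is split off because sqrt R = Q
  + \<open>rem_lin\<close>/z + O(1/z^2).\<close>

definition rem_lin :: "real \<Rightarrow> real \<Rightarrow> real \<Rightarrow> real \<Rightarrow> real" where
  "rem_lin a b c d = (- (a*b*c + a*b*d + a*c*d + b*c*d) - 2 * root_lin a b c d * root_const a b c d) / 2"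

definition rem_const :: "real \<Rightarrow> real \<Rightarrow> real \<Rightarrow> real \<Rightarrow> real" where
  "rem_const a b c d = a*b*c*d - (root_const a b c d)\<^sup>2"

lemma quartic_root_expansion:
  fixes z :: complex
  shows "(z - of_real a) * (z - of_real b) * (z - of_real c) * (z - of_real d) =
    (z\<^sup>2 + of_real (root_lin a b c d) * z + of_real (root_const a b c d))\<^sup>2 +
      2 * of_real (rem_lin a b c d) * z + of_real (rem_const a b c d)"
proof -
  define A B D K where "A = root_lin a b c d" and "B = root_const a b c d"
    and "D = rem_lin a b c d" and "K = rem_const a b c d"
  have A: "2 * A = - (a + b + c + d)" by (simp add: A_def root_lin_def)
  have B: "A\<^sup>2 + 2 * B = a*b + a*c + a*d + b*c + b*d + c*d"
    by (simp add: B_def root_const_def A_def field_simps)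
  have D: "2 * A * B + 2 * D = - (a*b*c + a*b*d + a*c*d + b*c*d)"
    by (simp add: D_def rem_lin_def A_def B_def field_simps)
  have K: "B\<^sup>2 + K = a*b*c*d" by (simp add: K_def rem_const_def B_def)
  have "(z - of_real a) * (z - of_real b) * (z - of_real c) * (z - of_real d) =
     z^4 + of_real (- (a + b + c + d)) * z^3 + of_real (a*b + a*c + a*d + b*c + b*d + c*d) * z\<^sup>2 +
     of_real (- (a*b*c + a*b*d + a*c*d + b*c*d)) * z + of_real (a*b*c*d)"
    by (simp add: algebra_simps power2_eq_square power3_eq_cube power4_eq_xxxx)
  also have "\<dots> = (z\<^sup>2 + of_real A * z + of_real B)\<^sup>2 + 2 * of_real D * z + of_real K"
    unfolding A[symmetric] B[symmetric] D[symmetric] K[symmetric]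
    by (simp add: algebra_simps power2_eq_square power3_eq_cube power4_eq_xxxx)
  finally show ?thesis by (simp add: A_def B_def D_def K_def)
qed

text \<open>The polynomial part of (z - e) sqrt R at infinity; up to the normalisation 2/mass it is
  the derivative of the quartic potential.\<close>

definition drift :: "real \<Rightarrow> real \<Rightarrow> real \<Rightarrow> real \<Rightarrow> real \<Rightarrow> real poly" where
  "drift a b c d e = [:- e, 1:] * [:root_const a b c d, root_lin a b c d, 1:] + [:rem_lin a b c d:]"

definition drift_primitive :: "real \<Rightarrow> real \<Rightarrow> real \<Rightarrow> real \<Rightarrow> real \<Rightarrow> real poly" where
  "drift_primitive a b c d e =
     [:0, rem_lin a b c d - e * root_const a b c d, (root_const a b c d - e * root_lin a b c d) / 2,
       (root_lin a b c d - e) / 3, 1 / 4:]"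

lemma pderiv_drift_primitive: "pderiv (drift_primitive a b c d e) = drift a b c d e"
  by (simp add: drift_primitive_def drift_def pderiv_pCons field_simps)

text \<open>The drift minus (z - e) sqrt R, hence decaying at infinity. It turns out to be the
  Cauchy transform of the density |x - e| sqrt|R| / pi.\<close>

definition resolvent :: "real \<Rightarrow> real \<Rightarrow> real \<Rightarrow> real \<Rightarrow> real \<Rightarrow> complex \<Rightarrow> complex" where
  "resolvent a b c d e z =
     (z - of_real e) * (z\<^sup>2 + of_real (root_lin a b c d) * z + of_real (root_const a b c d))
       + of_real (rem_lin a b c d) - (z - of_real e) * sqrt_quartic a b c d z"

text \<open>Rationalising: with s = sqrt R and polynomial part Q, (s - Q)(s + Q) = 2Dz + K, and s +
  Q is z^2 times a function N tending to 2. So (z - e)(s - Q) tends to D, the constant that the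
  drift contains.\<close>

lemma resolvent_tendsto_0:
  "(resolvent a b c d e \<longlongrightarrow> 0) (inf at_infinity (principal {z. Im z > 0}))" (is "(_ \<longlongrightarrow> _) ?F")
proof -
  define A B D K where "A = complex_of_real (root_lin a b c d)" and "B = complex_of_real (root_const a b c d)"
    and "D = complex_of_real (rem_lin a b c d)" and "K = complex_of_real (rem_const a b c d)"
  define P where "P z = (sqrt_uhp (z - of_real a) / sqrt_uhp z) * (sqrt_uhp (z - of_real b) / sqrt_uhp z) *
     (sqrt_uhp (z - of_real c) / sqrt_uhp z) * (sqrt_uhp (z - of_real d) / sqrt_uhp z)" for z
  define N where "N z = P z + 1 + A * inverse z + B * (inverse z)\<^sup>2" for z
  have inv: "(inverse \<longlongrightarrow> (0::complex)) ?F" by (rule tendsto_mono[OF inf_le1 tendsto_inverse_0])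
  have "(P \<longlongrightarrow> 1 * 1 * 1 * 1) ?F"
    unfolding P_def by (intro tendsto_mult sqrt_uhp_quotient_tendsto)
  then have "(N \<longlongrightarrow> 1 * 1 * 1 * 1 + 1 + A * 0 + B * 0\<^sup>2) ?F"
    unfolding N_def by (intro tendsto_intros inv)
  then have N: "(N \<longlongrightarrow> 2) ?F" by simp
  have "((\<lambda>z. D - (1 - of_real e * inverse z) * (2 * D + K * inverse z) / N z) \<longlongrightarrow>
      D - (1 - of_real e * 0) * (2 * D + K * 0) / 2) ?F"
    by (intro tendsto_intros inv N) simp
  then have lim: "((\<lambda>z. D - (1 - of_real e * inverse z) * (2 * D + K * inverse z) / N z) \<longlongrightarrow> 0) ?F"
    by simp
  have "eventually (\<lambda>z. N z \<noteq> 0) ?F"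
    by (rule tendsto_imp_eventually_ne[OF N]) simp
  moreover have "eventually (\<lambda>z. Im z > 0) ?F" by (simp add: eventually_inf_principal)
  ultimately have "eventually (\<lambda>z. D - (1 - of_real e * inverse z) * (2 * D + K * inverse z) / N z = resolvent a b c d e z) ?F"
  proof eventually_elim
    case (elim z)
    define s where "s = sqrt_quartic a b c d z"
    define Q where "Q = z\<^sup>2 + A * z + B"
    have z: "z \<noteq> 0" using elim by auto
    have sz: "sqrt_uhp z ^ 4 = z\<^sup>2"
      using sqrt_uhp_power2[of z] by (simp flip: power_mult add: power2_eq_square power4_eq_xxxx)
    have "sqrt_uhp z \<noteq> 0" using sqrt_uhp_power2[of z] z by auto
    then have "s = P z * sqrt_uhp z ^ 4"
      by (simp add: s_def sqrt_quartic_def P_def power4_eq_xxxx)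
    then have s: "s = P z * z\<^sup>2" by (simp add: sz)
    have "s\<^sup>2 = (z - of_real a) * (z - of_real b) * (z - of_real c) * (z - of_real d)"
      by (simp add: s_def sqrt_quartic_def power_mult_distrib sqrt_uhp_power2)
    also have "\<dots> = Q\<^sup>2 + 2 * D * z + K"
      unfolding quartic_root_expansion Q_def A_def B_def D_def K_def ..
    finally have prod: "(s - Q) * (s + Q) = 2 * D * z + K" by (simp add: algebra_simps power2_eq_square)
    have sQ: "s + Q = z\<^sup>2 * N z"
      using z by (simp add: s Q_def N_def field_simps power2_eq_square)
    then have "s + Q \<noteq> 0" using elim z by simp
    then have "s - Q = (2 * D * z + K) / (s + Q)" using prod by (simp add: eq_divide_eq)
    then have "s - Q = (2 * D * z + K) / (z\<^sup>2 * N z)" by (simp only: sQ)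
    note sub = this
    have "resolvent a b c d e z = D - (z - of_real e) * (s - Q)"
      by (simp add: resolvent_def s_def Q_def A_def B_def D_def algebra_simps)
    then show ?case
      unfolding sub using elim z by (simp add: field_simps power2_eq_square)
  qed
  then show ?thesis by (rule Lim_transform_eventually[OF lim])
qed

section \<open>Unnormalised density and its effective potential\<close>

context two_cuts
begin

definition raw_density :: "real \<Rightarrow> real \<Rightarrow> real" where
  "raw_density e x = \<bar>x - e\<bar> * cut_weight a b c d x / pi"

lemma raw_density_continuous: "continuous_on A (raw_density e)"
  unfolding raw_density_def by (intro continuous_intros cut_weight_continuous) auto

lemma raw_density_zero: "x \<notin> {a..d} \<Longrightarrow> raw_density e x = 0"
  using ab bc cd by (auto simp: raw_density_def intro!: cut_weight_eq_0)

text \<open>The imaginary part of the root is negative on the left cut and positive on the right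
  one; as e lies in the gap, x - e has the same signs, and the product is nonnegative.\<close>

lemma Im_sqrt_quartic:
  assumes "b < e" "e < c"
  shows "(x - e) * Im (sqrt_quartic a b c d (of_real x)) = pi * raw_density e x"
proof -
  consider "x < a" | "a \<le> x" "x \<le> b" | "b < x" "x < c" | "c \<le> x" "x \<le> d" | "d < x" by linarith
  then show ?thesis
  proof cases
    case 1
    then show ?thesis using ab bc cd sqrt_quartic_outer[of x] by (simp add: raw_density_def cut_weight_eq_0)
  next
    case 2
    then show ?thesis using assms sqrt_quartic_left_cut[of x]
      by (simp add: raw_density_def) (simp add: algebra_simps)
  next
    case 3
    then show ?thesis using sqrt_quartic_gap[of x] by (simp add: raw_density_def cut_weight_eq_0)
  next
    case 4
    then show ?thesis using assms sqrt_quartic_right_cut[of x] by (simp add: raw_density_def)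
  next
    case 5
    then show ?thesis using ab bc cd sqrt_quartic_outer[of x] by (simp add: raw_density_def cut_weight_eq_0)
  qed
qed

text \<open>On the real line the imaginary parts of the logarithmic transform and of a primitive F
  of the resolvent have the same derivative. After subtracting a constant the difference is real
  there and its derivative decays, so it is constant by \<open>uhp_Liouville\<close>; the real parts
  then give the claim at every x, on and off the cuts.\<close>

lemma potential_derivative:
  assumes e: "b < e" "e < c"
  shows "((\<lambda>x. (\<integral> y. ln \<bar>x - y\<bar> * raw_density e y \<partial>lborel) - poly (drift_primitive a b c d e) x)
     has_real_derivative - (x - e) * Re (sqrt_quartic a b c d (of_real x))) (at x)"
proof -
  obtain M where M: "compact_density (raw_density e) a d M"
    using compact_density_ex[OF raw_density_continuous raw_density_zero] by blast
  interpret compact_density "raw_density e" a d M by (rule M)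
  define Q where "Q = resolvent a b c d e"
  have contQ: "continuous_on {z. Im z \<ge> 0} Q"
    unfolding Q_def resolvent_def by (intro continuous_intros sqrt_quartic_continuous)
  have holQ: "Q holomorphic_on {z. Im z > 0}"
    unfolding Q_def resolvent_def by (intro holomorphic_intros sqrt_quartic_holomorphic)
  obtain F where F: "\<And>z. Im z \<ge> 0 \<Longrightarrow> (F has_field_derivative Q z) (at z within {z. Im z \<ge> 0})"
    and Fc: "continuous_on {z. Im z \<ge> 0} F" and Fd: "\<And>z. Im z > 0 \<Longrightarrow> (F has_field_derivative Q z) (at z)"
    using uhp_primitive[OF contQ holQ] by blast
  have Qre: "Re (Q (of_real x)) = poly (drift a b c d e) x - (x - e) * Re (sqrt_quartic a b c d (of_real x))"
   and Qim: "Im (Q (of_real x)) = - (x - e) * Im (sqrt_quartic a b c d (of_real x))" for x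
  proof -
    have "Q (of_real x) = of_real (poly (drift a b c d e) x) - of_real (x - e) * sqrt_quartic a b c d (of_real x)"
      by (simp add: Q_def resolvent_def drift_def algebra_simps power2_eq_square)
    note eq = this
    show "Re (Q (of_real x)) = poly (drift a b c d e) x - (x - e) * Re (sqrt_quartic a b c d (of_real x))"
      "Im (Q (of_real x)) = - (x - e) * Im (sqrt_quartic a b c d (of_real x))"
      unfolding eq by (simp_all add: algebra_simps)
  qed
  define \<Phi> where "\<Phi> = log_transform (raw_density e)"
  have FRe: "((\<lambda>t. Re (F (of_real t))) has_real_derivative Re (Q (of_real x))) (at x)"
    and FIm: "((\<lambda>t. Im (F (of_real t))) has_real_derivative Im (Q (of_real x))) (at x)" for x
    using derivative_within_uhp_of_real[OF F] by auto
  have Im_der: "((\<lambda>t. Im (\<Phi> (of_real t)) - Im (F (of_real t))) has_real_derivative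
      - pi * raw_density e x - Im (Q (of_real x))) (at x)" for x
    unfolding \<Phi>_def by (intro DERIV_diff Im_log_transform_derivative FIm)
  have "((\<lambda>t. Im (\<Phi> (of_real t)) - Im (F (of_real t))) has_real_derivative 0) (at x)" for x
  proof -
    have "- pi * raw_density e x - Im (Q (of_real x)) = 0"
      using Im_sqrt_quartic[OF e, of x] by (simp add: Qim algebra_simps)
    with Im_der[of x] show ?thesis by (simp only:)
  qed
  then have "Im (\<Phi> (of_real x)) - Im (F (of_real x)) = Im (\<Phi> (of_real 0)) - Im (F (of_real 0))" for x
    by (intro DERIV_isconst_all[of "\<lambda>t. Im (\<Phi> (of_real t)) - Im (F (of_real t))"]) blast
  then obtain k where k: "\<And>x. Im (\<Phi> (of_real x)) - Im (F (of_real x)) = k" by metis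
  have "\<exists>C. \<forall>z. Im z \<ge> 0 \<longrightarrow> \<Phi> z - F z - \<i> * of_real k = C"
  proof (rule uhp_Liouville)
    show "((\<lambda>z. \<Phi> z - F z - \<i> * of_real k) has_field_derivative
        cauchy_transform a d (raw_density e) z - Q z - 0) (at z)" if "Im z > 0" for z
      unfolding \<Phi>_def by (intro DERIV_diff log_transform_has_derivative Fd that DERIV_const)
    show "continuous_on {z. 0 \<le> Im z} (\<lambda>z. \<Phi> z - F z - \<i> * of_real k)"
      unfolding \<Phi>_def by (intro continuous_intros log_transform_continuous Fc)
    show "\<Phi> (of_real x) - F (of_real x) - \<i> * of_real k \<in> \<real>" for x
      using k[of x] by (simp add: complex_is_Real_iff)
    have "((\<lambda>z. cauchy_transform a d (raw_density e) z - Q z - 0) \<longlongrightarrow> 0 - 0 - 0) (inf at_infinity (principal {z. 0 < Im z}))"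
      unfolding Q_def by (intro tendsto_diff cauchy_transform_tendsto_0 resolvent_tendsto_0 tendsto_const)
    then show "((\<lambda>z. cauchy_transform a d (raw_density e) z - Q z - 0) \<longlongrightarrow> 0) (inf at_infinity (principal {z. 0 < Im z}))"
      by simp
  qed
  then obtain C where C: "\<And>z. Im z \<ge> 0 \<Longrightarrow> \<Phi> z - F z - \<i> * of_real k = C" by blast
  have Re: "(\<integral> y. ln \<bar>x - y\<bar> * raw_density e y \<partial>lborel) = Re C + Re (F (of_real x))" for x
    unfolding Re_log_transform_of_real[symmetric] \<Phi>_def[symmetric] using C[of "of_real x"] by auto
  have "((\<lambda>x. (Re C + Re (F (of_real x))) - poly (drift_primitive a b c d e) x)
     has_real_derivative (0 + Re (Q (of_real x))) - poly (drift a b c d e) x) (at x)"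
    unfolding pderiv_drift_primitive[symmetric]
    by (intro DERIV_diff DERIV_add DERIV_const FRe poly_DERIV)
  moreover have "(0 + Re (Q (of_real x))) - poly (drift a b c d e) x = - (x - e) * Re (sqrt_quartic a b c d (of_real x))"
    by (simp add: Qre algebra_simps)
  ultimately show ?thesis unfolding Re by (simp only:)
qed

end

section \<open>Identification of the transform from one cut\<close>

lemma poly_map_poly_of_real: "poly (map_poly of_real p) (of_real x) = (of_real (poly p x) :: complex)"
  by (induction p) (simp_all add: map_poly_pCons)

text \<open>On (p, q) the Euler-Lagrange equation fixes the real part of the combination and the
  formula for the density fixes its imaginary part. Constancy on one interval spreads to the whole
  half plane by \<open>uhp_boundary_zero\<close>.\<close>

lemma (in compact_density) log_transform_boundary_match:
  fixes V :: "real poly" and g \<Gamma> :: "complex \<Rightarrow> complex"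
  assumes \<Gamma>: "\<And>z. Im z \<ge> 0 \<Longrightarrow> (\<Gamma> has_field_derivative g z) (at z within {z. Im z \<ge> 0})"
    and \<Gamma>c: "continuous_on {z. Im z \<ge> 0} \<Gamma>"
    and \<Gamma>d: "\<And>z. Im z > 0 \<Longrightarrow> (\<Gamma> has_field_derivative g z) (at z)"
    and pq: "p < q"
    and EL: "\<And>x. p < x \<Longrightarrow> x < q \<Longrightarrow> 2 * (\<integral> y. ln \<bar>x - y\<bar> * \<rho> y \<partial>lborel) - poly V x = lv"
    and gre: "\<And>x. p < x \<Longrightarrow> x < q \<Longrightarrow> Re (g (of_real x)) = 0"
    and gim: "\<And>x. p < x \<Longrightarrow> x < q \<Longrightarrow> \<kappa> * Im (g (of_real x)) = - 2 * pi * \<rho> x"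
  shows "\<exists>C. \<forall>z. Im z \<ge> 0 \<longrightarrow>
    2 * log_transform \<rho> z - poly (map_poly of_real V) z - of_real \<kappa> * \<Gamma> z = C"
proof -
  define W where "W z = 2 * log_transform \<rho> z - poly (map_poly of_real V) z - of_real \<kappa> * \<Gamma> z" for z
  have der: "((\<lambda>t. Re (\<Gamma> (of_real t))) has_real_derivative Re (g (of_real x))) (at x)"
    "((\<lambda>t. Im (\<Gamma> (of_real t))) has_real_derivative Im (g (of_real x))) (at x)" for x
    using derivative_within_uhp_of_real[OF \<Gamma>] by auto
  have Wre: "Re (W (of_real x)) = lv - \<kappa> * Re (\<Gamma> (of_real x))" if "x \<in> {p<..<q}" for x
    using EL[of x] that by (simp add: W_def poly_map_poly_of_real Re_log_transform_of_real)
  have Wim: "Im (W (of_real x)) = 2 * Im (log_transform \<rho> (of_real x)) - \<kappa> * Im (\<Gamma> (of_real x))" for x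
    by (simp add: W_def poly_map_poly_of_real)
  have "\<exists>c. \<forall>x\<in>{p<..<q}. lv - \<kappa> * Re (\<Gamma> (of_real x)) = c"
  proof (rule has_field_derivative_zero_constant)
    show "((\<lambda>x. lv - \<kappa> * Re (\<Gamma> (of_real x))) has_field_derivative 0) (at x within {p<..<q})"
      if "x \<in> {p<..<q}" for x
      using DERIV_diff[OF DERIV_const DERIV_cmult[OF der(1)[of x], of \<kappa>], of lv] gre[of x] that
      by (simp add: has_field_derivative_at_within)
  qed simp
  then obtain c1 where c1: "\<And>x. x \<in> {p<..<q} \<Longrightarrow> Re (W (of_real x)) = c1" using Wre by auto
  have "\<exists>c. \<forall>x\<in>{p<..<q}. 2 * Im (log_transform \<rho> (of_real x)) - \<kappa> * Im (\<Gamma> (of_real x)) = c"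
  proof (rule has_field_derivative_zero_constant)
    show "((\<lambda>x. 2 * Im (log_transform \<rho> (of_real x)) - \<kappa> * Im (\<Gamma> (of_real x))) has_field_derivative 0)
        (at x within {p<..<q})" if "x \<in> {p<..<q}" for x
      using DERIV_diff[OF DERIV_cmult[OF Im_log_transform_derivative[of x], of 2] DERIV_cmult[OF der(2)[of x], of \<kappa>]]
        gim[of x] that
      by (simp add: has_field_derivative_at_within)
  qed simp
  then obtain c2 where c2: "\<And>x. x \<in> {p<..<q} \<Longrightarrow> Im (W (of_real x)) = c2" using Wim by auto
  have "W z - Complex c1 c2 = 0" if z: "Im z \<ge> 0" for z
  proof (rule uhp_boundary_zero[OF _ _ _ pq z])
    have "log_transform \<rho> holomorphic_on {z. Im z > 0}" "\<Gamma> holomorphic_on {z. Im z > 0}"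
      using log_transform_has_derivative \<Gamma>d
      by (auto simp: holomorphic_on_def field_differentiable_def intro: has_field_derivative_at_within)
    then show "(\<lambda>z. W z - Complex c1 c2) holomorphic_on {z. 0 < Im z}"
      unfolding W_def by (intro holomorphic_intros)
    show "continuous_on {z. 0 \<le> Im z} (\<lambda>z. W z - Complex c1 c2)"
      unfolding W_def by (intro continuous_intros log_transform_continuous \<Gamma>c)
    show "W (of_real x) - Complex c1 c2 = 0" if "p < x" "x < q" for x
      using c1[of x] c2[of x] that by (simp add: complex_eq_iff)
  qed
  then have "\<forall>z. Im z \<ge> 0 \<longrightarrow> W z = Complex c1 c2" by simp
  then show ?thesis unfolding W_def by blast
qed

lemma poly_sign_constant:
  fixes h :: "real poly"
  assumes "\<And>x. x \<in> {p..q} \<Longrightarrow> poly h x \<noteq> 0" "x \<in> {p..q}"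
  shows "sgn (poly h x) = sgn (poly h p)"
proof (rule ccontr)
  assume ne: "sgn (poly h x) \<noteq> sgn (poly h p)"
  then have "x \<noteq> p" by auto
  then have "p < x" using assms(2) by auto
  have "poly h x \<noteq> 0" "poly h p \<noteq> 0" using assms by auto
  then have "poly h p * poly h x < 0" using ne by (auto simp: sgn_if mult_less_0_iff split: if_splits)
  then obtain y where "p < y" "y < x" "poly h y = 0" using poly_IVT[OF \<open>p < x\<close>] by blast
  then show False using assms by auto
qed

lemma lborel_integral_compact_support:
  fixes g :: "real \<Rightarrow> real"
  assumes "continuous_on {p..q} g" "\<And>x. x \<notin> {p..q} \<Longrightarrow> g x = 0"
  shows "(\<integral> x. g x \<partial>lborel) = integral {p..q} g"
proof -
  have "(\<integral> x. g x \<partial>lborel) = (LINT x:{p..q}|lborel. g x)"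
    unfolding set_lebesgue_integral_def
    by (intro Bochner_Integration.integral_cong refl) (use assms(2) in \<open>auto simp: indicator_def\<close>)
  also have "\<dots> = integral {p..q} g"
    by (intro set_borel_integral_eq_integral(2) borel_integrable_atLeastAtMost' assms(1))
  finally show ?thesis .
qed

context two_cuts
begin

text \<open>If \<open>h\<close> had the same sign on both cuts, the two boundary matches would express
  \<open>2\<Phi> - V\<close> both as \<open>\<kappa>\<Gamma>\<close> and as \<open>-\<kappa>\<Gamma>\<close> up to constants, forcing the primitive \<open>\<Gamma>\<close> of \<open>h\<surd>R\<close> to be constant.\<close>
lemma cut_density_sign_change:
  fixes h V :: "real poly"
  assumes k: "k > 0" and h: "\<And>x. x \<in> {a..b} \<union> {c..d} \<Longrightarrow> poly h x \<noteq> 0"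
    and \<rho>: "\<And>x. \<rho> x = k * cut_weight a b c d x * \<bar>poly h x\<bar>"
    and EL: "\<And>x. x \<in> {a..b} \<union> {c..d} \<Longrightarrow> 2 * (\<integral> y. ln \<bar>x - y\<bar> * \<rho> y \<partial>lborel) - poly V x = lv"
  shows "sgn (poly h a) = - sgn (poly h c)"
proof (rule ccontr)
  assume ne: "sgn (poly h a) \<noteq> - sgn (poly h c)"
  have "poly h a \<noteq> 0" "poly h c \<noteq> 0" using h ab cd by auto
  then have eqs: "sgn (poly h c) = sgn (poly h a)" using ne by (auto simp: sgn_if split: if_splits)
  define s where "s = sgn (poly h a)"
  have s: "s \<noteq> 0" using \<open>poly h a \<noteq> 0\<close> by (simp add: s_def sgn_zero_iff)
  have absh: "\<bar>poly h x\<bar> = s * poly h x" if "x \<in> {a..b} \<union> {c..d}" for x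
  proof -
    have "sgn (poly h x) = s"
      using poly_sign_constant[of a b h x] poly_sign_constant[of c d h x] that h eqs by (auto simp: s_def)
    then show ?thesis by (metis abs_sgn mult.commute)
  qed
  have cont: "continuous_on UNIV \<rho>"
    unfolding \<rho>[abs_def] by (intro continuous_intros cut_weight_continuous)
  have zero: "\<rho> x = 0" if "x \<notin> {a..d}" for x
    using that ab bc cd cut_weight_eq_0[of x] by (auto simp: \<rho>)
  obtain M where M: "compact_density \<rho> a d M" using compact_density_ex[OF cont zero] by blast
  interpret compact_density \<rho> a d M by (rule M)
  define g where "g z = poly (map_poly of_real h) z * sqrt_quartic a b c d z" for z
  have gc: "continuous_on {z. Im z \<ge> 0} g"
    unfolding g_def by (intro continuous_intros sqrt_quartic_continuous)
  have gh: "g holomorphic_on {z. Im z > 0}"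
    unfolding g_def by (intro holomorphic_intros sqrt_quartic_holomorphic)
  obtain \<Gamma> where \<Gamma>: "\<And>z. Im z \<ge> 0 \<Longrightarrow> (\<Gamma> has_field_derivative g z) (at z within {z. Im z \<ge> 0})"
    "continuous_on {z. Im z \<ge> 0} \<Gamma>" "\<And>z. Im z > 0 \<Longrightarrow> (\<Gamma> has_field_derivative g z) (at z)"
    using uhp_primitive[OF gc gh] by blast
  have gl: "g (of_real x) = - \<i> * of_real (poly h x * cut_weight a b c d x)" if "a < x" "x < b" for x
    using that sqrt_quartic_left_cut[of x] by (simp add: g_def poly_map_poly_of_real)
  have gr: "g (of_real x) = \<i> * of_real (poly h x * cut_weight a b c d x)" if "c < x" "x < d" for x
    using that sqrt_quartic_right_cut[of x] by (simp add: g_def poly_map_poly_of_real)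
  define \<kappa> where "\<kappa> = 2 * pi * k * s"
  have "\<exists>C. \<forall>z. Im z \<ge> 0 \<longrightarrow>
    2 * log_transform \<rho> z - poly (map_poly of_real V) z - of_real \<kappa> * \<Gamma> z = C"
  proof (rule log_transform_boundary_match[OF \<Gamma> ab, where lv = lv])
    show "2 * (\<integral> y. ln \<bar>x - y\<bar> * \<rho> y \<partial>lborel) - poly V x = lv" if "a < x" "x < b" for x
      using that by (intro EL) auto
    show "Re (g (of_real x)) = 0" "\<kappa> * Im (g (of_real x)) = - 2 * pi * \<rho> x" if "a < x" "x < b" for x
      using that absh[of x] by (simp_all add: gl \<rho> \<kappa>_def)
  qed
  then obtain C1 where C1: "\<And>z. Im z \<ge> 0 \<Longrightarrow>
    2 * log_transform \<rho> z - poly (map_poly of_real V) z - of_real \<kappa> * \<Gamma> z = C1" by blast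
  have "\<exists>C. \<forall>z. Im z \<ge> 0 \<longrightarrow>
    2 * log_transform \<rho> z - poly (map_poly of_real V) z - of_real (- \<kappa>) * \<Gamma> z = C"
  proof (rule log_transform_boundary_match[OF \<Gamma> cd, where lv = lv])
    show "2 * (\<integral> y. ln \<bar>x - y\<bar> * \<rho> y \<partial>lborel) - poly V x = lv" if "c < x" "x < d" for x
      using that by (intro EL) auto
    show "Re (g (of_real x)) = 0" "- \<kappa> * Im (g (of_real x)) = - 2 * pi * \<rho> x" if "c < x" "x < d" for x
      using that absh[of x] by (simp_all add: gr \<rho> \<kappa>_def)
  qed
  then obtain C2 where C2: "\<And>z. Im z \<ge> 0 \<Longrightarrow>
    2 * log_transform \<rho> z - poly (map_poly of_real V) z - of_real (- \<kappa>) * \<Gamma> z = C2" by blast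
  have \<kappa>: "\<kappa> \<noteq> 0" using k s by (simp add: \<kappa>_def)
  have const: "\<Gamma> z = (C2 - C1) / (2 * of_real \<kappa>)" if "Im z \<ge> 0" for z
  proof -
    have "C2 - C1 = 2 * of_real \<kappa> * \<Gamma> z"
      unfolding C1[OF that, symmetric] C2[OF that, symmetric] by (simp add: algebra_simps)
    then show ?thesis using \<kappa> by simp
  qed
  have g0: "g z = 0" if z: "Im z > 0" for z
  proof -
    have "((\<lambda>_. (C2 - C1) / (2 * of_real \<kappa>)) has_field_derivative g z) (at z)"
      by (rule has_field_derivative_transform_within_open[OF \<Gamma>(3)[OF z] open_halfspace_Im_gt[of 0]])
         (use z const in auto)
    then show ?thesis using DERIV_unique DERIV_const by blast
  qed
  \<comment> \<open>At the midpoint of the left cut the weight is positive, while g vanishes there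
    by continuity from above; h would have a zero on the cut.\<close>
  define x where "x = (a + b) / 2"
  have x: "a < x" "x < b" using ab by (auto simp: x_def)
  have "closed {z. Im z \<ge> 0 \<and> g z = 0}"
    using continuous_closed_preimage_constant[OF gc closed_halfspace_Im_ge, of 0] by simp
  then have "of_real x \<in> {z. Im z \<ge> 0 \<and> g z = 0}"
    by (rule closed_superset_of_uhp) (simp_all add: g0)
  then have "poly h x * cut_weight a b c d x = 0" by (simp add: gl[OF x])
  then show False using h[of x] cut_weight_pos[of x] x by auto
qed

text \<open>The derivative of the effective potential E is 0 on the cuts, positive before a,
  negative after d, and (x - e) times a positive weight in the gap. So E falls and then rises across
  the gap, and the integral condition makes the net change 0, putting both cuts at the same
  level.\<close>

lemma raw_Euler_Lagrange:
  assumes e: "b < e" "e < c" and gap: "(\<integral> x. (x - e) * gap_weight a b c d x \<partial>lborel) = 0"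
  shows "\<exists>l. (\<forall>x\<in>{a..b} \<union> {c..d}.
      (\<integral> y. ln \<bar>x - y\<bar> * raw_density e y \<partial>lborel) - poly (drift_primitive a b c d e) x = l) \<and>
    (\<forall>x. x \<notin> {a..b} \<union> {c..d} \<longrightarrow>
      (\<integral> y. ln \<bar>x - y\<bar> * raw_density e y \<partial>lborel) - poly (drift_primitive a b c d e) x < l)"
proof -
  define E where "E x = (\<integral> y. ln \<bar>x - y\<bar> * raw_density e y \<partial>lborel) - poly (drift_primitive a b c d e) x" for x
  define E' where "E' x = - (x - e) * Re (sqrt_quartic a b c d (of_real x))" for x
  have der: "(E has_real_derivative E' x) (at x)" for x
    unfolding E_def E'_def by (rule potential_derivative[OF e])
  have contE: "continuous_on A E" for A
    using der by (intro DERIV_continuous_on[where D = E']) (auto intro: has_field_derivative_at_within)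
  have E'cut: "E' x = 0" if "x \<in> {a..b} \<union> {c..d}" for x
    using that sqrt_quartic_left_cut[of x] sqrt_quartic_right_cut[of x] by (auto simp: E'_def)
  have E'gap: "E' x = (x - e) * gap_weight a b c d x" if "b \<le> x" "x \<le> c" for x
    using sqrt_quartic_gap[OF that] unfolding E'_def by (simp add: algebra_simps)
  have gap_pos: "gap_weight a b c d x > 0" if "b < x" "x < c" for x
    using that quartic_pos[of x] gap_weight_eq[of x] by simp
  have E'out: "E' x = - (x - e) * sqrt (quartic a b c d x)" if "x \<le> a \<or> d \<le> x" for x
    using sqrt_quartic_outer[OF that] by (simp add: E'_def)
  have Ea: "E x = E a" if "x \<in> {a..b}" for x
  proof (cases "x = a")
    case False
    then have "a < x" using that by auto
    then show ?thesis
      by (rule DERIV_isconst_end[OF _ contE]) (use der E'cut that in \<open>metis UnI1 atLeastAtMost_iff less_imp_le order_trans\<close>)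
  qed simp
  have Ec: "E x = E c" if "x \<in> {c..d}" for x
  proof (cases "x = c")
    case False
    then have "c < x" using that by auto
    then show ?thesis
      by (rule DERIV_isconst_end[OF _ contE]) (use der E'cut that in \<open>metis UnI2 atLeastAtMost_iff less_imp_le order_trans\<close>)
  qed simp
  have "(E' has_integral (E c - E b)) {b..c}"
    using bc der by (intro fundamental_theorem_of_calculus)
      (auto simp: has_real_derivative_iff_has_vector_derivative[symmetric] intro: has_field_derivative_at_within)
  moreover have "integral {b..c} E' = integral {b..c} (\<lambda>x. (x - e) * gap_weight a b c d x)"
    by (intro integral_cong) (simp add: E'gap)
  moreover have "integral {b..c} (\<lambda>x. (x - e) * gap_weight a b c d x) = 0"
    unfolding gap[symmetric]
    by (rule lborel_integral_compact_support[symmetric])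
       (intro continuous_intros gap_weight_continuous, simp add: gap_weight_eq_0)
  ultimately have Ecb: "E c = E b" by (simp add: has_integral_iff)
  have Eb: "E b = E a" using Ea[of b] ab by simp
  have gap1: "E x < E b" if x: "b < x" "x \<le> e" for x
  proof (rule DERIV_neg_imp_decreasing_open[OF x(1)])
    show "\<exists>y. (E has_real_derivative y) (at t) \<and> y < 0" if "b < t" "t < x" for t
      using der[of t] E'gap[of t] gap_pos[of t] that x e
      by (intro exI[of _ "E' t"]) (simp add: mult_neg_pos)
  qed (rule contE)
  have gap2: "E x < E c" if x: "e \<le> x" "x < c" for x
  proof (rule DERIV_pos_imp_increasing_open[OF x(2)])
    show "\<exists>y. (E has_real_derivative y) (at t) \<and> y > 0" if "x < t" "t < c" for t
      using der[of t] E'gap[of t] gap_pos[of t] that x e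
      by (intro exI[of _ "E' t"]) simp
  qed (rule contE)
  have left: "E x < E a" if x: "x < a" for x
  proof (rule DERIV_pos_imp_increasing_open[OF x])
    show "\<exists>y. (E has_real_derivative y) (at t) \<and> y > 0" if "x < t" "t < a" for t
      using der[of t] E'out[of t] quartic_pos[of t] that x e ab bc
      by (intro exI[of _ "E' t"]) (simp add: mult_neg_pos)
  qed (rule contE)
  have right: "E x < E d" if x: "d < x" for x
  proof (rule DERIV_neg_imp_decreasing_open[OF x])
    show "\<exists>y. (E has_real_derivative y) (at t) \<and> y < 0" if "d < t" "t < x" for t
      using der[of t] E'out[of t] quartic_pos[of t] that x e cd bc
      by (intro exI[of _ "E' t"]) (simp add: mult_neg_pos)
  qed (rule contE)
  have Ed: "E d = E a" using Ec[of d] cd Ecb Eb by simp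
  show ?thesis unfolding E_def[symmetric]
  proof (intro exI[of _ "E a"] conjI ballI allI impI)
    show "E x = E a" if "x \<in> {a..b} \<union> {c..d}" for x
      using that Ea[of x] Ec[of x] Ecb Eb by auto
    show "E x < E a" if "x \<notin> {a..b} \<union> {c..d}" for x
    proof -
      have "x < a \<or> (b < x \<and> x < c) \<or> d < x" using that by auto
      then consider "x < a" | "b < x" "x \<le> e" | "e \<le> x" "x < c" | "d < x" by linarith
      then show ?thesis
        by cases (use left gap1 gap2 right Ecb Eb Ed in auto)
    qed
  qed
qed

end

section \<open>Two-cut data\<close>

definition cut_density :: "real \<Rightarrow> real \<Rightarrow> real \<Rightarrow> real \<Rightarrow> real poly \<Rightarrow> real \<Rightarrow> real" where
  "cut_density a b c d h x = cut_weight a b c d x * \<bar>poly h x\<bar>"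

definition cut_potential :: "real \<Rightarrow> real \<Rightarrow> real \<Rightarrow> real \<Rightarrow> real poly \<Rightarrow> real \<Rightarrow> real" where
  "cut_potential a b c d h x = (\<integral> y. ln \<bar>x - y\<bar> * cut_density a b c d h y \<partial>lborel)"

text \<open>The sign normalisation of \<open>h\<close> makes these data closed under convex combination for fixed endpoints.\<close>
definition two_cut_data :: "real \<Rightarrow> real \<Rightarrow> real \<Rightarrow> real \<Rightarrow> real poly \<Rightarrow> real poly \<Rightarrow> bool" where
  "two_cut_data a b c d h V \<longleftrightarrow> a < b \<and> b < c \<and> c < d \<and>
     (\<forall>x\<in>{a..b}. poly h x < 0) \<and> (\<forall>x\<in>{c..d}. poly h x > 0) \<and>
     (\<integral> x. cut_density a b c d h x \<partial>lborel) = 1 \<and>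
     (\<exists>l. (\<forall>x\<in>{a..b} \<union> {c..d}. 2 * cut_potential a b c d h x - poly V x = l) \<and>
          (\<forall>x. x \<notin> {a..b} \<union> {c..d} \<longrightarrow> 2 * cut_potential a b c d h x - poly V x < l))"

lemma cut_density_continuous: "continuous_on A (cut_density a b c d h)"
  unfolding cut_density_def by (intro continuous_intros cut_weight_continuous)

lemma cut_density_measurable [measurable]: "cut_density a b c d h \<in> borel_measurable borel"
  by (intro borel_measurable_continuous_onI cut_density_continuous)

lemma cut_density_nonneg: "cut_density a b c d h x \<ge> 0"
  by (simp add: cut_density_def cut_weight_nonneg)

lemma (in two_cuts) cut_density_zero: "x \<notin> {a..b} \<union> {c..d} \<Longrightarrow> cut_density a b c d h x = 0"
  by (simp add: cut_density_def cut_weight_eq_0)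

lemma (in two_cuts) cut_density_compact: "\<exists>M. compact_density (cut_density a b c d h) a d M"
  using ab bc cd by (intro compact_density_ex cut_density_continuous cut_density_zero) auto

lemma (in two_cuts) integrable_cut_density: "integrable lborel (cut_density a b c d h)"
proof -
  have "set_integrable lborel {a..d} (cut_density a b c d h)"
    by (intro borel_integrable_atLeastAtMost' cut_density_continuous)
  moreover have eq: "indicator {a..d} x *\<^sub>R cut_density a b c d h x = cut_density a b c d h x" for x
  proof (cases "x \<in> {a..d}")
    case False
    then have "x \<notin> {a..b} \<union> {c..d}" using ab bc cd by auto
    then show ?thesis by (simp add: cut_density_zero)
  qed simp
  ultimately show ?thesis unfolding set_integrable_def eq by blast
qed

lemma (in two_cuts) integrable_log_cut_density:
  "integrable lborel (\<lambda>y. ln \<bar>x - y\<bar> * cut_density a b c d h y)"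
proof -
  obtain M where "compact_density (cut_density a b c d h) a d M" using cut_density_compact by blast
  then interpret compact_density "cut_density a b c d h" a d M .
  show ?thesis by (rule integrable_log_times_bounded[OF _ bound zero]) simp_all
qed

lemma msupport_two_cuts:
  assumes "a < b" "b < c" "c < d" and h: "\<And>x. x \<in> {a..b} \<union> {c..d} \<Longrightarrow> poly h x \<noteq> 0"
  shows "msupport (density lborel (\<lambda>x. ennreal (cut_density a b c d h x))) = {a..b} \<union> {c..d}"
    (is "msupport ?\<mu> = ?S")
proof -
  interpret two_cuts a b c d using assms by unfold_locales
  have em: "emeasure ?\<mu> A = (\<integral>\<^sup>+ x. ennreal (cut_density a b c d h x) * indicator A x \<partial>lborel)"
    if "A \<in> sets borel" for A using that by (subst emeasure_density) auto
  have pos: "emeasure ?\<mu> {p<..<q} > 0" if "p < q" "{p<..<q} \<subseteq> {a<..<b} \<union> {c<..<d}" for p q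
  proof (rule ccontr)
    assume "\<not> emeasure ?\<mu> {p<..<q} > 0"
    then have "AE x in lborel. ennreal (cut_density a b c d h x) * indicator {p<..<q} x = 0"
      by (simp add: em nn_integral_0_iff_AE)
    then have "AE x in lborel. x \<notin> {p<..<q}"
    proof eventually_elim
      case (elim x)
      show ?case
      proof
        assume x: "x \<in> {p<..<q}"
        then have "x \<in> {a<..<b} \<union> {c<..<d}" using that(2) by blast
        then have "cut_weight a b c d x > 0" "poly h x \<noteq> 0" using cut_weight_pos[of x] h[of x] by auto
        then have "cut_density a b c d h x > 0" by (simp add: cut_density_def)
        then show False using elim x by simp
      qed
    qed
    then have "{p<..<q} \<in> null_sets lborel" by (subst AE_iff_null_sets) auto
    then have "emeasure lborel {p<..<q} = 0" by (rule null_setsD1)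
    then show False using \<open>p < q\<close> by simp
  qed
  \<comment> \<open>A ball around an endpoint of a cut still contains an open interval inside the
    cut, although the density vanishes at the endpoint itself.\<close>
  have inside: "emeasure ?\<mu> (ball x e) > 0" if "x \<in> {p..q}" "p < q" "{p<..<q} \<subseteq> {a<..<b} \<union> {c<..<d}" "e > 0" for x e p q
  proof -
    have sub: "{max p (x - e)<..<min q (x + e)} \<subseteq> ball x e" by (auto simp: dist_real_def)
    have "0 < emeasure ?\<mu> {max p (x - e)<..<min q (x + e)}"
      using that by (intro pos) auto
    also have "\<dots> \<le> emeasure ?\<mu> (ball x e)" by (intro emeasure_mono sub) simp
    finally show ?thesis .
  qed
  show ?thesis
  proof (intro equalityI subsetI)
    fix x assume x: "x \<in> msupport ?\<mu>"
    show "x \<in> ?S"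
    proof (rule ccontr)
      assume "x \<notin> ?S"
      moreover have "open (- ?S)" by (intro open_Compl closed_Un closed_atLeastAtMost)
      ultimately obtain e where e: "e > 0" "ball x e \<subseteq> - ?S" using openE[of "- ?S" x] by blast
      have "emeasure ?\<mu> (ball x e) = (\<integral>\<^sup>+ x. 0 \<partial>(lborel :: real measure))"
        unfolding em[OF borel_open[OF open_ball]]
      proof (intro nn_integral_cong)
        fix y
        show "ennreal (cut_density a b c d h y) * indicator (ball x e) y = 0"
        proof (cases "y \<in> ball x e")
          case True
          then have "y \<notin> ?S" using e(2) by blast
          then have "cut_density a b c d h y = 0" by (rule cut_density_zero)
          then show ?thesis by simp
        qed simp
      qed
      then show False using x e(1) by (auto simp: msupport_def)
    qed
  next
    fix x assume "x \<in> ?S"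
    then have "emeasure ?\<mu> (ball x e) > 0" if "e > 0" for e
      using inside[of x a b e] inside[of x c d e] that assms by auto
    then show "x \<in> msupport ?\<mu>" by (simp add: msupport_def)
  qed
qed

lemma integral_density_log:
  "(\<integral> y. ln \<bar>x - y\<bar> \<partial>density lborel (\<lambda>x. ennreal (cut_density a b c d h x))) = cut_potential a b c d h x"
  unfolding cut_potential_def
  by (subst integral_real_density) (auto simp: cut_density_nonneg mult.commute)

lemma two_cut_data_imp_in_P_cut:
  assumes data: "two_cut_data a b c d h V" and V: "in_P m V"
  shows "in_P_cut m 2 V"
proof -
  from data have ord: "a < b" "b < c" "c < d"
    and hneg: "\<And>x. x \<in> {a..b} \<Longrightarrow> poly h x < 0" and hpos: "\<And>x. x \<in> {c..d} \<Longrightarrow> poly h x > 0"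
    and mass: "(\<integral> x. cut_density a b c d h x \<partial>lborel) = 1"
    by (auto simp: two_cut_data_def)
  from data obtain l where eq: "\<And>x. x \<in> {a..b} \<union> {c..d} \<Longrightarrow> 2 * cut_potential a b c d h x - poly V x = l"
    and less: "\<And>x. x \<notin> {a..b} \<union> {c..d} \<Longrightarrow> 2 * cut_potential a b c d h x - poly V x < l"
    by (auto simp: two_cut_data_def)
  interpret two_cuts a b c d using ord by unfold_locales
  have h0: "poly h x \<noteq> 0" if "x \<in> {a..b} \<union> {c..d}" for x using hneg[of x] hpos[of x] that by auto
  obtain M where "compact_density (cut_density a b c d h) a d M" using cut_density_compact by blast
  then interpret compact_density "cut_density a b c d h" a d M .
  define \<mu> where "\<mu> = density lborel (\<lambda>x. ennreal (cut_density a b c d h x))"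
  have "is_equilibrium V \<mu>"
    unfolding \<mu>_def
  proof (rule Euler_Lagrange_imp_equilibrium[OF V _ cut_density_nonneg _ zero mass])
    show "cut_density a b c d h x \<le> M" for x using bound[of x] by simp
    show "2 * (\<integral> y. ln \<bar>x - y\<bar> * cut_density a b c d h y \<partial>lborel) - poly V x = l"
      if "cut_density a b c d h x \<noteq> 0" for x
      using eq[of x] cut_density_zero[of x h] that unfolding cut_potential_def by blast
    show "2 * (\<integral> y. ln \<bar>x - y\<bar> * cut_density a b c d h y \<partial>lborel) - poly V x \<le> l" for x
      using eq[of x] less[of x] unfolding cut_potential_def by (cases "x \<in> {a..b} \<union> {c..d}") auto
  qed simp
  then have \<mu>: "eq_measure V = \<mu>" by (rule eq_measure_unique[OF V])
  have S: "msupport \<mu> = {a..b} \<union> {c..d}" unfolding \<mu>_def by (rule msupport_two_cuts[OF ord h0])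
  define \<alpha> where "\<alpha> = (\<lambda>j::nat. if j = 0 then a else c)"
  define \<beta> where "\<beta> = (\<lambda>j::nat. if j = 0 then b else d)"
  have two: "{..<2::nat} = {0, 1}" by auto
  have prod: "(\<Prod>j<2. (x - \<alpha> j) * (x - \<beta> j)) = quartic a b c d x" for x
    by (simp add: two \<alpha>_def \<beta>_def quartic_def)
  have un: "(\<Union>j<2. {\<alpha> j..\<beta> j}) = {a..b} \<union> {c..d}" by (simp add: two \<alpha>_def \<beta>_def)
  have dens: "indicator ({a..b} \<union> {c..d}) x * (1 / 1) * sqrt \<bar>quartic a b c d x\<bar> * \<bar>poly h x\<bar> = cut_density a b c d h x" for x
  proof (cases "x \<in> {a..b} \<union> {c..d}")
    case True
    then have "quartic a b c d x \<le> 0" using quartic_nonpos[of x] by auto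
    then show ?thesis using True by (simp add: cut_density_def cut_weight_def)
  next
    case False
    then show ?thesis by (simp add: cut_density_zero)
  qed
  have pot: "(\<integral> y. ln \<bar>x - y\<bar> \<partial>\<mu>) = cut_potential a b c d h x" for x
    unfolding \<mu>_def by (rule integral_density_log)
  have "cut_regular 2 V"
    unfolding cut_regular_def Let_def \<mu> S
  proof (rule exI[of _ \<alpha>], rule exI[of _ \<beta>], intro conjI)
    show "\<forall>j<2. \<alpha> j < \<beta> j" using ord by (auto simp: \<alpha>_def \<beta>_def)
    show "\<forall>j. Suc j < 2 \<longrightarrow> \<beta> j < \<alpha> (Suc j)" using ord by (auto simp: \<alpha>_def \<beta>_def)
    show "{a..b} \<union> {c..d} = (\<Union>j<2. {\<alpha> j..\<beta> j})" by (simp add: un)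
    show "\<exists>k h. 0 < k \<and> (\<forall>x\<in>{a..b} \<union> {c..d}. poly h x \<noteq> 0) \<and>
       \<mu> = density lborel (\<lambda>x. ennreal (indicator ({a..b} \<union> {c..d}) x * (1 / k) *
          sqrt \<bar>\<Prod>j<2. (x - \<alpha> j) * (x - \<beta> j)\<bar> * \<bar>poly h x\<bar>))"
      unfolding prod
      by (intro exI[of _ "1::real"] exI[of _ h] conjI ballI h0) (simp_all only: dens \<mu>_def zero_less_one)
    show "\<exists>lv. (\<forall>x\<in>{a..b} \<union> {c..d}. 2 * (\<integral> y. ln \<bar>x - y\<bar> \<partial>\<mu>) - poly V x = lv) \<and>
       (\<forall>x. x \<notin> {a..b} \<union> {c..d} \<longrightarrow> 2 * (\<integral> y. ln \<bar>x - y\<bar> \<partial>\<mu>) - poly V x < lv)"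
      unfolding pot using eq less by blast
  qed
  then show ?thesis using V by (simp add: in_P_cut_def)
qed

text \<open>The hypothesis sees only |h|, so one overall sign is free; the relative sign between the
  two cuts is not, and it comes from \<open>cut_density_sign_change\<close>.\<close>

lemma in_P_cut_imp_two_cut_data:
  assumes "in_P_cut m 2 V"
  shows "\<exists>a b c d h. two_cut_data a b c d h V"
proof -
  have V: "in_P m V" and cr: "cut_regular 2 V" using assms by (auto simp: in_P_cut_def)
  define \<mu> where "\<mu> = eq_measure V"
  from cr[unfolded cut_regular_def Let_def, folded \<mu>_def] obtain \<alpha> \<beta> :: "nat \<Rightarrow> real" and k :: real and h lv where
    ord1: "\<forall>j<2. \<alpha> j < \<beta> j" and ord2: "\<forall>j. Suc j < 2 \<longrightarrow> \<beta> j < \<alpha> (Suc j)"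
    and S0: "msupport \<mu> = (\<Union>j<2. {\<alpha> j..\<beta> j})" and k: "k > 0"
    and h0: "\<forall>x\<in>msupport \<mu>. poly h x \<noteq> 0"
    and dens: "\<mu> = density lborel (\<lambda>x. ennreal (indicator (msupport \<mu>) x * (1 / k) *
                 sqrt \<bar>\<Prod>j<2. (x - \<alpha> j) * (x - \<beta> j)\<bar> * \<bar>poly h x\<bar>))"
    and eq: "\<forall>x\<in>msupport \<mu>. 2 * (\<integral>y. ln \<bar>x - y\<bar> \<partial>\<mu>) - poly V x = lv"
    and less: "\<forall>x. x \<notin> msupport \<mu> \<longrightarrow> 2 * (\<integral>y. ln \<bar>x - y\<bar> \<partial>\<mu>) - poly V x < lv"
    by - (elim exE conjE, blast)
  define a b c d where "a = \<alpha> 0" and "b = \<beta> 0" and "c = \<alpha> 1" and "d = \<beta> 1"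
  have two: "{..<2::nat} = {0, 1}" by auto
  have S: "msupport \<mu> = {a..b} \<union> {c..d}" unfolding S0 by (simp add: two a_def b_def c_def d_def)
  have ord: "a < b" "b < c" "c < d" using ord1 ord2 by (auto simp: a_def b_def c_def d_def)
  interpret two_cuts a b c d using ord by unfold_locales
  have prod: "(\<Prod>j<2. (x - \<alpha> j) * (x - \<beta> j)) = quartic a b c d x" for x
    by (simp add: two a_def b_def c_def d_def quartic_def)
  \<comment> \<open>Dividing by k absorbs the constant of the density, and the sign makes g negative
    on the left cut; it is then positive on the right one.\<close>
  define g where "g = smult (- sgn (poly h a) / k) h"
  have ha: "poly h a \<noteq> 0" "poly h c \<noteq> 0" using h0 ord by (auto simp: S)
  have absg: "\<bar>poly g x\<bar> = \<bar>poly h x\<bar> / k" for x using ha k by (simp add: g_def abs_mult abs_sgn_eq)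
  have dens': "indicator ({a..b} \<union> {c..d}) x * (1 / k) * sqrt \<bar>quartic a b c d x\<bar> * \<bar>poly h x\<bar> = cut_density a b c d g x" for x
  proof (cases "x \<in> {a..b} \<union> {c..d}")
    case True
    then have "quartic a b c d x \<le> 0" using quartic_nonpos[of x] by auto
    then show ?thesis using True by (simp add: cut_density_def cut_weight_def absg)
  next
    case False
    then show ?thesis by (simp add: cut_density_zero)
  qed
  have \<mu>: "\<mu> = density lborel (\<lambda>x. ennreal (cut_density a b c d g x))"
    using dens unfolding S prod dens' .
  have pot: "(\<integral> y. ln \<bar>x - y\<bar> \<partial>\<mu>) = cut_potential a b c d g x" for x
    unfolding \<mu> by (rule integral_density_log)
  have "borel_prob \<mu>" using is_equilibrium_eq_measure[OF V] by (simp add: is_equilibrium_def \<mu>_def)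
  then interpret prob_space \<mu> by (rule borel_probD)
  have "(\<integral>\<^sup>+ x. ennreal (cut_density a b c d g x) \<partial>lborel) = 1"
    using emeasure_space_1 by (simp add: \<mu> emeasure_density)
  then have mass: "(\<integral> x. cut_density a b c d g x \<partial>lborel) = 1"
    using integrable_cut_density[of g] by (simp add: nn_integral_eq_integral cut_density_nonneg)
  have sign: "sgn (poly h a) = - sgn (poly h c)"
  proof (rule cut_density_sign_change[where k = "1 / k" and V = V and lv = lv and \<rho> = "cut_density a b c d g"])
    show "cut_density a b c d g x = 1 / k * cut_weight a b c d x * \<bar>poly h x\<bar>" for x
      by (simp add: cut_density_def absg)
    show "2 * (\<integral> y. ln \<bar>x - y\<bar> * cut_density a b c d g y \<partial>lborel) - poly V x = lv" if "x \<in> {a..b} \<union> {c..d}" for x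
      using eq that unfolding S pot cut_potential_def by blast
  qed (use k h0 S in auto)
  have gneg: "poly g x < 0" if "x \<in> {a..b}" for x
  proof -
    have "sgn (poly h x) = sgn (poly h a)" using poly_sign_constant[of a b h x] h0 that by (auto simp: S)
    then have "sgn (poly h a) * poly h x = \<bar>poly h x\<bar>" by (metis abs_sgn mult.commute)
    moreover have "poly h x \<noteq> 0" using h0 that by (auto simp: S)
    moreover have "poly g x = - (sgn (poly h a) * poly h x) / k" by (simp add: g_def)
    ultimately show ?thesis using k by simp
  qed
  have gpos: "poly g x > 0" if "x \<in> {c..d}" for x
  proof -
    have "sgn (poly h x) = sgn (poly h c)" using poly_sign_constant[of c d h x] h0 that by (auto simp: S)
    then have "sgn (poly h c) * poly h x = \<bar>poly h x\<bar>" by (metis abs_sgn mult.commute)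
    moreover have "poly h x \<noteq> 0" using h0 that by (auto simp: S)
    moreover have "poly g x = (sgn (poly h c) * poly h x) / k" by (simp add: g_def sign)
    ultimately show ?thesis using k by simp
  qed
  have "two_cut_data a b c d g V"
    unfolding two_cut_data_def using ord gneg gpos mass eq less unfolding S pot by blast
  then show ?thesis by blast
qed

text \<open>On each cut the two factors have the same sign, so absolute values add without
  cancellation, and density, mass and potential are all affine in s. The case s = 0 is separated
  because strictness is drawn from the second datum, which then has weight 0.\<close>

lemma two_cut_data_convex:
  assumes 0: "two_cut_data a b c d h V" and 1: "two_cut_data a b c d g W" and s: "0 \<le> s" "s \<le> 1"
  shows "two_cut_data a b c d (smult (1 - s) h + smult s g) (smult (1 - s) V + smult s W)"
proof -
  have ord: "a < b" "b < c" "c < d" using 0 by (auto simp: two_cut_data_def)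
  interpret two_cuts a b c d using ord by unfold_locales
  define f where "f = smult (1 - s) h + smult s g"
  have hg: "x \<in> {a..b} \<Longrightarrow> poly h x < 0" "x \<in> {a..b} \<Longrightarrow> poly g x < 0"
    "x \<in> {c..d} \<Longrightarrow> poly h x > 0" "x \<in> {c..d} \<Longrightarrow> poly g x > 0" for x
    using 0 1 by (auto simp: two_cut_data_def)
  have fneg: "poly f x < 0" if "x \<in> {a..b}" for x
  proof (cases "s = 0")
    case False
    then have "s * poly g x < 0" using hg(2)[OF that] s by (intro mult_pos_neg) auto
    moreover have "(1 - s) * poly h x \<le> 0" using hg(1)[OF that] s by (intro mult_nonneg_nonpos) auto
    ultimately show ?thesis by (simp add: f_def)
  qed (use hg(1)[OF that] in \<open>simp add: f_def\<close>)
  have fpos: "poly f x > 0" if "x \<in> {c..d}" for x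
  proof (cases "s = 0")
    case False
    then have "s * poly g x > 0" using hg(4)[OF that] s by (intro mult_pos_pos) auto
    moreover have "(1 - s) * poly h x \<ge> 0" using hg(3)[OF that] s by (intro mult_nonneg_nonneg) auto
    ultimately show ?thesis by (simp add: f_def)
  qed (use hg(3)[OF that] in \<open>simp add: f_def\<close>)
  have dens: "cut_density a b c d f x = (1 - s) * cut_density a b c d h x + s * cut_density a b c d g x" for x
  proof (cases "x \<in> {a..b} \<union> {c..d}")
    case True
    then have eq: "\<bar>poly f x\<bar> = (1 - s) * \<bar>poly h x\<bar> + s * \<bar>poly g x\<bar>"
    proof
      assume x: "x \<in> {a..b}"
      show ?thesis using fneg[OF x] hg(1,2)[OF x] by (simp add: f_def)
    next
      assume x: "x \<in> {c..d}"
      show ?thesis using fpos[OF x] hg(3,4)[OF x] by (simp add: f_def)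
    qed
    show ?thesis unfolding cut_density_def eq by (simp add: algebra_simps)
  qed (simp add: cut_density_zero)
  have mass: "(\<integral> x. cut_density a b c d f x \<partial>lborel) = 1"
  proof -
    have "(\<integral> x. cut_density a b c d f x \<partial>lborel) =
        (1 - s) * (\<integral> x. cut_density a b c d h x \<partial>lborel) + s * (\<integral> x. cut_density a b c d g x \<partial>lborel)"
      unfolding dens by (simp add: integrable_cut_density)
    then show ?thesis using 0 1 by (simp add: two_cut_data_def)
  qed
  have pot: "cut_potential a b c d f x = (1 - s) * cut_potential a b c d h x + s * cut_potential a b c d g x" for x
  proof -
    have "cut_potential a b c d f x = (\<integral> y. (1 - s) * (ln \<bar>x - y\<bar> * cut_density a b c d h y) +
        s * (ln \<bar>x - y\<bar> * cut_density a b c d g y) \<partial>lborel)"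
      unfolding cut_potential_def dens by (simp add: algebra_simps)
    also have "\<dots> = (1 - s) * cut_potential a b c d h x + s * cut_potential a b c d g x"
      unfolding cut_potential_def
      by (subst Bochner_Integration.integral_add)
         (simp_all add: integrable_log_cut_density)
    finally show ?thesis .
  qed
  obtain l0 where l0: "\<And>x. x \<in> {a..b} \<union> {c..d} \<Longrightarrow> 2 * cut_potential a b c d h x - poly V x = l0"
     "\<And>x. x \<notin> {a..b} \<union> {c..d} \<Longrightarrow> 2 * cut_potential a b c d h x - poly V x < l0"
    using 0 unfolding two_cut_data_def by blast
  obtain l1 where l1: "\<And>x. x \<in> {a..b} \<union> {c..d} \<Longrightarrow> 2 * cut_potential a b c d g x - poly W x = l1"
     "\<And>x. x \<notin> {a..b} \<union> {c..d} \<Longrightarrow> 2 * cut_potential a b c d g x - poly W x < l1"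
    using 1 unfolding two_cut_data_def by blast
  have comb: "2 * cut_potential a b c d f x - poly (smult (1 - s) V + smult s W) x =
     (1 - s) * (2 * cut_potential a b c d h x - poly V x) + s * (2 * cut_potential a b c d g x - poly W x)" for x
    by (simp add: pot algebra_simps)
  have EL1: "2 * cut_potential a b c d f x - poly (smult (1 - s) V + smult s W) x = (1 - s) * l0 + s * l1"
    if "x \<in> {a..b} \<union> {c..d}" for x
    unfolding comb l0(1)[OF that] l1(1)[OF that] ..
  have EL2: "2 * cut_potential a b c d f x - poly (smult (1 - s) V + smult s W) x < (1 - s) * l0 + s * l1"
    if x: "x \<notin> {a..b} \<union> {c..d}" for x
  proof (cases "s = 0")
    case True
    then show ?thesis unfolding comb using l0(2)[OF x] by simp
  next
    case False
    then have "s * (2 * cut_potential a b c d g x - poly W x) < s * l1"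
      using s l1(2)[OF x] by (intro mult_strict_left_mono) auto
    moreover have "(1 - s) * (2 * cut_potential a b c d h x - poly V x) \<le> (1 - s) * l0"
      using s l0(2)[OF x] by (intro mult_left_mono) auto
    ultimately show ?thesis unfolding comb by linarith
  qed
  show ?thesis
    unfolding two_cut_data_def f_def[symmetric] using ord fneg fpos mass EL1 EL2 by blast
qed

text \<open>Positive leading coefficients cannot cancel, so for 0 < s < 1 the degree is the larger
  of two even degrees.\<close>

lemma in_P_convex:
  assumes V: "in_P m V" and W: "in_P m W" and s: "0 \<le> s" "s \<le> 1"
  shows "in_P m (smult (1 - s) V + smult s W)"
proof -
  consider "s = 0" | "s = 1" | "0 < s" "s < 1" using s by linarith
  then show ?thesis
  proof cases
    case 3
    define P Q where "P = smult (1 - s) V" and "Q = smult s W"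
    have deg: "degree P = degree V" "degree Q = degree W"
      and lc: "lead_coeff P > 0" "lead_coeff Q > 0"
      using 3 V W by (auto simp: P_def Q_def in_P_def)
    have "degree (P + Q) = max (degree P) (degree Q) \<and> lead_coeff (P + Q) > 0"
    proof (cases "degree P" "degree Q" rule: linorder_cases)
      case less
      then show ?thesis using lc by (simp add: degree_add_eq_right coeff_eq_0)
    next
      case greater
      then show ?thesis using lc by (simp add: degree_add_eq_left coeff_eq_0)
    next
      case equal
      then have pos: "coeff (P + Q) (degree P) > 0" using lc by simp
      then have "degree (P + Q) \<ge> degree P" by (intro le_degree) simp
      moreover have "degree (P + Q) \<le> degree P" using equal by (intro degree_add_le) auto
      ultimately show ?thesis using pos equal by simp
    qed
    then show ?thesis using V W deg
      by (auto simp: in_P_def max_def P_def[symmetric] Q_def[symmetric] poly_add)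
         (simp_all add: P_def Q_def)
  qed (use V W in simp_all)
qed

section \<open>The path\<close>

lemma lborel_integral_pos:
  fixes g :: "real \<Rightarrow> real"
  assumes "continuous_on {p..q} g" "\<And>x. x \<notin> {p..q} \<Longrightarrow> g x = 0"
    and "\<And>x. g x \<ge> 0" "p < x0" "x0 < q" "g x0 > 0"
  shows "(\<integral> x. g x \<partial>lborel) > 0"
proof -
  have "integral {p..q} g \<ge> 0" by (rule integral_nonneg[OF integrable_continuous_interval[OF assms(1)]]) (rule assms(3))
  moreover have "integral {p..q} g \<noteq> 0"
    using integral_eq_0_iff[OF assms(1)] assms(3-6) by force
  moreover have "(\<integral> x. g x \<partial>lborel) = integral {p..q} g"
    by (rule lborel_integral_compact_support[OF assms(1)]) (rule assms(2))
  ultimately show ?thesis by linarith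
qed

text \<open>Moving endpoints are handled with one fixed interval of integration, since the weights
  vanish continuously at and beyond the endpoints.\<close>

lemma continuous_on_lborel_integral_param:
  fixes f :: "real \<Rightarrow> real \<Rightarrow> real"
  assumes "continuous_on (T \<times> {-L..L}) (\<lambda>(t, x). f t x)"
    and "\<And>t x. t \<in> T \<Longrightarrow> x \<notin> {-L..L} \<Longrightarrow> f t x = 0"
  shows "continuous_on T (\<lambda>t. \<integral> x. f t x \<partial>lborel)"
proof -
  have "continuous_on T (\<lambda>t. integral {-L..L} (f t))"
    using integral_continuous_on_param[of T "-L" L f] assms(1) by simp
  moreover have "(\<integral> x. f t x \<partial>lborel) = integral {-L..L} (f t)" if "t \<in> T" for t
  proof (rule lborel_integral_compact_support)
    have "continuous_on {-L..L} ((\<lambda>(t, x). f t x) \<circ> (\<lambda>x. (t, x)))"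
      by (rule continuous_on_compose[OF _ continuous_on_subset[OF assms(1)]])
         (use that in \<open>auto intro!: continuous_intros\<close>)
    then show "continuous_on {-L..L} (f t)" by (simp add: comp_def)
  qed (rule assms(2)[OF that])
  ultimately show ?thesis by simp
qed

section \<open>The family of quartic potentials\<close>

definition gap_moment :: "nat \<Rightarrow> real \<Rightarrow> real \<Rightarrow> real \<Rightarrow> real \<Rightarrow> real" where
  "gap_moment n a b c d = (\<integral> x. x ^ n * gap_weight a b c d x \<partial>lborel)"

definition gap_center :: "real \<Rightarrow> real \<Rightarrow> real \<Rightarrow> real \<Rightarrow> real" where
  "gap_center a b c d = gap_moment 1 a b c d / gap_moment 0 a b c d"

definition raw_mass :: "real \<Rightarrow> real \<Rightarrow> real \<Rightarrow> real \<Rightarrow> real" where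
  "raw_mass a b c d = (\<integral> x. \<bar>x - gap_center a b c d\<bar> * cut_weight a b c d x / pi \<partial>lborel)"

definition quartic_potential :: "real \<Rightarrow> real \<Rightarrow> real \<Rightarrow> real \<Rightarrow> real poly" where
  "quartic_potential a b c d = smult (2 / raw_mass a b c d) (drift_primitive a b c d (gap_center a b c d))"

definition quartic_factor :: "real \<Rightarrow> real \<Rightarrow> real \<Rightarrow> real \<Rightarrow> real poly" where
  "quartic_factor a b c d = smult (1 / (pi * raw_mass a b c d)) [:- gap_center a b c d, 1:]"

context two_cuts
begin

lemma gap_pos: "b < x \<Longrightarrow> x < c \<Longrightarrow> gap_weight a b c d x > 0"
  using quartic_pos[of x] gap_weight_eq[of x] by simp

lemma gap_weight_nonneg: "gap_weight a b c d x \<ge> 0"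
  by (simp add: gap_weight_def)

lemma gap_integrable:
  assumes "continuous_on {b..c} f"
  shows "integrable lborel (\<lambda>x. f x * gap_weight a b c d x)"
proof -
  have "set_integrable lborel {b..c} (\<lambda>x. f x * gap_weight a b c d x)"
    by (intro borel_integrable_atLeastAtMost' continuous_on_mult gap_weight_continuous assms)
  moreover have eq: "indicator {b..c} x *\<^sub>R (f x * gap_weight a b c d x) = f x * gap_weight a b c d x" for x
    using gap_weight_eq_0[of x] by (cases "x \<in> {b..c}") auto
  ultimately show ?thesis unfolding set_integrable_def eq by blast
qed

lemma gap_moment_0_pos: "gap_moment 0 a b c d > 0"
  unfolding gap_moment_def using bc gap_pos[of "(b + c) / 2"]
  by (intro lborel_integral_pos[of b c _ "(b + c) / 2"])
     (auto intro!: continuous_intros gap_weight_continuous simp: gap_weight_eq_0 gap_weight_nonneg)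

lemma gap_integral_linear:
  "(\<integral> x. (x - e) * gap_weight a b c d x \<partial>lborel) = gap_moment 1 a b c d - e * gap_moment 0 a b c d"
proof -
  have "(\<integral> x. (x - e) * gap_weight a b c d x \<partial>lborel) =
      (\<integral> x. x ^ 1 * gap_weight a b c d x - e * (x ^ 0 * gap_weight a b c d x) \<partial>lborel)"
    by (simp add: algebra_simps)
  also have "\<dots> = gap_moment 1 a b c d - e * gap_moment 0 a b c d"
    unfolding gap_moment_def
    by (subst Bochner_Integration.integral_diff)
       (auto intro!: gap_integrable integrable_mult_right continuous_intros simp del: power_0 power_one_right)
  finally show ?thesis .
qed

lemma gap_center_integral: "(\<integral> x. (x - gap_center a b c d) * gap_weight a b c d x \<partial>lborel) = 0"
  unfolding gap_integral_linear gap_center_def using gap_moment_0_pos by simp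

text \<open>Both x - b and c - x have positive integrals against the gap weight; divided by its
  total mass these are the two inequalities.\<close>

lemma gap_center_in_gap: "b < gap_center a b c d" "gap_center a b c d < c"
proof -
  define m where "m = (b + c) / 2"
  have m: "b < m" "m < c" using bc by (auto simp: m_def)
  have 1: "(\<integral> x. (x - b) * gap_weight a b c d x \<partial>lborel) > 0"
  proof (rule lborel_integral_pos[of b c _ m])
    show "0 \<le> (x - b) * gap_weight a b c d x" for x
      using gap_weight_eq_0[of x] gap_weight_nonneg[of x] by (cases "x \<in> {b..c}") auto
  qed (use m gap_pos in \<open>auto intro!: continuous_intros gap_weight_continuous simp: gap_weight_eq_0\<close>)
  have 2: "(\<integral> x. (c - x) * gap_weight a b c d x \<partial>lborel) > 0"
  proof (rule lborel_integral_pos[of b c _ m])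
    show "0 \<le> (c - x) * gap_weight a b c d x" for x
      using gap_weight_eq_0[of x] gap_weight_nonneg[of x] by (cases "x \<in> {b..c}") auto
  qed (use m gap_pos in \<open>auto intro!: continuous_intros gap_weight_continuous simp: gap_weight_eq_0\<close>)
  have "(\<integral> x. (c - x) * gap_weight a b c d x \<partial>lborel) = - (\<integral> x. (x - c) * gap_weight a b c d x \<partial>lborel)"
    by (subst Bochner_Integration.integral_minus[symmetric]) (simp add: algebra_simps)
  then have "b * gap_moment 0 a b c d < gap_moment 1 a b c d" "gap_moment 1 a b c d < c * gap_moment 0 a b c d"
    using 1 2 by (simp_all add: gap_integral_linear)
  then show "b < gap_center a b c d" "gap_center a b c d < c"
    using gap_moment_0_pos by (simp_all add: gap_center_def field_simps)
qed

lemma raw_mass_eq: "raw_mass a b c d = (\<integral> x. raw_density (gap_center a b c d) x \<partial>lborel)"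
  by (simp add: raw_mass_def raw_density_def)

lemma raw_mass_pos: "raw_mass a b c d > 0"
  unfolding raw_mass_eq
proof (rule lborel_integral_pos[of a d _ "(a + b) / 2"])
  show "raw_density (gap_center a b c d) x \<ge> 0" for x
    by (simp add: raw_density_def cut_weight_nonneg)
  have "cut_weight a b c d ((a + b) / 2) > 0" using ab by (intro cut_weight_pos) auto
  moreover have "(a + b) / 2 \<noteq> gap_center a b c d" using gap_center_in_gap ab by auto
  ultimately show "raw_density (gap_center a b c d) ((a + b) / 2) > 0" by (simp add: raw_density_def)
qed (use ab bc cd raw_density_zero in \<open>auto intro!: raw_density_continuous\<close>)

text \<open>The centre is exactly the e for which the gap condition of
  \<open>raw_Euler_Lagrange\<close> holds, and it lies in the gap, so the linear factor has the
  required signs. Dividing by the raw mass normalises the measure and rescales the potential; the 2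
  matches the factor in front of the logarithmic potential.\<close>

lemma two_cut_data_quartic:
  "two_cut_data a b c d (quartic_factor a b c d) (quartic_potential a b c d)"
proof -
  define e where "e = gap_center a b c d"
  define r where "r = raw_mass a b c d"
  have e: "b < e" "e < c" using gap_center_in_gap by (auto simp: e_def)
  have r: "r > 0" using raw_mass_pos by (simp add: r_def)
  have fac: "poly (quartic_factor a b c d) x = (x - e) / (pi * r)" for x
    by (simp add: quartic_factor_def e_def r_def diff_divide_distrib)
  have dens: "cut_density a b c d (quartic_factor a b c d) x = raw_density e x / r" for x
    using r by (simp add: cut_density_def raw_density_def fac abs_mult)
  have pot: "cut_potential a b c d (quartic_factor a b c d) x = (\<integral> y. ln \<bar>x - y\<bar> * raw_density e y \<partial>lborel) / r" for x
    unfolding cut_potential_def dens by simp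
  obtain l where l: "\<And>x. x \<in> {a..b} \<union> {c..d} \<Longrightarrow>
      (\<integral> y. ln \<bar>x - y\<bar> * raw_density e y \<partial>lborel) - poly (drift_primitive a b c d e) x = l"
    "\<And>x. x \<notin> {a..b} \<union> {c..d} \<Longrightarrow>
      (\<integral> y. ln \<bar>x - y\<bar> * raw_density e y \<partial>lborel) - poly (drift_primitive a b c d e) x < l"
    using raw_Euler_Lagrange[OF e gap_center_integral[folded e_def]] by blast
  have EL: "2 * cut_potential a b c d (quartic_factor a b c d) x - poly (quartic_potential a b c d) x =
      2 / r * ((\<integral> y. ln \<bar>x - y\<bar> * raw_density e y \<partial>lborel) - poly (drift_primitive a b c d e) x)" for x
    unfolding pot quartic_potential_def e_def[symmetric] r_def[symmetric] by (simp add: algebra_simps)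
  show ?thesis
    unfolding two_cut_data_def
  proof (intro conjI ballI exI[of _ "2 / r * l"] allI impI)
    show "a < b" "b < c" "c < d" by (fact ab bc cd)+
    show "poly (quartic_factor a b c d) x < 0" if "x \<in> {a..b}" for x
      using that e r by (simp add: fac divide_neg_pos)
    show "poly (quartic_factor a b c d) x > 0" if "x \<in> {c..d}" for x
      using that e r by (simp add: fac)
    show "(\<integral> x. cut_density a b c d (quartic_factor a b c d) x \<partial>lborel) = 1"
      unfolding dens using r by (simp add: raw_mass_eq[symmetric] r_def e_def)
    show "2 * cut_potential a b c d (quartic_factor a b c d) x - poly (quartic_potential a b c d) x = 2 / r * l"
      if "x \<in> {a..b} \<union> {c..d}" for x
      unfolding EL l(1)[OF that] ..
    show "2 * cut_potential a b c d (quartic_factor a b c d) x - poly (quartic_potential a b c d) x < 2 / r * l"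
      if "x \<notin> {a..b} \<union> {c..d}" for x
      unfolding EL using r l(2)[OF that] by (intro mult_strict_left_mono) auto
  qed
qed

lemma in_P_quartic_potential:
  assumes "m \<ge> 4"
  shows "in_P m (quartic_potential a b c d)"
proof -
  have "degree (quartic_potential a b c d) = 4" "coeff (quartic_potential a b c d) 4 > 0"
    "poly (quartic_potential a b c d) 0 = 0"
    using raw_mass_pos by (simp_all add: quartic_potential_def drift_primitive_def eval_nat_numeral)
  then show ?thesis using assms by (simp add: in_P_def)
qed

end

text \<open>In u = x^2 - 2 the quartic is u^2 - 1, so the cuts are |u| <= 1. Each cut contributes
  half the integral of sqrt(1 - u^2) over [-1, 1], that is pi/4; the raw mass is 1/2 and the
  potential is 4(x^4/4 - x^2).\<close>

lemma quartic_potential_symmetric: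
  "quartic_potential (- sqrt 3) (- 1) 1 (sqrt 3) = [:0, 0, -4, 0, 1:]"
proof -
  have s3: "1 < sqrt (3 :: real)" "sqrt 3 * sqrt 3 = (3::real)" by simp_all
  interpret two_cuts "- sqrt 3" "-1" 1 "sqrt 3" using s3 by unfold_locales auto
  let ?w = "cut_weight (- sqrt 3) (- 1) 1 (sqrt 3)"
  have quart: "quartic (- sqrt 3) (- 1) 1 (sqrt 3) x = (x\<^sup>2 - 2)\<^sup>2 - 1" for x
  proof -
    have "quartic (- sqrt 3) (- 1) 1 (sqrt 3) x = (x * x - sqrt 3 * sqrt 3) * (x * x - 1)"
      by (simp add: quartic_def algebra_simps del: real_sqrt_mult_self)
    then show ?thesis by (simp add: power2_eq_square algebra_simps)
  qed
  \<comment> \<open>The gap weight is even here, so its first moment vanishes and the centre is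
    0.\<close>
  have "gap_moment 1 (- sqrt 3) (- 1) 1 (sqrt 3) = - gap_moment 1 (- sqrt 3) (- 1) 1 (sqrt 3)"
  proof -
    have even: "gap_weight (- sqrt 3) (- 1) 1 (sqrt 3) (- x) = gap_weight (- sqrt 3) (- 1) 1 (sqrt 3) x" for x
      by (simp add: gap_weight_def algebra_simps)
    have "gap_moment 1 (- sqrt 3) (- 1) 1 (sqrt 3) =
       (\<integral> x. (0 + (-1) * x) ^ 1 * gap_weight (- sqrt 3) (- 1) 1 (sqrt 3) (0 + (-1) * x) \<partial>lborel)"
      unfolding gap_moment_def by (subst lborel_integral_real_affine[where c = "-1" and t = 0]) auto
    then show ?thesis by (simp add: even gap_moment_def)
  qed
  then have center: "gap_center (- sqrt 3) (- 1) 1 (sqrt 3) = 0" by (simp add: gap_center_def)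
  \<comment> \<open>Half of the primitive (u sqrt(1 - u^2) + arcsin u)/2 of sqrt(1 - u^2) at u = x^2
    - 2, as du = 2x dx.\<close>
  define F where "F x = ((x\<^sup>2 - 2) * sqrt (1 - (x\<^sup>2 - 2)\<^sup>2) + arcsin (x\<^sup>2 - 2)) / 4" for x :: real
  have Fder: "(F has_real_derivative x * sqrt (1 - (x\<^sup>2 - 2)\<^sup>2)) (at x)" if x: "\<bar>x\<^sup>2 - 2\<bar> < 1" for x
  proof -
    define u where "u = x\<^sup>2 - 2"
    have u: "- 1 < u" "u < 1" "u\<^sup>2 < 1" using x by (auto simp: u_def abs_less_iff abs_square_less_1)
    define s where "s = sqrt (1 - u\<^sup>2)"
    have s: "s > 0" "s * s = 1 - u\<^sup>2" using u by (simp_all add: s_def)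
    have "((\<lambda>u. (u * sqrt (1 - u\<^sup>2) + arcsin u) / 4) has_real_derivative
       ((1 * s + (- (2 * u) * (inverse s / 2)) * u) + inverse s) / 4) (at u)"
      unfolding s_def using u by (auto intro!: derivative_eq_intros simp: power2_eq_square)
    moreover have "((1 * s + (- (2 * u) * (inverse s / 2)) * u) + inverse s) / 4 = s / 2"
      using s by (simp add: field_simps power2_eq_square)
    ultimately have "((\<lambda>u. (u * sqrt (1 - u\<^sup>2) + arcsin u) / 4) has_real_derivative s / 2) (at u)"
      by (simp only:)
    moreover have "((\<lambda>x. x\<^sup>2 - 2) has_real_derivative 2 * x) (at x)"
      by (auto intro!: derivative_eq_intros)
    ultimately have "((\<lambda>x. ((x\<^sup>2 - 2) * sqrt (1 - (x\<^sup>2 - 2)\<^sup>2) + arcsin (x\<^sup>2 - 2)) / 4) has_real_derivative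
        s / 2 * (2 * x)) (at x)"
      unfolding u_def by (rule DERIV_chain2)
    then show ?thesis by (simp add: F_def[abs_def] s_def u_def mult.commute)
  qed
  have sq_le: "\<bar>x\<^sup>2 - 2\<bar> \<le> 1" if "1 \<le> \<bar>x\<bar>" "\<bar>x\<bar> \<le> sqrt 3" for x :: real
  proof -
    have "1 \<le> x\<^sup>2" using that(1) by (metis abs_le_square_iff abs_one one_power2)
    moreover have "x\<^sup>2 \<le> 3" using that(2) by (metis real_le_rsqrt real_sqrt_abs real_sqrt_le_iff)
    ultimately show ?thesis by simp
  qed
  have sq_less: "\<bar>x\<^sup>2 - 2\<bar> < 1" if "1 < \<bar>x\<bar>" "\<bar>x\<bar> < sqrt 3" for x :: real
  proof -
    have "1 < x\<^sup>2" using that(1) by (metis abs_square_less_1 abs_square_le_1 linorder_not_le)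
    moreover have "x\<^sup>2 < 3" using that(2) by (metis real_sqrt_abs real_sqrt_less_iff)
    ultimately show ?thesis by simp
  qed
  have w: "?w x = sqrt (1 - (x\<^sup>2 - 2)\<^sup>2)" if "1 \<le> \<bar>x\<bar>" "\<bar>x\<bar> \<le> sqrt 3" for x
    using sq_le[OF that] by (simp add: cut_weight_def quart max_def abs_square_le_1)
  have Fc: "continuous_on A F" if "\<And>x. x \<in> A \<Longrightarrow> 1 \<le> \<bar>x\<bar> \<and> \<bar>x\<bar> \<le> sqrt 3" for A
    unfolding F_def using sq_le that
    by (intro continuous_intros) (force simp: abs_le_iff)+
  have F1: "F 1 = - pi / 8" "F (-1) = - pi / 8" "F (sqrt 3) = pi / 8" "F (- sqrt 3) = pi / 8"
    by (simp_all add: F_def)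
  have right: "((\<lambda>x. \<bar>x\<bar> * ?w x) has_integral pi / 4) {1..sqrt 3}"
  proof -
    have "((\<lambda>x. x * sqrt (1 - (x\<^sup>2 - 2)\<^sup>2)) has_integral (F (sqrt 3) - F 1)) {1..sqrt 3}"
      using s3(1) Fder sq_less
      by (intro fundamental_theorem_of_calculus_interior Fc)
         (auto simp: has_real_derivative_iff_has_vector_derivative[symmetric])
    then have "((\<lambda>x. \<bar>x\<bar> * ?w x) has_integral (F (sqrt 3) - F 1)) {1..sqrt 3}"
      by (rule has_integral_eq[rotated]) (simp add: w)
    then show ?thesis by (simp add: F1)
  qed
  have left: "((\<lambda>x. \<bar>x\<bar> * ?w x) has_integral pi / 4) {- sqrt 3..-1}"
  proof -
    have "((\<lambda>x. x * sqrt (1 - (x\<^sup>2 - 2)\<^sup>2)) has_integral (F (-1) - F (- sqrt 3))) {- sqrt 3..-1}"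
      using s3(1) Fder sq_less
      by (intro fundamental_theorem_of_calculus_interior Fc)
         (auto simp: has_real_derivative_iff_has_vector_derivative[symmetric])
    from has_integral_neg[OF this]
    have "((\<lambda>x. \<bar>x\<bar> * ?w x) has_integral - (F (-1) - F (- sqrt 3))) {- sqrt 3..-1}"
      by (rule has_integral_eq[rotated]) (simp add: w)
    then show ?thesis by (simp add: F1)
  qed
  have mid: "((\<lambda>x. \<bar>x\<bar> * ?w x) has_integral 0) {-1..1}"
  proof (rule has_integral_is_0)
    show "\<bar>x\<bar> * ?w x = 0" if "x \<in> {-1..1}" for x
      using quartic_nonneg[of x] that by (simp add: cut_weight_def)
  qed
  have "((\<lambda>x. \<bar>x\<bar> * ?w x) has_integral (pi / 4 + 0) + pi / 4) {- sqrt 3..sqrt 3}"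
    by (rule has_integral_combine[OF _ _ has_integral_combine[OF _ _ left mid] right]) (use s3(1) in linarith)+
  then have "integral {- sqrt 3..sqrt 3} (\<lambda>x. \<bar>x\<bar> * ?w x) = pi / 2" by (simp add: integral_unique)
  moreover have "(\<integral> x. \<bar>x\<bar> * ?w x \<partial>lborel) = integral {- sqrt 3..sqrt 3} (\<lambda>x. \<bar>x\<bar> * ?w x)"
  proof (rule lborel_integral_compact_support)
    show "\<bar>x\<bar> * ?w x = 0" if "x \<notin> {- sqrt 3..sqrt 3}" for x
      using cut_weight_eq_0[of x] that s3(1) by auto
  qed (intro continuous_intros cut_weight_continuous)
  ultimately have mass: "raw_mass (- sqrt 3) (- 1) 1 (sqrt 3) = 1 / 2"
    by (simp add: raw_mass_def center)
  have "root_lin (- sqrt 3) (- 1) 1 (sqrt 3) = 0" by (simp add: root_lin_def)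
  moreover from this have "root_const (- sqrt 3) (- 1) 1 (sqrt 3) = - 2"
    by (simp add: root_const_def)
  ultimately have "drift_primitive (- sqrt 3) (- 1) 1 (sqrt 3) 0 = [:0, 0, -1, 0, 1/4:]"
    by (simp add: drift_primitive_def rem_lin_def)
  then show ?thesis by (simp add: quartic_potential_def center mass)
qed

lemma continuous_on_coeff_pCons:
  fixes f :: "real \<Rightarrow> real"
  assumes "continuous_on T f" "\<And>i. continuous_on T (\<lambda>t. coeff (P t) i)"
  shows "continuous_on T (\<lambda>t. coeff (pCons (f t) (P t)) j)"
  by (cases j) (simp_all add: assms)

text \<open>The only divisions are by the zeroth gap moment and by the raw mass, both positive as
  long as the endpoints stay ordered.\<close>

lemma quartic_potential_coeff_continuous:
  fixes a b c d :: "real \<Rightarrow> real"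
  assumes cont: "continuous_on T a" "continuous_on T b" "continuous_on T c" "continuous_on T d"
    and ord: "\<And>t. t \<in> T \<Longrightarrow> a t < b t" "\<And>t. t \<in> T \<Longrightarrow> b t < c t" "\<And>t. t \<in> T \<Longrightarrow> c t < d t"
    and bnd: "\<And>t. t \<in> T \<Longrightarrow> - L \<le> a t" "\<And>t. t \<in> T \<Longrightarrow> d t \<le> L"
  shows "continuous_on T (\<lambda>t. coeff (quartic_potential (a t) (b t) (c t) (d t)) j)"
proof -
  have tc: "two_cuts (a t) (b t) (c t) (d t)" if "t \<in> T" for t
    using ord that by unfold_locales
  have fst_cont: "continuous_on (T \<times> S) (\<lambda>p. f (fst p))" if "continuous_on T f" for f :: "real \<Rightarrow> real" and S :: "real set"
    by (rule continuous_on_compose2[OF that continuous_on_fst[OF continuous_on_id]]) auto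
  note fc = fst_cont[OF cont(1)] fst_cont[OF cont(2)] fst_cont[OF cont(3)] fst_cont[OF cont(4)]
  have moment: "continuous_on T (\<lambda>t. gap_moment n (a t) (b t) (c t) (d t))" for n
    unfolding gap_moment_def
  proof (rule continuous_on_lborel_integral_param[where L = L])
    show "continuous_on (T \<times> {-L..L}) (\<lambda>(t, x). x ^ n * gap_weight (a t) (b t) (c t) (d t) x)"
      unfolding split_beta' gap_weight_def by (intro continuous_intros fc)
    show "x ^ n * gap_weight (a t) (b t) (c t) (d t) x = 0" if "t \<in> T" "x \<notin> {-L..L}" for t x
    proof -
      have "x \<notin> {b t..c t}" using that ord[OF that(1)] bnd[OF that(1)] by auto
      then show ?thesis by (simp add: two_cuts.gap_weight_eq_0[OF tc[OF that(1)]])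
    qed
  qed
  have m0: "gap_moment 0 (a t) (b t) (c t) (d t) \<noteq> 0" if "t \<in> T" for t
    using two_cuts.gap_moment_0_pos[OF tc[OF that]] by simp
  have center: "continuous_on T (\<lambda>t. gap_center (a t) (b t) (c t) (d t))"
    unfolding gap_center_def using m0 by (intro continuous_intros moment) auto
  have mass: "continuous_on T (\<lambda>t. raw_mass (a t) (b t) (c t) (d t))"
    unfolding raw_mass_def
  proof (rule continuous_on_lborel_integral_param[where L = L])
    show "continuous_on (T \<times> {-L..L}) (\<lambda>(t, x). \<bar>x - gap_center (a t) (b t) (c t) (d t)\<bar> * cut_weight (a t) (b t) (c t) (d t) x / pi)"
      unfolding split_beta' cut_weight_def quartic_def
      by (intro continuous_intros fc fst_cont[OF center]) auto
    show "\<bar>x - gap_center (a t) (b t) (c t) (d t)\<bar> * cut_weight (a t) (b t) (c t) (d t) x / pi = 0"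
      if "t \<in> T" "x \<notin> {-L..L}" for t x
    proof -
      have "x \<notin> {a t..b t} \<union> {c t..d t}" using that ord[OF that(1)] bnd[OF that(1)] by auto
      then have "cut_weight (a t) (b t) (c t) (d t) x = 0" by (rule two_cuts.cut_weight_eq_0[OF tc[OF that(1)]])
      then show ?thesis by simp
    qed
  qed
  have r0: "raw_mass (a t) (b t) (c t) (d t) \<noteq> 0" if "t \<in> T" for t
    using two_cuts.raw_mass_pos[OF tc[OF that]] by simp
  have lin: "continuous_on T (\<lambda>t. root_lin (a t) (b t) (c t) (d t))"
    unfolding root_lin_def by (intro continuous_intros cont) auto
  have const: "continuous_on T (\<lambda>t. root_const (a t) (b t) (c t) (d t))"
    unfolding root_const_def by (intro continuous_intros cont lin) auto
  have rem: "continuous_on T (\<lambda>t. rem_lin (a t) (b t) (c t) (d t))"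
    unfolding rem_lin_def by (intro continuous_intros cont lin const) auto
  have "continuous_on T (\<lambda>t. coeff (drift_primitive (a t) (b t) (c t) (d t) (gap_center (a t) (b t) (c t) (d t))) j)"
    unfolding drift_primitive_def
    by (intro continuous_on_coeff_pCons continuous_intros lin const rem center) auto
  then show ?thesis
    unfolding quartic_potential_def coeff_smult using r0 by (intro continuous_intros mass) auto
qed

text \<open>The bound on m places the coefficients of x^4 - 4x^2 among the free ones, so subtracting
  them reaches every polynomial of degree at most m without constant term.\<close>

lemma V_t_coeffs:
  assumes m: "m \<ge> 4" and W: "degree W \<le> m" "poly W 0 = 0"
  shows "V_t m (\<lambda>j. coeff W j - coeff [:0, 0, -4, 0, 1:] j) = W"
proof (rule poly_eqI)
  fix n
  have "coeff (V_t m (\<lambda>j. coeff W j - coeff [:0, 0, -4, 0, 1:] j)) n =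
     coeff [:0, 0, -4, 0, 1:] n + (\<Sum>j\<in>{1..m}. if j = n then coeff W j - coeff [:0, 0, -4, 0, 1:] j else 0)"
    unfolding V_t_def by (simp add: coeff_sum)
  also have "\<dots> = coeff [:0, 0, -4, 0, 1:] n + (if n \<in> {1..m} then coeff W n - coeff [:0, 0, -4, 0, 1:] n else 0)"
    by (subst sum.delta) auto
  also have "\<dots> = coeff W n"
  proof -
    consider "n = 0" | "n \<in> {1..m}" | "n > m" by fastforce
    then show ?thesis
    proof cases
      case 1
      then show ?thesis using W(2) by (simp add: poly_0_coeff_0)
    next
      case 3
      then have "coeff W n = 0" "coeff [:0, 0, -4, 0, 1 :: real:] n = 0"
        using W(1) m by (auto intro!: coeff_eq_0)
      then show ?thesis using 3 by simp
    qed simp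
  qed
  finally show "coeff (V_t m (\<lambda>j. coeff W j - coeff [:0, 0, -4, 0, 1:] j)) n = coeff W n" .
qed

theorem theorem2p4:
  fixes m :: nat and t :: "nat \<Rightarrow> real"
  assumes "m \<ge> 4"
    and "in_P_cut m 2 (V_t m t)"
  shows "\<exists>p :: real \<Rightarrow> nat \<Rightarrow> real.
           (\<forall>j\<in>{1..m}. continuous_on {0..1} (\<lambda>\<tau>. p \<tau> j)) \<and>
           (\<forall>j\<in>{1..m}. p 0 j = 0 \<and> p 1 j = t j) \<and>
           (\<forall>\<tau>\<in>{0..1}. in_P_cut m 2 (V_t m (p \<tau>)))"
proof -
  define V where "V = V_t m t"
  have V: "in_P m V" using assms(2) by (simp add: in_P_cut_def V_def)
  obtain a b c d h where data: "two_cut_data a b c d h V"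
    using in_P_cut_imp_two_cut_data[OF assms(2)] unfolding V_def by blast
  then have ord: "a < b" "b < c" "c < d" by (auto simp: two_cut_data_def)
  \<comment> \<open>Strict order of the endpoints is preserved by convex combination, so the
    interpolated cuts never touch or degenerate.\<close>
  define A where "A \<tau> = (1 - \<tau>) * (- sqrt 3) + \<tau> * a" for \<tau>
  define B where "B \<tau> = (1 - \<tau>) * (- 1) + \<tau> * b" for \<tau>
  define C where "C \<tau> = (1 - \<tau>) * 1 + \<tau> * c" for \<tau>
  define D where "D \<tau> = (1 - \<tau>) * sqrt 3 + \<tau> * d" for \<tau>
  have mix: "(1 - \<tau>) * p + \<tau> * q < (1 - \<tau>) * p' + \<tau> * q'"
    if "p < p'" "q < q'" "\<tau> \<in> {0..1}" for p q p' q' \<tau> :: real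
  proof (cases "\<tau> = 0")
    case False
    then have "\<tau> * q < \<tau> * q'" "(1 - \<tau>) * p \<le> (1 - \<tau>) * p'"
      using that by (auto intro!: mult_left_mono)
    then show ?thesis by linarith
  qed (use that in simp)
  have s3: "1 < sqrt (3::real)" by simp
  have ordt: "A \<tau> < B \<tau>" "B \<tau> < C \<tau>" "C \<tau> < D \<tau>" if "\<tau> \<in> {0..1}" for \<tau>
    unfolding A_def B_def C_def D_def using that ord s3 by (intro mix; simp)+
  have tc: "two_cuts (A \<tau>) (B \<tau>) (C \<tau>) (D \<tau>)" if "\<tau> \<in> {0..1}" for \<tau>
    using ordt[OF that] by unfold_locales
  define Q where "Q \<tau> = quartic_potential (A \<tau>) (B \<tau>) (C \<tau>) (D \<tau>)" for \<tau>
  have Q0: "Q 0 = [:0, 0, -4, 0, 1:]"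
    using quartic_potential_symmetric by (simp add: Q_def A_def B_def C_def D_def)
  have Q1: "Q 1 = quartic_potential a b c d" by (simp add: Q_def A_def B_def C_def D_def)
  have Qcut: "in_P_cut m 2 (Q \<tau>)" if "\<tau> \<in> {0..1}" for \<tau>
    unfolding Q_def
    by (rule two_cut_data_imp_in_P_cut[OF two_cuts.two_cut_data_quartic[OF tc[OF that]]
        two_cuts.in_P_quartic_potential[OF tc[OF that] assms(1)]])
  define L where "L = sqrt 3 + \<bar>a\<bar> + \<bar>d\<bar>"
  have Qcont: "continuous_on {0..1} (\<lambda>\<tau>. coeff (Q \<tau>) j)" for j
    unfolding Q_def
  proof (rule quartic_potential_coeff_continuous[where L = L])
    show "continuous_on {0..1} A" "continuous_on {0..1} B" "continuous_on {0..1} C" "continuous_on {0..1} D"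
      unfolding A_def B_def C_def D_def by (intro continuous_intros)+
    fix \<tau> :: real assume \<tau>: "\<tau> \<in> {0..1}"
    have *: "\<bar>(1 - \<tau>) * p\<bar> \<le> \<bar>p\<bar>" "\<bar>\<tau> * p\<bar> \<le> \<bar>p\<bar>" for p
      using \<tau> by (auto simp: abs_mult intro: mult_left_le_one_le)
    show "- L \<le> A \<tau>" using *(1)[of "- sqrt 3"] *(2)[of a] by (simp add: A_def L_def)
    show "D \<tau> \<le> L" using *(1)[of "sqrt 3"] *(2)[of d] by (simp add: D_def L_def)
  qed (use ordt in auto)
  \<comment> \<open>Second leg: the support is now that of V, and the segment joins the quartic
    potential on it to V itself.\<close>
  define W where "W s = smult (1 - s) (Q 1) + smult s V" for s
  have Wcut: "in_P_cut m 2 (W s)" if "s \<in> {0..1}" for s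
  proof -
    interpret two_cuts a b c d using ord by unfold_locales
    show ?thesis
      unfolding W_def Q1 using that
      by (intro two_cut_data_imp_in_P_cut[OF two_cut_data_convex[OF two_cut_data_quartic data]]
          in_P_convex in_P_quartic_potential V assms(1)) auto
  qed
  have Wcont: "continuous_on S (\<lambda>s. coeff (W s) j)" for j S
    unfolding W_def by (simp, intro continuous_intros)
  \<comment> \<open>The legs meet at time 1/2, where \<open>Q 1\<close> and \<open>W 0\<close>
    coincide.\<close>
  define X where "X \<tau> = (if \<tau> \<le> 1 / 2 then Q (2 * \<tau>) else W (2 * \<tau> - 1))" for \<tau>
  have Xcut: "in_P_cut m 2 (X \<tau>)" if "\<tau> \<in> {0..1}" for \<tau>
    using that by (auto simp: X_def intro!: Qcut Wcut)
  have Xcont: "continuous_on {0..1} (\<lambda>\<tau>. coeff (X \<tau>) j)" for j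
  proof -
    have "continuous_on {0..1} (\<lambda>\<tau>. if \<tau> \<le> 1 / 2 then coeff (Q (2 * \<tau>)) j else coeff (W (2 * \<tau> - 1)) j)"
    proof (rule continuous_on_cases_le)
      show "continuous_on {\<tau> \<in> {0..1}. \<tau> \<le> 1 / 2} (\<lambda>\<tau>. coeff (Q (2 * \<tau>)) j)"
        by (rule continuous_on_compose2[OF Qcont]) (auto intro!: continuous_intros)
      show "continuous_on {\<tau> \<in> {0..1}. 1 / 2 \<le> \<tau>} (\<lambda>\<tau>. coeff (W (2 * \<tau> - 1)) j)"
        by (rule continuous_on_compose2[OF Wcont[of UNIV]]) (auto intro!: continuous_intros)
      show "coeff (Q (2 * \<tau>)) j = coeff (W (2 * \<tau> - 1)) j" if "\<tau> \<in> {0..1}" "\<tau> = 1 / 2" for \<tau>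
        unfolding that(2) by (simp add: W_def)
    qed (rule continuous_on_id)
    then show ?thesis unfolding X_def by (simp add: if_distrib[of "\<lambda>P. coeff P j"])
  qed
  define p where "p \<tau> j = coeff (X \<tau>) j - coeff [:0, 0, -4, 0, 1:] j" for \<tau> j
  have Vp: "V_t m (p \<tau>) = X \<tau>" if "\<tau> \<in> {0..1}" for \<tau>
    unfolding p_def using Xcut[OF that]
    by (intro V_t_coeffs assms(1)) (auto simp: in_P_cut_def in_P_def)
  have X1: "X 1 = V" by (simp add: X_def W_def)
  have p1: "p 1 j = t j" if "j \<in> {1..m}" for j
  proof -
    have "coeff V j = coeff [:0, 0, -4, 0, 1:] j + (\<Sum>i\<in>{1..m}. if i = j then t i else 0)"
      by (simp add: V_def V_t_def coeff_sum)
    also have "(\<Sum>i\<in>{1..m}. if i = j then t i else 0) = t j" using that by (subst sum.delta) auto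
    finally show ?thesis by (simp add: p_def X1)
  qed
  show ?thesis
  proof (intro exI[of _ p] conjI ballI)
    show "continuous_on {0..1} (\<lambda>\<tau>. p \<tau> j)" for j
      unfolding p_def by (intro continuous_intros Xcont)
    show "p 0 j = 0" for j by (simp add: p_def X_def Q0)
    show "p 1 j = t j" if "j \<in> {1..m}" for j by (rule p1[OF that])
    show "in_P_cut m 2 (V_t m (p \<tau>))" if "\<tau> \<in> {0..1}" for \<tau>
      using Xcut[OF that] by (simp only: Vp[OF that])
  qed
qed

end
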